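(* Let $K$ be the function field of a smooth, projective variety defined over $\overline{\mathbb{Q}}$. Let $q=p^r$ ($r\ge 1$) be a power of the prime number $p$. Let $f\in K[x]$ be a polynomial of the form $x^q+c$ where $c\notin\overline{\mathbb{Q}}$. Then for any non-periodic $\beta\in K$, the pair $(f,\beta)$ is eventually stable over $K$.
   Context: Varieties are irreducible. $f^n$ denotes the $n$-th iterate of $f$. The point $\beta$ is periodic for $f$ if $f^n(\beta)=\beta$ for some $n\ge1$. The pair $(f,\beta)$ is eventually stable over $K$ if the number of irreducible factors over $K$ of the polynomial $f^n(x)-\beta$ is bounded uniformly over all $n$. *)

theory Defs
  imports
    "HOL-Analysis.Analysis"
    "HOL-Library.Poly_Mapping"
    "HOL-Algebra.QuotRing"
    "HOL-Algebra.Algebraic_Closure_Type"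
begin

unbundle no fps_syntax

section \<open>Projective varieties over an algebraically closed field\<close>

text \<open>
  Polynomials over \<open>'a\<close> in the variables indexed by \<open>'n\<close>: a polynomial maps each
  exponent vector to its coefficient.
\<close>

type_synonym ('a, 'n) mpoly = "('n \<Rightarrow>\<^sub>0 nat) \<Rightarrow>\<^sub>0 'a"

definition mp_eval :: "('a::comm_ring_1, 'n::finite) mpoly \<Rightarrow> 'a^'n \<Rightarrow> 'a" where
  "mp_eval F a =
     (\<Sum>m\<in>Poly_Mapping.keys F. Poly_Mapping.lookup F m * (\<Prod>i\<in>UNIV. (a $ i) ^ Poly_Mapping.lookup m i))"

definition mp_const :: "'a::comm_ring_1 \<Rightarrow> ('a, 'n::finite) mpoly" where
  "mp_const t = Poly_Mapping.single 0 t"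

text \<open>The zero polynomial is homogeneous of every degree.\<close>

definition homogeneous :: "nat \<Rightarrow> ('a::comm_ring_1, 'n::finite) mpoly \<Rightarrow> bool" where
  "homogeneous d F \<longleftrightarrow> (\<forall>m\<in>Poly_Mapping.keys F. (\<Sum>i\<in>UNIV. Poly_Mapping.lookup m i) = d)"

text \<open>
  The vector of formal partial derivatives of \<open>F\<close>, evaluated at \<open>a\<close>. When \<open>lookup m i = 0\<close>
  the truncated exponent is harmless, because the summand has the factor \<open>0\<close>.
\<close>

definition mp_gradient :: "('a::comm_ring_1, 'n::finite) mpoly \<Rightarrow> 'a^'n \<Rightarrow> 'a^'n" where
  "mp_gradient F a = (\<chi> i. \<Sum>m\<in>Poly_Mapping.keys F. Poly_Mapping.lookup F m * of_nat (Poly_Mapping.lookup m i) *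
     (\<Prod>j\<in>UNIV. (a $ j) ^ (if j = i then Poly_Mapping.lookup m j - 1 else Poly_Mapping.lookup m j)))"

text \<open>
  A point of the projective space of dimension \<open>CARD('n) - 1\<close> is represented by all of its
  homogeneous coordinate vectors, so a subset of projective space is the corresponding cone
  in \<open>'a^'n\<close> with the origin removed. The empty set is closed.
\<close>

definition proj_closed :: "('a::field^'n::finite) set \<Rightarrow> bool" where
  "proj_closed V \<longleftrightarrow> (\<exists>S. (\<forall>F\<in>S. \<exists>d. homogeneous d F) \<and>
     V = {a. a \<noteq> 0 \<and> (\<forall>F\<in>S. mp_eval F a = 0)})"

definition projective_variety :: "('a::field^'n::finite) set \<Rightarrow> bool" where
  "projective_variety V \<longleftrightarrow> proj_closed V \<and> V \<noteq> {} \<and>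
     (\<forall>Y Z. proj_closed Y \<longrightarrow> proj_closed Z \<longrightarrow> V = Y \<union> Z \<longrightarrow> V = Y \<or> V = Z)"

text \<open>The Krull dimension in the Zariski topology.\<close>

definition proj_dim :: "('a::field^'n::finite) set \<Rightarrow> enat" where
  "proj_dim V = Sup {enat l | l. \<exists>Z. (\<forall>i\<le>l. projective_variety (Z i) \<and> Z i \<subseteq> V) \<and>
                                   (\<forall>i<l. Z i \<subset> Z (Suc i))}"

text \<open>
  The Jacobian criterion in homogeneous coordinates: at every point, the gradients of the
  homogeneous polynomials vanishing on \<open>V\<close> span a space whose dimension (the rank of the Jacobian
  matrix of generators of the ideal) is the codimension \<open>(CARD('n) - 1) - dim V\<close>.
\<close>

definition smooth_projective_variety :: "('a::field^'n::finite) set \<Rightarrow> bool" where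
  "smooth_projective_variety V \<longleftrightarrow> projective_variety V \<and>
     (\<forall>a\<in>V. enat (vec.dim {mp_gradient F a | F. (\<exists>d. homogeneous d F) \<and> (\<forall>b\<in>V. mp_eval F b = 0)})
             + proj_dim V + 1 = enat CARD('n))"

section \<open>The function field\<close>

text \<open>
  Rational functions on \<open>V\<close> are fractions \<open>g/h\<close> of homogeneous polynomials of the same degree,
  \<open>h\<close> not in the homogeneous ideal of \<open>V\<close>, with \<open>g/h\<close> and \<open>g'/h'\<close> identified if
  \<open>g h' - g' h\<close> is in that ideal, i.e. vanishes on \<open>V\<close>.
\<close>

definition rat_fracs ::
  "('a::field^'n::finite) set \<Rightarrow> (('a, 'n) mpoly \<times> ('a, 'n) mpoly) set" where
  "rat_fracs V = {(g, h). (\<exists>d. homogeneous d g \<and> homogeneous d h) \<and> (\<exists>a\<in>V. mp_eval h a \<noteq> 0)}"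

definition rat_rel ::
  "('a::field^'n::finite) set \<Rightarrow>
   ((('a, 'n) mpoly \<times> ('a, 'n) mpoly) \<times> (('a, 'n) mpoly \<times> ('a, 'n) mpoly)) set" where
  "rat_rel V = {((g, h), (g', h')). (g, h) \<in> rat_fracs V \<and> (g', h') \<in> rat_fracs V \<and>
     (\<forall>a\<in>V. mp_eval (g * h' - g' * h) a = 0)}"

definition function_field ::
  "('a::field^'n::finite) set \<Rightarrow> (('a, 'n) mpoly \<times> ('a, 'n) mpoly) set ring" where
  "function_field V = \<lparr>
     carrier = rat_fracs V // rat_rel V,
     monoid.mult = (\<lambda>A B. \<Union>(g, h)\<in>A. \<Union>(g', h')\<in>B. rat_rel V `` {(g * g', h * h')}),
     one = rat_rel V `` {(1, 1)},
     ring.zero = rat_rel V `` {(0, 1)},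
     add = (\<lambda>A B. \<Union>(g, h)\<in>A. \<Union>(g', h')\<in>B. rat_rel V `` {(g * h' + g' * h, h * h')})\<rparr>"

definition constant_functions ::
  "('a::field^'n::finite) set \<Rightarrow> (('a, 'n) mpoly \<times> ('a, 'n) mpoly) set set" where
  "constant_functions V = {rat_rel V `` {(mp_const t, 1)} | t. True}"

section \<open>Eventual stability\<close>

definition iter_poly :: "'k::comm_ring_1 poly \<Rightarrow> nat \<Rightarrow> 'k poly" where
  "iter_poly f n = (pcompose f ^^ n) [:0, 1:]"

definition periodic_point :: "'k::comm_ring_1 poly \<Rightarrow> 'k \<Rightarrow> bool" where
  "periodic_point f \<beta> \<longleftrightarrow> (\<exists>n\<ge>1. poly (iter_poly f n) \<beta> = \<beta>)"

text \<open>
  For a nonconstant polynomial over a field a unit can be absorbed into one of the factors, so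
  no unit appears here.
\<close>

definition irreducible_factorization :: "'k::field poly \<Rightarrow> 'k poly multiset \<Rightarrow> bool" where
  "irreducible_factorization P A \<longleftrightarrow> (\<forall>p\<in>#A. Factorial_Ring.irreducible p) \<and> prod_mset A = P"

lemma irreducible_factorization_exists:
  fixes P :: "'k::field poly"
  assumes "Polynomial.degree P > 0"
  shows "\<exists>A. irreducible_factorization P A"
  using assms
proof (induction "Polynomial.degree P" arbitrary: P rule: less_induct)
  case less
  show ?case
  proof (cases "Factorial_Ring.irreducible P")
    case True
    then have "irreducible_factorization P {#P#}"
      by (simp add: irreducible_factorization_def)
    then show ?thesis by blast
  next
    case False
    from less.prems have "P \<noteq> 0" by auto
    with less.prems have "\<not> is_unit P"
      by (simp add: is_unit_iff_degree)
    with False \<open>P \<noteq> 0\<close> obtain a b where ab: "P = a * b" "\<not> is_unit a" "\<not> is_unit b"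
      unfolding Factorial_Ring.irreducible_def by blast
    with \<open>P \<noteq> 0\<close> have "a \<noteq> 0" "b \<noteq> 0" by auto
    with ab have d: "Polynomial.degree a > 0" "Polynomial.degree b > 0" "Polynomial.degree P = Polynomial.degree a + Polynomial.degree b"
      by (auto simp: is_unit_iff_degree degree_mult_eq)
    obtain A B where "irreducible_factorization a A" "irreducible_factorization b B"
      using less.hyps[of a] less.hyps[of b] d by auto
    then have "irreducible_factorization P (A + B)"
      using ab by (auto simp: irreducible_factorization_def)
    then show ?thesis by blast
  qed
qed

text \<open>
  Irreducible factors are counted with multiplicity. All factorizations of the same
  polynomial have the same size, by unique factorization.
\<close>

definition eventually_stable :: "'k::field poly \<Rightarrow> 'k \<Rightarrow> bool" where
  "eventually_stable f \<beta> \<longleftrightarrow>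
     (\<exists>B. \<forall>n A. irreducible_factorization (iter_poly f n - [:\<beta>:]) A \<longrightarrow> size A \<le> B)"

end

theory Submission
  imports Defs
begin

text \<open>
  Let \<open>f = x\<^sup>q + c\<close>, let \<open>C\<close> be the field of constants and embed \<open>K\<close> into its algebraic closure.

  If \<open>\<beta>\<close> is transcendental over \<open>C(c)\<close>, take a valuation at a pole of \<open>\<beta>\<close> over \<open>C(c)\<close>. All
  solutions of \<open>f\<^sup>n(x) = \<beta>\<close> have valuation \<open>v(\<beta>)/q\<^sup>n\<close>, whereas the values of the constant
  coefficients of factors over \<open>K\<close> have bounded denominators. So every factor has degree at
  least a constant times \<open>q\<^sup>n\<close>.

  If \<open>\<beta>\<close> is algebraic over \<open>C(c)\<close>, look at a pole of \<open>c\<close>. Up to a fixed factor, the late preimages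
  of \<open>\<beta>\<close> are \<open>q\<close>-th roots of 1-units, hence by Hensel's lemma they all lie in the closure of one
  finite extension of \<open>\<rat>(c)\<close>. This closure is linearly disjoint from \<open>C\<close> over its residue field, a
  number field; therefore all factors of \<open>f\<^sup>n(x) - \<beta>\<close> over \<open>K\<close> have coefficients in a subfield \<open>K'\<close> of
  bounded degree over \<open>\<rat>(c)\<close>. Sending \<open>c\<close> to a transcendental \<open>p\<close>-adic integer gives a discrete
  valuation on \<open>K'\<close> with finite residue field. If \<open>\<beta>\<close> is not integral, argue as in the first case.
  Otherwise \<open>\<beta>\<close> is periodic in the residue field, because \<open>f\<close> is injective modulo \<open>p\<close>. Every
  \<open>n\<close>-th preimage \<open>x\<close> reduces to the same point of the cycle, which is represented by a point
  \<open>r\<^sub>n\<close> of the forward orbit of \<open>\<beta>\<close>. Since \<open>x\<^sup>q - y\<^sup>q \<equiv> (x - y)\<^sup>q\<close> modulo \<open>p (x - y)\<close>, and since \<open>\<beta>\<close> is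
  not periodic, \<open>v(x - r\<^sub>n)\<close> is positive and \<open>O(q\<^sup>-\<^sup>n)\<close>. Evaluating a factor at \<open>r\<^sub>n\<close> shows again that
  its degree is at least a constant times \<open>q\<^sup>n\<close>.
\<close>

text \<open>Since the polynomial has degree q^n, it is enough that all its irreducible factors over
  K have degree at least q^n / N with N independent of n. A factor enters only as the multiset A of
  its roots, through the property that the product of the r - x over x in A lies in K for every r in
  K; this form is easy to transfer to smaller fields.

  All fields and valuation rings are subsets of one algebraically closed field, so that roots,
  constants and places are compared without embeddings. The valuations come from Chevalley's theorem
  and their value groups are out of control; only elements of bounded degree over a rational
  function field are measured, and degrees are bounded because K is finitely generated over C.

  The obstacle in the second case: C contains all roots of p and all roots of unity, so a p-adic
  valuation on it is not discrete and has an infinite residue field. Neither the bound on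
  denominators nor a pigeonhole argument for periodicity is available over K. The detour through the
  pole of c finds a subfield of arithmetic nature that still contains the values of all monic
  factors at its own points.\<close>

hide_const (open) Poly_Mapping.degree Polynomials.degree up_ring.monom up_ring.coeff
  Divisibility.irreducible module.smult Polynomials.lead_coeff Divisibility.prime

section \<open>Subrings and subfields as subsets, and polynomials over them\<close>

definition ring_set :: "'a::comm_ring_1 set \<Rightarrow> bool" where
  "ring_set R \<longleftrightarrow> 1 \<in> R \<and> (\<forall>x\<in>R. \<forall>y\<in>R. x - y \<in> R \<and> x * y \<in> R)"

definition field_set :: "'a::field set \<Rightarrow> bool" where
  "field_set F \<longleftrightarrow> ring_set F \<and> (\<forall>x\<in>F. inverse x \<in> F)"

definition poly_over :: "'a::zero set \<Rightarrow> 'a poly \<Rightarrow> bool" where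
  "poly_over S P \<longleftrightarrow> (\<forall>i. coeff P i \<in> S)"

context
  fixes R :: "'a::idom set"
  assumes R: "ring_set R"
begin

lemma ring_set_1: "1 \<in> R" using R by (simp add: ring_set_def)
lemma ring_set_diff: "x \<in> R \<Longrightarrow> y \<in> R \<Longrightarrow> x - y \<in> R" using R by (simp add: ring_set_def)
lemma ring_set_mult: "x \<in> R \<Longrightarrow> y \<in> R \<Longrightarrow> x * y \<in> R" using R by (simp add: ring_set_def)
lemma ring_set_0: "0 \<in> R" using ring_set_diff[OF ring_set_1 ring_set_1] by simp
lemma ring_set_uminus: "x \<in> R \<Longrightarrow> - x \<in> R" using ring_set_diff[OF ring_set_0] by simp
lemma ring_set_add: "x \<in> R \<Longrightarrow> y \<in> R \<Longrightarrow> x + y \<in> R"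
  using ring_set_diff[of x "-y"] ring_set_uminus by simp
lemma ring_set_power: "x \<in> R \<Longrightarrow> x ^ n \<in> R"
  by (induction n) (auto intro: ring_set_1 ring_set_mult)
lemma ring_set_sum: "(\<And>i. i \<in> I \<Longrightarrow> u i \<in> R) \<Longrightarrow> sum u I \<in> R"
  by (induction I rule: infinite_finite_induct) (auto intro: ring_set_0 ring_set_add)
lemma ring_set_prod: "(\<And>i. i \<in> I \<Longrightarrow> u i \<in> R) \<Longrightarrow> prod u I \<in> R"
  by (induction I rule: infinite_finite_induct) (auto intro: ring_set_1 ring_set_mult)
lemma ring_set_of_nat: "of_nat n \<in> R"
  by (induction n) (auto intro: ring_set_0 ring_set_1 ring_set_add)
lemma ring_set_of_int: "of_int n \<in> R"
  by (cases n rule: int_cases2) (auto intro: ring_set_of_nat ring_set_uminus)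
lemma ring_set_prod_mset: "(\<And>x. x \<in># A \<Longrightarrow> u x \<in> R) \<Longrightarrow> (\<Prod>x\<in>#A. u x) \<in> R"
  by (induction A) (auto intro: ring_set_1 ring_set_mult)

lemma poly_over_0: "poly_over R 0" by (simp add: poly_over_def ring_set_0)
lemma poly_over_const: "x \<in> R \<Longrightarrow> poly_over R [:x:]"
  by (auto simp: poly_over_def coeff_pCons ring_set_0 split: nat.splits)
lemma poly_over_1: "poly_over R 1"
  using poly_over_const[OF ring_set_1] by (simp add: one_pCons)
lemma poly_over_pCons: "x \<in> R \<Longrightarrow> poly_over R P \<Longrightarrow> poly_over R (pCons x P)"
  by (auto simp: poly_over_def coeff_pCons ring_set_0 split: nat.splits)
lemma poly_over_add: "poly_over R P \<Longrightarrow> poly_over R Q \<Longrightarrow> poly_over R (P + Q)"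
  by (auto simp: poly_over_def ring_set_add)
lemma poly_over_diff: "poly_over R P \<Longrightarrow> poly_over R Q \<Longrightarrow> poly_over R (P - Q)"
  by (auto simp: poly_over_def ring_set_diff)
lemma poly_over_mult: "poly_over R P \<Longrightarrow> poly_over R Q \<Longrightarrow> poly_over R (P * Q)"
  by (auto simp: poly_over_def coeff_mult intro!: ring_set_sum ring_set_mult)
lemma poly_over_smult: "x \<in> R \<Longrightarrow> poly_over R Q \<Longrightarrow> poly_over R (smult x Q)"
  by (auto simp: poly_over_def intro!: ring_set_mult)
lemma poly_over_monom: "x \<in> R \<Longrightarrow> poly_over R (monom x n)"
  by (auto simp: poly_over_def ring_set_0)
lemma poly_over_sum: "(\<And>i. i \<in> I \<Longrightarrow> poly_over R (u i)) \<Longrightarrow> poly_over R (sum u I)"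
  by (induction I rule: infinite_finite_induct) (auto intro: poly_over_0 poly_over_add)
lemma poly_over_power: "poly_over R P \<Longrightarrow> poly_over R (P ^ n)"
  by (induction n) (auto intro: poly_over_1 poly_over_mult)
lemma poly_over_pderiv: "poly_over R P \<Longrightarrow> poly_over R (pderiv P)"
  unfolding poly_over_def coeff_pderiv by (intro allI ring_set_mult ring_set_of_nat) auto
lemma poly_in_ring_set: "poly_over R P \<Longrightarrow> x \<in> R \<Longrightarrow> poly P x \<in> R"
  unfolding poly_over_def poly_altdef by (intro ring_set_sum ring_set_mult ring_set_power) auto

lemma poly_over_synthetic_div: "poly_over R P \<Longrightarrow> s \<in> R \<Longrightarrow> poly_over R (synthetic_div P s)"
proof (induction P)
  case (pCons a P)
  then have "poly_over R P" unfolding poly_over_def by (metis coeff_pCons_Suc)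
  then show ?case using pCons by (simp add: synthetic_div_pCons poly_over_pCons poly_in_ring_set)
qed (simp add: poly_over_0)

end

lemma poly_over_mono: "poly_over S P \<Longrightarrow> S \<subseteq> T \<Longrightarrow> poly_over T P"
  by (auto simp: poly_over_def)

lemma field_setD: "field_set F \<Longrightarrow> ring_set F" by (simp add: field_set_def)
lemma field_set_inverse: "field_set F \<Longrightarrow> x \<in> F \<Longrightarrow> inverse x \<in> F" by (simp add: field_set_def)
lemma field_set_divide: "field_set F \<Longrightarrow> x \<in> F \<Longrightarrow> y \<in> F \<Longrightarrow> x / y \<in> F"
  by (simp add: divide_inverse ring_set_mult[OF field_setD] field_set_inverse)

section \<open>Linear spans and finite extensions\<close>

definition lspan :: "'a::field set \<Rightarrow> 'a set \<Rightarrow> 'a set" where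
  "lspan F B = {\<Sum>b\<in>B. a b * b | a. \<forall>b\<in>B. a b \<in> F}"

lemma lspanE:
  assumes "y \<in> lspan F B"
  obtains a where "\<And>b. b \<in> B \<Longrightarrow> a b \<in> F" "y = (\<Sum>b\<in>B. a b * b)"
  using assms unfolding lspan_def by blast

lemma lspan_add:
  assumes "ring_set F" "x \<in> lspan F B" "y \<in> lspan F B" shows "x + y \<in> lspan F B"
proof -
  obtain a where a: "\<And>b. b \<in> B \<Longrightarrow> a b \<in> F" "x = (\<Sum>b\<in>B. a b * b)" using assms(2) by (rule lspanE) auto
  obtain a' where a': "\<And>b. b \<in> B \<Longrightarrow> a' b \<in> F" "y = (\<Sum>b\<in>B. a' b * b)" using assms(3) by (rule lspanE) auto
  show ?thesis unfolding lspan_def mem_Collect_eq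
    using a a' by (intro exI[of _ "\<lambda>b. a b + a' b"])
      (auto simp: sum.distrib distrib_right intro: ring_set_add[OF assms(1)])
qed

lemma lspan_scale:
  assumes "ring_set F" "r \<in> F" "x \<in> lspan F B" shows "r * x \<in> lspan F B"
proof -
  obtain a where a: "\<And>b. b \<in> B \<Longrightarrow> a b \<in> F" "x = (\<Sum>b\<in>B. a b * b)" using assms(3) by (rule lspanE) auto
  show ?thesis unfolding lspan_def mem_Collect_eq
    using a assms by (intro exI[of _ "\<lambda>b. r * a b"])
      (auto simp: sum_distrib_left mult.assoc intro: ring_set_mult[OF assms(1)])
qed

lemma lspan_0: "ring_set F \<Longrightarrow> 0 \<in> lspan F B"
  unfolding lspan_def by (auto intro!: exI[of _ "\<lambda>_. 0"] ring_set_0)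

lemma lspan_sum:
  "ring_set F \<Longrightarrow> (\<And>i. i \<in> I \<Longrightarrow> u i \<in> lspan F B) \<Longrightarrow> sum u I \<in> lspan F B"
  by (induction I rule: infinite_finite_induct) (auto intro: lspan_0 lspan_add)

lemma lspan_base:
  assumes "ring_set F" "finite B" "b \<in> B" shows "b \<in> lspan F B"
proof -
  have "(\<Sum>x\<in>B. (if x = b then 1 else 0) * x) = (\<Sum>x\<in>B. if x = b then x else 0)"
    by (intro sum.cong) auto
  also have "\<dots> = b" using assms by simp
  finally have "(\<Sum>x\<in>B. (if x = b then 1 else 0) * x) = b" .
  then show ?thesis unfolding lspan_def using ring_set_0[OF assms(1)] ring_set_1[OF assms(1)]
    by (intro CollectI exI[of _ "\<lambda>x. if x = b then 1 else 0"] conjI) simp_all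
qed

text \<open>Tower law: expanding the E-coefficients of y over F leaves products of elements of the
  two spanning sets.\<close>

lemma lspan_trans:
  assumes "ring_set F" "finite B" "finite B'" "E \<subseteq> lspan F B" "y \<in> lspan E B'"
  shows "y \<in> lspan F ((\<lambda>(b, b'). b * b') ` (B \<times> B'))"
proof -
  let ?P = "(\<lambda>(b, b'). b * b') ` (B \<times> B')"
  obtain a where a: "\<And>b. b \<in> B' \<Longrightarrow> a b \<in> E" "y = (\<Sum>b\<in>B'. a b * b)" using assms(5) by (rule lspanE) auto
  have "a b * b \<in> lspan F ?P" if b: "b \<in> B'" for b
  proof -
    obtain c where c: "\<And>x. x \<in> B \<Longrightarrow> c x \<in> F" "a b = (\<Sum>x\<in>B. c x * x)"
      using subsetD[OF assms(4) a(1)[OF b]] by (rule lspanE) auto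
    have "a b * b = (\<Sum>x\<in>B. c x * (x * b))" by (simp add: c(2) sum_distrib_right mult.assoc)
    also have "\<dots> \<in> lspan F ?P"
      using assms(1,2,3) b c(1) by (intro lspan_sum lspan_scale lspan_base) auto
    finally show ?thesis .
  qed
  then show ?thesis unfolding a(2) using assms(1) by (intro lspan_sum) auto
qed

text \<open>More unknowns than equations, by elimination of one spanning element \<open>b\<close>:
  if some \<open>u k\<close> involves \<open>b\<close>, subtract multiples of it from the others.
  The family is indexed, so repeated vectors are allowed, as is needed for the powers of an
  element.\<close>

lemma lspan_dependent:
  assumes F: "field_set F" and "finite B" "finite I" "card B < card I" "\<And>i. i \<in> I \<Longrightarrow> u i \<in> lspan F B"
  shows "\<exists>a. (\<forall>i\<in>I. a i \<in> F) \<and> (\<exists>i\<in>I. a i \<noteq> 0) \<and> (\<Sum>i\<in>I. a i * u i) = 0"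
  using assms(2-)
proof (induction B arbitrary: I u rule: finite_induct)
  case empty
  then have "I \<noteq> {}" "\<And>i. i \<in> I \<Longrightarrow> u i = 0" by (auto simp: lspan_def)
  then show ?case by (intro exI[of _ "\<lambda>_. 1"]) (auto intro: ring_set_1[OF field_setD[OF F]])
next
  case (insert b B)
  note R = field_setD[OF F]
  have "\<forall>i\<in>I. \<exists>t v. t \<in> F \<and> v \<in> lspan F B \<and> u i = t * b + v"
  proof
    fix i assume iI: "i \<in> I"
    obtain a where a: "\<And>x. x \<in> insert b B \<Longrightarrow> a x \<in> F" "u i = (\<Sum>x\<in>insert b B. a x * x)"
      using insert.prems(3)[OF iI] by (rule lspanE) auto
    show "\<exists>t v. t \<in> F \<and> v \<in> lspan F B \<and> u i = t * b + v"
      using a insert.hyps by (intro exI[of _ "a b"] exI[of _ "\<Sum>x\<in>B. a x * x"]) (auto simp: lspan_def)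
  qed
  then obtain t v where tv: "\<And>i. i \<in> I \<Longrightarrow> t i \<in> F" "\<And>i. i \<in> I \<Longrightarrow> v i \<in> lspan F B"
    "\<And>i. i \<in> I \<Longrightarrow> u i = t i * b + v i" by metis
  show ?case
  proof (cases "\<forall>i\<in>I. t i = 0")
    case True
    then show ?thesis using insert.IH[OF insert.prems(1), of u] insert.prems insert.hyps tv by auto
  next
    case False
    then obtain k where k: "k \<in> I" "t k \<noteq> 0" by blast
    define r where "r i = t i / t k" for i
    have r: "r i \<in> F" if "i \<in> I" for i using that tv k F by (simp add: r_def field_set_divide)
    have "u i - r i * u k \<in> lspan F B" if "i \<in> I - {k}" for i
    proof -
      have "u i - r i * u k = v i + (- r i) * v k" using that k by (simp add: tv r_def field_simps)
      moreover have "v i + (- r i) * v k \<in> lspan F B"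
        using that tv(2) k(1) r R by (intro lspan_add lspan_scale ring_set_uminus) auto
      ultimately show ?thesis by (simp only:)
    qed
    moreover have "card B < card (I - {k})"
      using insert.prems insert.hyps k by (simp add: card_Diff_singleton)
    ultimately obtain a where a: "\<forall>i\<in>I - {k}. a i \<in> F" "\<exists>i\<in>I - {k}. a i \<noteq> 0"
      "(\<Sum>i\<in>I - {k}. a i * (u i - r i * u k)) = 0"
      using insert.IH[of "I - {k}" "\<lambda>i. u i - r i * u k"] insert.prems by auto
    \<comment> \<open>The coefficient at the pivot collects what was subtracted from the other
      vectors.\<close>
    define a' where "a' i = (if i = k then - (\<Sum>i\<in>I - {k}. a i * r i) else a i)" for i
    have "(\<Sum>i\<in>I. a' i * u i) = a' k * u k + (\<Sum>i\<in>I - {k}. a' i * u i)"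
      using insert.prems k by (intro sum.remove) auto
    also have "\<dots> = (\<Sum>i\<in>I - {k}. a i * (u i - r i * u k))"
      by (simp add: a'_def right_diff_distrib sum_subtractf sum_distrib_right mult.assoc)
    finally have "(\<Sum>i\<in>I. a' i * u i) = 0" using a by simp
    moreover have "\<forall>i\<in>I. a' i \<in> F" using a r R
      by (auto simp: a'_def intro!: ring_set_uminus ring_set_sum ring_set_mult)
    moreover have "\<exists>i\<in>I. a' i \<noteq> 0" using a(2) by (auto simp: a'_def)
    ultimately show ?thesis by blast
  qed
qed

section \<open>Algebraic elements of bounded degree and finite extensions\<close>

definition algdeg :: "'a::field set \<Rightarrow> nat \<Rightarrow> 'a set" where
  "algdeg S d = {y. \<exists>P. P \<noteq> 0 \<and> poly_over S P \<and> degree P \<le> d \<and> poly P y = 0}"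

definition algover :: "'a::field set \<Rightarrow> 'a set" where
  "algover S = {y. \<exists>P. P \<noteq> 0 \<and> poly_over S P \<and> poly P y = 0}"

lemma algdeg_algover: "y \<in> algdeg S d \<Longrightarrow> y \<in> algover S"
  unfolding algdeg_def algover_def by blast

lemma algover_algdeg: "y \<in> algover S \<Longrightarrow> \<exists>d. y \<in> algdeg S d"
  unfolding algdeg_def algover_def by blast

lemma algdeg_mono: "y \<in> algdeg S d \<Longrightarrow> S \<subseteq> T \<Longrightarrow> d \<le> e \<Longrightarrow> y \<in> algdeg T e"
  unfolding algdeg_def using poly_over_mono order_trans by blast

lemma algover_mono: "y \<in> algover S \<Longrightarrow> S \<subseteq> T \<Longrightarrow> y \<in> algover T"
  unfolding algover_def using poly_over_mono by blast

lemma algdegI_sum: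
  assumes "ring_set S" "\<And>i. i \<le> d \<Longrightarrow> a i \<in> S" "\<exists>i\<le>d. a i \<noteq> 0" "(\<Sum>i\<le>d. a i * y ^ i) = 0"
  shows "y \<in> algdeg S d"
proof -
  define P where "P = (\<Sum>i\<le>d. monom (a i) i)"
  have c: "coeff P i = (if i \<le> d then a i else 0)" for i
    by (simp add: P_def coeff_sum sum.delta)
  have "P \<noteq> 0" using assms(3) c by (metis coeff_0)
  moreover have "poly_over S P" unfolding poly_over_def c using assms by (auto intro: ring_set_0)
  moreover have "degree P \<le> d" by (rule degree_le) (auto simp: c)
  moreover have "poly P y = 0" using assms(4) by (simp add: P_def poly_sum poly_monom)
  ultimately show ?thesis unfolding algdeg_def by blast
qed

lemma algdeg_spanI:
  assumes "field_set F" "finite B" "card B \<le> n" "\<And>i. y ^ i \<in> lspan F B"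
  shows "y \<in> algdeg F n"
proof -
  obtain a where "\<forall>i\<in>{..n}. a i \<in> F" "\<exists>i\<in>{..n}. a i \<noteq> 0" "(\<Sum>i\<in>{..n}. a i * y ^ i) = 0"
    using lspan_dependent[OF assms(1,2), of "{..n}" "\<lambda>i. y ^ i"] assms by auto
  then show ?thesis by (intro algdegI_sum[of F n a]) (auto intro: field_setD assms)
qed

text \<open>Long division by a polynomial \<open>Q\<close> that kills y: subtracting a multiple of
  \<open>Q\<close> cancels the leading term and keeps the value at y, until the degree falls below
  that of \<open>Q\<close>.\<close>

lemma power_in_lspan:
  assumes E: "field_set E" and y: "y \<in> algdeg E d" and P: "poly_over E P"
  shows "poly P y \<in> lspan E ((\<lambda>i. y ^ i) ` {..<d})"
proof -
  note R = field_setD[OF E]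
  obtain Q where Q: "Q \<noteq> 0" "poly_over E Q" "degree Q \<le> d" "poly Q y = 0" using y unfolding algdeg_def by blast
  have "degree Q \<noteq> 0" using Q by (metis degree_eq_zeroE poly_const_conv pCons_0_0)
  show ?thesis using P
  proof (induction "degree P" arbitrary: P rule: less_induct)
    case less
    show ?case
    proof (cases "degree P < degree Q")
      case True
      have "poly P y = (\<Sum>i\<le>degree P. coeff P i * y ^ i)" by (rule poly_altdef)
      also have "\<dots> \<in> lspan E ((\<lambda>i. y ^ i) ` {..<d})"
        using R less.prems True Q(3)
        by (intro lspan_sum lspan_scale lspan_base) (auto simp: poly_over_def)
      finally show ?thesis .
    next
      case False
      define k where "k = lead_coeff P / lead_coeff Q"
      define P' where "P' = P - monom k (degree P - degree Q) * Q"
      have kE: "k \<in> E" using less.prems Q E by (auto simp: k_def poly_over_def intro: field_set_divide)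
      have o: "poly_over E P'" unfolding P'_def using R kE less.prems Q
        by (auto intro!: poly_over_diff poly_over_mult poly_over_monom)
      have e: "poly P' y = poly P y" by (simp add: P'_def Q)
      have "degree P > 0" using False \<open>degree Q \<noteq> 0\<close> by simp
      have dm: "degree (monom k (degree P - degree Q) * Q) \<le> degree P"
      proof -
        have "degree (monom k (degree P - degree Q) * Q) \<le> degree (monom k (degree P - degree Q)) + degree Q"
          by (rule degree_mult_le)
        also have "\<dots> \<le> degree P" using False degree_monom_le[of k "degree P - degree Q"] by simp
        finally show ?thesis .
      qed
      have "coeff (monom k (degree P - degree Q) * Q) (degree P) = lead_coeff P"
        using False Q(1) by (simp add: coeff_monom_mult k_def)
      then have "coeff P' (degree P) = 0" by (simp add: P'_def)
      moreover have "degree P' \<le> degree P" unfolding P'_def using dm by (intro degree_diff_le) auto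
      ultimately have "degree P' < degree P"
        using \<open>degree P > 0\<close> eq_zero_or_degree_less[of P' "degree P"] by auto
      then show ?thesis using less.hyps[of P'] o e by simp
    qed
  qed
qed

text \<open>In an equation of least degree for x the constant term a is nonzero, since otherwise x
  could be cancelled. Solving a + x Q(x) = 0 for the inverse of x stays inside A.\<close>

lemma ring_set_finite_span_field:
  assumes F: "field_set F" and A: "ring_set A" "F \<subseteq> A" "finite B" "A \<subseteq> lspan F B"
  shows "field_set A"
proof -
  have "inverse x \<in> A" if x: "x \<in> A" for x
  proof (cases "x = 0")
    case True then show ?thesis using A ring_set_0 by simp
  next
    case False
    have "x \<in> algdeg F (card B)"
      using A x by (intro algdeg_spanI[OF F A(3)]) (auto intro: ring_set_power)
    then have "\<exists>P. P \<noteq> 0 \<and> poly_over F P \<and> poly P x = 0" unfolding algdeg_def by blast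
    then obtain P where P: "P \<noteq> 0" "poly_over F P" "poly P x = 0"
      and least: "\<And>Q. Q \<noteq> 0 \<Longrightarrow> poly_over F Q \<Longrightarrow> poly Q x = 0 \<Longrightarrow> degree P \<le> degree Q"
      using ex_has_least_nat[of "\<lambda>P. P \<noteq> 0 \<and> poly_over F P \<and> poly P x = 0" _ degree] by metis
    obtain a Q where aQ: "P = pCons a Q" by (cases P)
    have Qo: "poly_over F Q" "a \<in> F" using P(2) unfolding aQ poly_over_def
      by (metis coeff_pCons_Suc, metis coeff_pCons_0)
    have "a \<noteq> 0"
    proof
      assume "a = 0"
      then have "Q \<noteq> 0" "poly Q x = 0" using P aQ False by auto
      then have "degree P \<le> degree Q" using least Qo by blast
      then show False using aQ \<open>Q \<noteq> 0\<close> by simp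
    qed
    have "a + x * poly Q x = 0" using P aQ by simp
    then have "inverse x = - poly Q x / a" using \<open>a \<noteq> 0\<close> False by (simp add: field_simps add_eq_0_iff)
    also have "\<dots> = - (inverse a) * poly Q x" by (simp add: field_simps)
    also have "\<dots> \<in> A" using A Qo F x
      by (intro ring_set_mult ring_set_uminus) (auto intro: field_set_inverse poly_in_ring_set poly_over_mono)
    finally show ?thesis .
  qed
  then show ?thesis using A by (simp add: field_set_def)
qed

definition finext :: "'a::field set \<Rightarrow> 'a set \<Rightarrow> bool" where
  "finext F E \<longleftrightarrow> field_set F \<and> field_set E \<and> F \<subseteq> E \<and> (\<exists>B. finite B \<and> E \<subseteq> lspan F B)"

lemma finext_field: "finext F E \<Longrightarrow> field_set E"
  and finext_base: "finext F E \<Longrightarrow> field_set F"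
  and finext_subset: "finext F E \<Longrightarrow> F \<subseteq> E"
  by (auto simp: finext_def)

lemma finext_refl: "field_set F \<Longrightarrow> finext F F"
proof -
  assume F: "field_set F"
  have "F \<subseteq> lspan F {1}" unfolding lspan_def by auto
  then show ?thesis using F unfolding finext_def by blast
qed

lemma finext_trans:
  assumes "finext F E" "finext E G" shows "finext F G"
proof -
  obtain B B' where "finite B" "E \<subseteq> lspan F B" "finite B'" "G \<subseteq> lspan E B'"
    using assms unfolding finext_def by blast
  then have "G \<subseteq> lspan F ((\<lambda>(b, b'). b * b') ` (B \<times> B'))" "finite ((\<lambda>(b, b'). b * b') ` (B \<times> B'))"
    using lspan_trans[of F B B' E] assms unfolding finext_def by (auto intro: field_setD)
  then show ?thesis using assms unfolding finext_def by blast
qed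

lemma finext_adjoin_one:
  assumes E: "field_set E" and y: "y \<in> algover E"
  shows "\<exists>G. finext E G \<and> y \<in> G"
proof -
  note R = field_setD[OF E]
  obtain d where d: "y \<in> algdeg E d" using y algover_algdeg by blast
  define G where "G = {poly P y | P. poly_over E P}"
  have "ring_set G" unfolding ring_set_def
  proof (intro conjI ballI)
    show "1 \<in> G" unfolding G_def using R by (auto intro!: exI[of _ 1] poly_over_1)
    fix u v assume "u \<in> G" "v \<in> G"
    then obtain P Q where PQ: "u = poly P y" "poly_over E P" "v = poly Q y" "poly_over E Q" unfolding G_def by blast
    show "u - v \<in> G" unfolding G_def using PQ R by (auto intro!: exI[of _ "P - Q"] poly_over_diff)
    show "u * v \<in> G" unfolding G_def using PQ R by (auto intro!: exI[of _ "P * Q"] poly_over_mult)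
  qed
  moreover have EG: "E \<subseteq> G"
  proof
    fix x assume "x \<in> E"
    then show "x \<in> G" unfolding G_def using R by (auto intro!: exI[of _ "[:x:]"] poly_over_const)
  qed
  moreover have sp: "G \<subseteq> lspan E ((\<lambda>i. y ^ i) ` {..<d})"
    unfolding G_def using power_in_lspan[OF E d] by blast
  ultimately have "field_set G" using E by (intro ring_set_finite_span_field[OF E]) auto
  moreover have "y \<in> G" unfolding G_def using R
    by (auto intro!: exI[of _ "[:0,1:]"] poly_over_pCons poly_over_0 ring_set_0 ring_set_1)
  ultimately show ?thesis using E EG sp unfolding finext_def by blast
qed

lemma finext_adjoin:
  assumes "finite Z" "finext F E" "Z \<subseteq> algover E"
  shows "\<exists>G. finext F G \<and> E \<subseteq> G \<and> Z \<subseteq> G"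
  using assms
proof (induction Z rule: finite_induct)
  case empty then show ?case by blast
next
  case (insert z Z)
  then obtain G where G: "finext F G" "E \<subseteq> G" "Z \<subseteq> G" by auto
  have "z \<in> algover G" using insert.prems G algover_mono by blast
  then obtain H where H: "finext G H" "z \<in> H" using finext_adjoin_one[OF finext_field[OF G(1)]] by blast
  then have "finext F H" "G \<subseteq> H" using finext_trans[OF G(1)] finext_subset by auto
  then show ?case using G H by blast
qed

text \<open>The factor \<open>e\<close> depends on the extension alone, so uniform degree bounds
  pass down. The powers of y lie in the F-span of the products of a spanning set of E with 1, y,
  ..., y^(d-1).\<close>

lemma finext_algdeg:
  assumes "finext F E"
  shows "\<exists>e. \<forall>d y. y \<in> algdeg E d \<longrightarrow> y \<in> algdeg F (e * d)"
proof -
  obtain B where B: "finite B" "E \<subseteq> lspan F B" and F: "field_set F" and E: "field_set E"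
    using assms unfolding finext_def by blast
  have "y \<in> algdeg F (card B * d)" if y: "y \<in> algdeg E d" for y d
  proof (rule algdeg_spanI[OF F])
    let ?B' = "(\<lambda>i. y ^ i) ` {..<d}" let ?P = "(\<lambda>(b, b'). b * b') ` (B \<times> ?B')"
    show "finite ?P" using B by auto
    have "card ?P \<le> card (B \<times> ?B')" by (intro card_image_le) (use B in auto)
    also have "\<dots> \<le> card B * d" using card_image_le[of "{..<d}" "\<lambda>i. y ^ i"] by (simp add: card_cartesian_product)
    finally show "card ?P \<le> card B * d" .
    fix i
    have "poly (monom 1 i) y \<in> lspan E ?B'"
      using E by (intro power_in_lspan[OF E y]) (auto intro: poly_over_monom ring_set_1 field_setD)
    then show "y ^ i \<in> lspan F ?P"
      using B F by (intro lspan_trans[of F B _ E]) (auto intro: field_setD simp: poly_monom)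
  qed
  then show ?thesis by (intro exI[of _ "card B"]) auto
qed

lemma algdeg_self:
  assumes "ring_set F" "y \<in> F" shows "y \<in> algdeg F 1"
proof -
  have "poly_over F [:-y, 1:]" using assms
    by (intro poly_over_pCons poly_over_0 ring_set_1 ring_set_uminus)
  then show ?thesis unfolding algdeg_def by (intro CollectI exI[of _ "[:-y, 1:]"]) auto
qed

lemma finext_bounded:
  assumes "finext F E" shows "\<exists>e. E \<subseteq> algdeg F e"
proof -
  obtain e where e: "\<forall>d y. y \<in> algdeg E d \<longrightarrow> y \<in> algdeg F (e * d)" using finext_algdeg[OF assms] by (rule exE)
  have "E \<subseteq> algdeg F (e * 1)" using algdeg_self[OF field_setD[OF finext_field[OF assms]]] e by fast
  then show ?thesis by (rule exI)
qed

lemma algover_finext: "finext F E \<Longrightarrow> y \<in> algover E \<Longrightarrow> y \<in> algover F"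
  using finext_algdeg algover_algdeg algdeg_algover by metis

text \<open>Any two algebraic elements lie in a common finite extension, which consists of algebraic
  elements.\<close>

lemma algover_field_set:
  assumes F: "field_set F" shows "field_set (algover F)"
proof -
  have *: "\<exists>E. field_set E \<and> E \<subseteq> algover F \<and> x \<in> E \<and> y \<in> E" if "x \<in> algover F" "y \<in> algover F" for x y
  proof -
    have "\<exists>E. finext F E \<and> F \<subseteq> E \<and> {x, y} \<subseteq> E"
      by (rule finext_adjoin[OF _ finext_refl[OF F]]) (use that in auto)
    then obtain E where "finext F E" "{x, y} \<subseteq> E" by blast
    moreover from this have "E \<subseteq> algover F" using finext_bounded algdeg_algover by blast
    ultimately show ?thesis unfolding finext_def by auto
  qed
  have 1: "1 \<in> algover F"
    using algdeg_self[OF field_setD[OF F] ring_set_1[OF field_setD[OF F]]] algdeg_algover by blast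
  show ?thesis unfolding field_set_def ring_set_def
  proof (intro conjI ballI 1)
    fix x y assume xy: "x \<in> algover F" "y \<in> algover F"
    then obtain E where E: "field_set E" "E \<subseteq> algover F" "x \<in> E" "y \<in> E" using * by blast
    then show "x - y \<in> algover F" "x * y \<in> algover F"
      using ring_set_diff[OF field_setD] ring_set_mult[OF field_setD] by blast+
  next
    fix x assume "x \<in> algover F"
    then obtain E where E: "field_set E" "E \<subseteq> algover F" "x \<in> E" using * by blast
    then show "inverse x \<in> algover F" using field_set_inverse by blast
  qed
qed

lemma algover_superset: "field_set F \<Longrightarrow> F \<subseteq> algover F"
  using algdeg_self algdeg_algover field_setD by blast

text \<open>The finitely many coefficients of an equation for y already lie in a finite extension of
  F.\<close>

lemma algover_algover:
  assumes F: "field_set F" and y: "y \<in> algover (algover F)"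
  shows "y \<in> algover F"
proof -
  obtain P where P: "P \<noteq> 0" "poly_over (algover F) P" "poly P y = 0" using y unfolding algover_def by blast
  have "coeff P ` {..degree P} \<subseteq> algover F" using P(2) unfolding poly_over_def by blast
  then obtain E where E: "finext F E" "coeff P ` {..degree P} \<subseteq> E"
    using finext_adjoin[of "coeff P ` {..degree P}" F F] finext_refl[OF F] by auto
  have "coeff P i \<in> E" for i
  proof (cases "i \<le> degree P")
    case True then show ?thesis using E by blast
  next
    case False
    then show ?thesis using ring_set_0[OF field_setD[OF finext_field[OF E(1)]]] by (simp add: coeff_eq_0)
  qed
  then have "y \<in> algover E" using P unfolding algover_def poly_over_def by blast
  then show ?thesis using E algover_finext by blast
qed

section \<open>Adjoining an element\<close>

text \<open>S may be just a ring: this is the field generated by S and z. Thus in characteristic 0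
  \<open>adj \<int> c\<close> is the field \<rat>(c), and \<open>adj \<int> 0\<close> is
  \<rat>.\<close>

definition adj :: "'a::field set \<Rightarrow> 'a \<Rightarrow> 'a set" where
  "adj S z = {poly P z / poly Q z | P Q. poly_over S P \<and> poly_over S Q \<and> poly Q z \<noteq> 0}"

lemma adjI: "poly_over S P \<Longrightarrow> poly_over S Q \<Longrightarrow> poly Q z \<noteq> 0 \<Longrightarrow> poly P z / poly Q z \<in> adj S z"
  unfolding adj_def by blast

lemma adjE:
  assumes "y \<in> adj S z"
  obtains P Q where "poly_over S P" "poly_over S Q" "poly Q z \<noteq> 0" "y = poly P z / poly Q z"
  using assms unfolding adj_def by blast

lemma poly_in_adj: "ring_set S \<Longrightarrow> poly_over S P \<Longrightarrow> poly P z \<in> adj S z"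
  using adjI[of S P 1 z] poly_over_1 by auto

lemma adj_field_set:
  assumes S: "ring_set S" shows "field_set (adj S z)"
  unfolding field_set_def ring_set_def
proof (intro conjI ballI)
  show "1 \<in> adj S z" using poly_in_adj[OF S poly_over_1[OF S]] by simp
  fix x y assume xy: "x \<in> adj S z" "y \<in> adj S z"
  obtain P Q where 1: "poly_over S P" "poly_over S Q" "poly Q z \<noteq> 0" "x = poly P z / poly Q z"
    using xy(1) by (rule adjE)
  obtain P' Q' where 2: "poly_over S P'" "poly_over S Q'" "poly Q' z \<noteq> 0" "y = poly P' z / poly Q' z"
    using xy(2) by (rule adjE)
  have "x - y = poly (P * Q' - P' * Q) z / poly (Q * Q') z" using 1 2 by (simp add: diff_frac_eq)
  also have "\<dots> \<in> adj S z" using 1 2 S by (intro adjI poly_over_diff poly_over_mult) auto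
  finally show "x - y \<in> adj S z" .
  have "x * y = poly (P * P') z / poly (Q * Q') z" using 1 2 by simp
  also have "\<dots> \<in> adj S z" using 1 2 S by (intro adjI poly_over_mult) auto
  finally show "x * y \<in> adj S z" .
next
  fix x assume "x \<in> adj S z"
  then obtain P Q where 1: "poly_over S P" "poly_over S Q" "poly Q z \<noteq> 0" "x = poly P z / poly Q z"
    by (rule adjE)
  show "inverse x \<in> adj S z"
  proof (cases "poly P z = 0")
    case True
    then show ?thesis using 1 poly_in_adj[OF S poly_over_0[OF S], of z] by simp
  next
    case False
    then show ?thesis using 1 adjI[of S Q P z] by simp
  qed
qed

lemma adj_base: "ring_set S \<Longrightarrow> S \<subseteq> adj S z"
proof
  fix x assume "ring_set S" "x \<in> S"
  then show "x \<in> adj S z" using poly_in_adj[of S "[:x:]" z] poly_over_const[of S x] by simp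
qed

lemma adj_gen: "ring_set S \<Longrightarrow> z \<in> adj S z"
  using poly_in_adj[of S "[:0,1:]" z] by (simp add: poly_over_pCons poly_over_0 ring_set_0 ring_set_1)

lemma adj_least: "field_set F \<Longrightarrow> S \<subseteq> F \<Longrightarrow> z \<in> F \<Longrightarrow> adj S z \<subseteq> F"
proof
  fix y assume F: "field_set F" and S: "S \<subseteq> F" "z \<in> F" and "y \<in> adj S z"
  then obtain P Q where "poly_over S P" "poly_over S Q" "y = poly P z / poly Q z" by (auto elim: adjE)
  then show "y \<in> F"
    using F S by (auto intro!: field_set_divide poly_in_ring_set field_setD elim: poly_over_mono)
qed

lemma adj_mono: "S \<subseteq> T \<Longrightarrow> adj S z \<subseteq> adj T z"
  unfolding adj_def using poly_over_mono by blast

lemma adj_clear_denominators: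
  assumes S: "ring_set S" and "finite I" "\<And>i. i \<in> I \<Longrightarrow> w i \<in> adj S z"
  shows "\<exists>Q P. poly_over S Q \<and> poly Q z \<noteq> 0 \<and> (\<forall>i\<in>I. poly_over S (P i) \<and> w i = poly (P i) z / poly Q z)"
  using assms(2,3)
proof (induction I rule: finite_induct)
  case empty
  then show ?case using poly_over_1[OF S] by (intro exI[of _ 1]) auto
next
  case (insert k I)
  then obtain Q P where QP: "poly_over S Q" "poly Q z \<noteq> 0" "\<forall>i\<in>I. poly_over S (P i) \<and> w i = poly (P i) z / poly Q z"
    by auto
  obtain A B where AB: "poly_over S A" "poly_over S B" "poly B z \<noteq> 0" "w k = poly A z / poly B z"
    using insert.prems[of k] by (auto elim: adjE)
  define P' where "P' i = (if i = k then A * Q else P i * B)" for i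
  have "\<forall>i\<in>insert k I. poly_over S (P' i) \<and> w i = poly (P' i) z / poly (Q * B) z"
    using QP AB insert.hyps S by (auto simp: P'_def poly_over_mult)
  then show ?case using QP AB S by (intro exI[of _ "Q * B"] exI[of _ P']) (auto intro: poly_over_mult)
qed

text \<open>With coefficients polynomial in z, a relation can be expanded in powers of z and
  rearranged; this is how degrees are transferred between base fields.\<close>

lemma algdeg_adj_clear:
  assumes S: "ring_set S" and y: "y \<in> algdeg (adj S z) d"
  shows "\<exists>P. (\<forall>i. poly_over S (P i)) \<and> (\<exists>i\<le>d. poly (P i) z \<noteq> 0) \<and> (\<Sum>i\<le>d. poly (P i) z * y ^ i) = 0"
proof -
  obtain R where R: "R \<noteq> 0" "poly_over (adj S z) R" "degree R \<le> d" "poly R y = 0"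
    using y unfolding algdeg_def by blast
  obtain Q P where QP: "poly_over S Q" "poly Q z \<noteq> 0"
    "\<forall>i\<in>{..d}. poly_over S (P i) \<and> coeff R i = poly (P i) z / poly Q z"
    using adj_clear_denominators[OF S, of "{..d}" "coeff R" z] R(2) unfolding poly_over_def by auto
  define P' where "P' i = (if i \<le> d then P i else 0)" for i
  have "(\<Sum>i\<le>d. poly (P' i) z * y ^ i) = poly Q z * (\<Sum>i\<le>d. coeff R i * y ^ i)"
    unfolding sum_distrib_left by (rule sum.cong) (use QP in \<open>auto simp: P'_def\<close>)
  also have "(\<Sum>i\<le>d. coeff R i * y ^ i) = poly R y"
    unfolding poly_altdef by (rule sum.mono_neutral_right) (use R in \<open>auto simp: coeff_eq_0\<close>)
  finally have "(\<Sum>i\<le>d. poly (P' i) z * y ^ i) = 0" using R by simp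
  moreover have "poly (P' (degree R)) z \<noteq> 0"
  proof
    assume "poly (P' (degree R)) z = 0"
    then have "lead_coeff R = 0" using R(3) QP(3) by (simp add: P'_def)
    then show False using R(1) by simp
  qed
  moreover have "\<forall>i. poly_over S (P' i)" using QP poly_over_0[OF S] by (auto simp: P'_def)
  ultimately show ?thesis using R(3) by blast
qed

section \<open>Finitely generated fields\<close>

text \<open>t stays transcendental over a finite extension containing y. Read as a polynomial in t
  over that extension, the relation for y vanishes coefficient by coefficient; each coefficient is a
  relation for y over F of degree at most d, and one of them is nontrivial.\<close>

lemma algdeg_descend:
  assumes F: "field_set F" and t: "t \<notin> algover F" and y: "y \<in> algover F" "y \<in> algdeg (adj F t) d"
  shows "y \<in> algdeg F d"
proof -
  note R = field_setD[OF F]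
  obtain P where P: "\<And>i. poly_over F (P i)" "\<exists>i\<le>d. poly (P i) t \<noteq> 0" "(\<Sum>i\<le>d. poly (P i) t * y ^ i) = 0"
    using algdeg_adj_clear[OF R y(2)] by blast
  obtain E where E: "finext F E" "y \<in> E" using finext_adjoin_one[OF F y(1)] by blast
  have RE: "ring_set E" using E unfolding finext_def by (auto intro: field_setD)
  have FE: "F \<subseteq> E" using E unfolding finext_def by auto
  define T where "T = (\<Sum>i\<le>d. smult (y ^ i) (P i))"
  have "poly_over E T" unfolding T_def
    using RE E FE P(1) by (intro poly_over_sum poly_over_smult ring_set_power) (auto intro: poly_over_mono)
  moreover have "poly T t = 0" using P(3) by (simp add: T_def poly_sum mult.commute)
  moreover have "t \<notin> algover E" using t E algover_finext by blast
  ultimately have T0: "T = 0" unfolding algover_def by blast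
  obtain i where i: "i \<le> d" "poly (P i) t \<noteq> 0" using P(2) by blast
  then obtain k where k: "coeff (P i) k \<noteq> 0" by (metis leading_coeff_0_iff poly_0)
  have "(\<Sum>i\<le>d. coeff (P i) k * y ^ i) = coeff T k" by (simp add: T_def coeff_sum mult.commute)
  then show ?thesis using T0 k i P(1) R
    by (intro algdegI_sum[of F d "\<lambda>i. coeff (P i) k"]) (auto simp: poly_over_def)
qed

lemma adj_algover_finext:
  assumes "field_set F" "z \<in> algover F" shows "finext F (adj F z)"
proof -
  obtain E where E: "finext F E" "z \<in> E" using finext_adjoin_one assms by blast
  have "adj F z \<subseteq> E" using E unfolding finext_def by (intro adj_least) auto
  then show ?thesis using E assms adj_field_set adj_base unfolding finext_def
    by (meson field_setD subset_trans)
qed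

fun adjs :: "'a::field set \<Rightarrow> 'a list \<Rightarrow> 'a set" where
  "adjs F [] = F"
| "adjs F (y # ys) = adjs (adj F y) ys"

lemma adjs_field_set: "field_set F \<Longrightarrow> field_set (adjs F ys)"
  by (induction ys arbitrary: F) (auto intro: adj_field_set field_setD)

lemma adjs_mono: "F \<subseteq> E \<Longrightarrow> adjs F ys \<subseteq> adjs E ys"
  by (induction ys arbitrary: F E) (auto dest: adj_mono)

lemma adjs_superset: "field_set F \<Longrightarrow> F \<union> set ys \<subseteq> adjs F ys"
proof (induction ys arbitrary: F)
  case (Cons y ys)
  have "field_set (adj F y)" using Cons.prems adj_field_set field_setD by blast
  from Cons.IH[OF this] show ?case using adj_base[OF field_setD[OF Cons.prems]] adj_gen[OF field_setD[OF Cons.prems]]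
    by auto
qed simp

text \<open>An algebraic generator multiplies the bound by a constant, a transcendental one
  preserves it by \<open>algdeg_descend\<close>. All later bounds on the denominators of a valuation
  on K have their source here.\<close>

lemma finitely_generated_bounded_degree:
  assumes "field_set F"
  shows "\<exists>d. \<forall>y\<in>adjs F ys. y \<in> algover F \<longrightarrow> y \<in> algdeg F d"
  using assms
proof (induction ys arbitrary: F)
  case Nil
  then show ?case using algdeg_self field_setD by auto
next
  case (Cons z ys)
  have fz: "field_set (adj F z)" using Cons.prems adj_field_set field_setD by blast
  obtain d where d: "\<forall>y\<in>adjs (adj F z) ys. y \<in> algover (adj F z) \<longrightarrow> y \<in> algdeg (adj F z) d"
    using Cons.IH[OF fz] by blast
  have sub: "F \<subseteq> adj F z" using adj_base Cons.prems field_setD by blast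
  show ?case
  proof (cases "z \<in> algover F")
    case True
    obtain e where "\<forall>d y. y \<in> algdeg (adj F z) d \<longrightarrow> y \<in> algdeg F (e * d)"
      using finext_algdeg[OF adj_algover_finext[OF Cons.prems True]] by blast
    then show ?thesis using d algover_mono[OF _ sub] by (intro exI[of _ "e * d"]) auto
  next
    case False
    then show ?thesis using d algover_mono[OF _ sub] algdeg_descend[OF Cons.prems False] by (intro exI[of _ d]) auto
  qed
qed

section \<open>Valuation rings\<close>

definition vmax :: "'a::field set \<Rightarrow> 'a set" where
  "vmax V = {x \<in> V. x = 0 \<or> inverse x \<notin> V}"

text \<open>For the valuation v of a valuation ring this is v(x) \<le> v(y). Divisibility replaces
  the value group, which is never constructed and may have any rank.\<close>

definition vdvd :: "'a::field set \<Rightarrow> 'a \<Rightarrow> 'a \<Rightarrow> bool" where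
  "vdvd V x y \<longleftrightarrow> (\<exists>z\<in>V. y = x * z)"

definition vassoc :: "'a::field set \<Rightarrow> 'a \<Rightarrow> 'a \<Rightarrow> bool" where
  "vassoc V x y \<longleftrightarrow> vdvd V x y \<and> vdvd V y x"

locale valuation_ring =
  fixes V :: "'a::field set"
  assumes ring: "ring_set V" and total: "x \<in> V \<or> inverse x \<in> V"
begin

abbreviation "M \<equiv> vmax V"
abbreviation dv (infix "\<preceq>" 50) where "x \<preceq> y \<equiv> vdvd V x y"
abbreviation as (infix "\<asymp>" 50) where "x \<asymp> y \<equiv> vassoc V x y"

lemmas V_intros = ring_set_1[OF ring] ring_set_0[OF ring] ring_set_mult[OF ring] ring_set_add[OF ring]
  ring_set_diff[OF ring] ring_set_uminus[OF ring] ring_set_power[OF ring] ring_set_of_nat[OF ring] ring_set_of_int[OF ring]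

lemma M_in_V: "x \<in> M \<Longrightarrow> x \<in> V" by (simp add: vmax_def)
lemma one_notin_M: "1 \<notin> M" by (simp add: vmax_def V_intros)
lemma zero_in_M: "0 \<in> M" by (simp add: vmax_def V_intros)
lemma inverse_in_V: "x \<in> V \<Longrightarrow> x \<notin> M \<Longrightarrow> inverse x \<in> V" by (simp add: vmax_def)
lemma inverse_in_M: "x \<notin> V \<Longrightarrow> inverse x \<in> M" using total[of x] by (auto simp: vmax_def)

lemma M_mult: assumes "x \<in> M" "y \<in> V" shows "x * y \<in> M"
proof -
  have "inverse (x * y) \<notin> V" if "x * y \<noteq> 0"
  proof
    assume "inverse (x * y) \<in> V"
    then have "inverse (x * y) * y \<in> V" using assms by (intro V_intros) auto
    moreover have "inverse (x * y) * y = inverse x" using that by simp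
    ultimately have "inverse x \<in> V" by (simp only:)
    then show False using that assms by (simp add: vmax_def)
  qed
  then show ?thesis using assms ring_set_mult[OF ring] by (auto simp: vmax_def)
qed

lemma M_mult': "x \<in> V \<Longrightarrow> y \<in> M \<Longrightarrow> x * y \<in> M"
  using M_mult[of y x] by (simp add: mult.commute)

lemma vdvd_total: "x \<preceq> y \<or> y \<preceq> x"
proof (cases "x = 0 \<or> y = 0")
  case True then show ?thesis by (auto simp: vdvd_def V_intros)
next
  case False
  then have "y = x * (y / x)" "x = y * (x / y)" "inverse (y / x) = x / y" by auto
  then show ?thesis using total[of "y / x"] unfolding vdvd_def by metis
qed

lemma M_add: assumes "x \<in> M" "y \<in> M" shows "x + y \<in> M"
  using vdvd_total[of x y]
proof
  assume "x \<preceq> y"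
  then obtain z where "z \<in> V" "y = x * z" by (auto simp: vdvd_def)
  then have "x + y = x * (1 + z)" "1 + z \<in> V" by (auto simp: algebra_simps V_intros)
  then show ?thesis using M_mult assms by metis
next
  assume "y \<preceq> x"
  then obtain z where "z \<in> V" "x = y * z" by (auto simp: vdvd_def)
  then have "x + y = y * (1 + z)" "1 + z \<in> V" by (auto simp: algebra_simps V_intros)
  then show ?thesis using M_mult assms by metis
qed

lemma M_uminus: "x \<in> M \<Longrightarrow> - x \<in> M" using M_mult[of x "-1"] V_intros(1,6) by simp
lemma M_diff: "x \<in> M \<Longrightarrow> y \<in> M \<Longrightarrow> x - y \<in> M" using M_add[of x "-y"] M_uminus by simp
lemma M_sum: "(\<And>i. i \<in> I \<Longrightarrow> u i \<in> M) \<Longrightarrow> sum u I \<in> M"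
  by (induction I rule: infinite_finite_induct) (auto intro: zero_in_M M_add)

lemma M_prime: assumes "x \<in> V" "y \<in> V" "x * y \<in> M" shows "x \<in> M \<or> y \<in> M"
proof (rule ccontr)
  assume n: "\<not> ?thesis"
  then have "inverse x * inverse y \<in> V" "x \<noteq> 0" "y \<noteq> 0" using assms zero_in_M by (auto intro!: V_intros inverse_in_V)
  then have "(x * y) * (inverse x * inverse y) \<in> M" using M_mult assms by blast
  moreover have "(x * y) * (inverse x * inverse y) = 1" using \<open>x \<noteq> 0\<close> \<open>y \<noteq> 0\<close> by (simp add: field_simps)
  ultimately show False using one_notin_M by simp
qed

lemma M_power_iff: assumes "x \<in> V" "n > 0" shows "x ^ n \<in> M \<longleftrightarrow> x \<in> M"
proof
  show "x ^ n \<in> M \<Longrightarrow> x \<in> M" using \<open>n > 0\<close>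
  proof (induction n)
    case (Suc n)
    then have "x \<in> M \<or> x ^ n \<in> M" using M_prime[of x "x ^ n"] assms V_intros(7)[of x n] by auto
    then show ?case using Suc one_notin_M by (cases n) auto
  qed simp
  show "x \<in> M \<Longrightarrow> x ^ n \<in> M" using \<open>n > 0\<close> assms
    by (cases n) (auto intro!: M_mult V_intros)
qed

lemma V_power_iff: assumes "n > 0" shows "x ^ n \<in> V \<longleftrightarrow> x \<in> V"
proof
  assume a: "x ^ n \<in> V"
  show "x \<in> V"
  proof (rule ccontr)
    assume "x \<notin> V"
    then have "inverse x \<in> M" "x \<noteq> 0" using inverse_in_M V_intros(2) by auto
    then have "inverse x ^ n \<in> M" using M_power_iff assms M_in_V by blast
    then have "x ^ n * inverse x ^ n \<in> M" using M_mult' a by blast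
    then show False using one_notin_M \<open>x \<noteq> 0\<close> by (simp add: power_mult_distrib[symmetric])
  qed
qed (rule V_intros(7))

lemma vdvd_refl [simp]: "x \<preceq> x" unfolding vdvd_def using V_intros(1) by (metis mult_1_right)
lemma vdvd_trans [trans]: "x \<preceq> y \<Longrightarrow> y \<preceq> z \<Longrightarrow> x \<preceq> z"
  unfolding vdvd_def by (metis V_intros(3) mult.assoc)
lemma vdvd_0 [simp]: "x \<preceq> 0" unfolding vdvd_def using V_intros(2) by (metis mult_zero_right)
lemma vdvd_0_left [simp]: "0 \<preceq> y \<longleftrightarrow> y = 0" unfolding vdvd_def using V_intros(2) by auto
lemma vdvd_1 [simp]: "1 \<preceq> y \<longleftrightarrow> y \<in> V" unfolding vdvd_def by auto
lemma vdvd_add: "x \<preceq> y \<Longrightarrow> x \<preceq> z \<Longrightarrow> x \<preceq> y + z"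
  unfolding vdvd_def using V_intros(4) by (metis distrib_left)
lemma vdvd_uminus: "x \<preceq> y \<Longrightarrow> x \<preceq> - y"
  unfolding vdvd_def using V_intros(6) by (metis mult_minus_right)
lemma vdvd_diff: "x \<preceq> y \<Longrightarrow> x \<preceq> z \<Longrightarrow> x \<preceq> y - z"
  using vdvd_add[of x y "-z"] vdvd_uminus by simp
lemma vdvd_mult: "x \<preceq> y \<Longrightarrow> x' \<preceq> y' \<Longrightarrow> x * x' \<preceq> y * y'"
  unfolding vdvd_def by (metis V_intros(3) mult.assoc mult.left_commute)
lemma vdvd_multI: "z \<in> V \<Longrightarrow> x \<preceq> x * z" unfolding vdvd_def by blast
lemma vdvd_power: "x \<preceq> y \<Longrightarrow> x ^ n \<preceq> y ^ n"
  by (induction n) (auto intro: vdvd_mult)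
lemma vdvd_in_M: "x \<preceq> y \<Longrightarrow> x \<in> M \<Longrightarrow> y \<in> M"
  unfolding vdvd_def using M_mult by auto
lemma vdvd_cancel: "a \<noteq> 0 \<Longrightarrow> a * x \<preceq> a * y \<longleftrightarrow> x \<preceq> y"
  unfolding vdvd_def by (auto simp: mult.assoc)
lemma vdvd_iff_div: "x \<noteq> 0 \<Longrightarrow> x \<preceq> y \<longleftrightarrow> y / x \<in> V"
  unfolding vdvd_def by (auto simp: field_simps intro!: bexI[of _ "y / x"])
lemma vdvd_prod_mset: "(\<And>x. x \<in># A \<Longrightarrow> u x \<preceq> w x) \<Longrightarrow> (\<Prod>x\<in>#A. u x) \<preceq> (\<Prod>x\<in>#A. w x)"
  by (induction A) (auto intro: vdvd_mult)
lemma not_vdvd: "x \<noteq> 0 \<Longrightarrow> \<not> y \<preceq> x \<Longrightarrow> \<exists>z\<in>M. y = x * z"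
proof -
  assume a: "x \<noteq> 0" "\<not> y \<preceq> x"
  have "y \<noteq> 0 \<Longrightarrow> inverse (y / x) \<notin> V" using a vdvd_iff_div[of y x] by auto
  then have "y / x \<in> M" using a vdvd_total[of x y] by (auto simp: vmax_def vdvd_iff_div)
  then show ?thesis using a by (intro bexI[of _ "y / x"]) auto
qed

lemma vassoc_refl [simp]: "x \<asymp> x" by (simp add: vassoc_def)
lemma vassoc_sym: "x \<asymp> y \<Longrightarrow> y \<asymp> x" by (simp add: vassoc_def)
lemma vassoc_trans [trans]: "x \<asymp> y \<Longrightarrow> y \<asymp> z \<Longrightarrow> x \<asymp> z" unfolding vassoc_def using vdvd_trans by blast
lemma vassoc_mult: "x \<asymp> y \<Longrightarrow> x' \<asymp> y' \<Longrightarrow> x * x' \<asymp> y * y'" unfolding vassoc_def using vdvd_mult by blast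
lemma vassoc_power: "x \<asymp> y \<Longrightarrow> x ^ n \<asymp> y ^ n" unfolding vassoc_def using vdvd_power by blast
lemma vassoc_cancel: "a \<noteq> 0 \<Longrightarrow> a * x \<asymp> a * y \<longleftrightarrow> x \<asymp> y" by (simp add: vassoc_def vdvd_cancel)
lemma vassoc_0 [simp]: "x \<asymp> 0 \<longleftrightarrow> x = 0" by (simp add: vassoc_def)
lemma vassoc_inverse: "x \<asymp> y \<Longrightarrow> inverse x \<asymp> inverse y"
proof (cases "x = 0 \<or> y = 0")
  case True
  moreover assume "x \<asymp> y"
  ultimately show ?thesis by (auto simp: vassoc_def)
next
  case False
  assume "x \<asymp> y"
  moreover have "(x * y) * inverse y = x" "(x * y) * inverse x = y" using False by (simp_all add: field_simps)
  ultimately have "(x * y) * inverse x \<asymp> (x * y) * inverse y" using vassoc_sym by (simp only:)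
  then show ?thesis using False vassoc_cancel[of "x * y"] by simp
qed
lemma vassoc_one: "x \<in> V \<Longrightarrow> x \<notin> M \<Longrightarrow> x \<asymp> 1"
proof -
  assume x: "x \<in> V" "x \<notin> M"
  then have "x \<noteq> 0" using zero_in_M by auto
  then show ?thesis using x inverse_in_V[of x] unfolding vassoc_def vdvd_1 vdvd_def
    by (auto intro!: bexI[of _ "inverse x"])
qed
lemma vassoc_mult_unit: "u \<in> V \<Longrightarrow> u \<notin> M \<Longrightarrow> x * u \<asymp> x"
  using vassoc_mult[OF vassoc_refl vassoc_one, of u x] by simp
lemma vassoc_one_plus: "m \<in> M \<Longrightarrow> x * (1 + m) \<asymp> x"
  using M_diff[of "1 + m" m] one_notin_M by (intro vassoc_mult_unit) (auto intro: V_intros M_in_V)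

lemma vdvd_minimum:
  assumes "finite I" "I \<noteq> {}" shows "\<exists>k\<in>I. \<forall>i\<in>I. u k \<preceq> u i"
  using assms
proof (induction I rule: finite_ne_induct)
  case (insert i I)
  then obtain k where k: "k \<in> I" "\<forall>j\<in>I. u k \<preceq> u j" by blast
  show ?case
  proof (cases "u k \<preceq> u i")
    case True then show ?thesis using k by blast
  next
    case False
    then have "u i \<preceq> u k" using vdvd_total by blast
    then show ?thesis using k vdvd_trans by (intro bexI[of _ i]) auto
  qed
qed auto

text \<open>Ultrametric principle: if a summand were the only one of least value, dividing by it
  would turn the sum into 1 plus an element of M, which is not 0.\<close>

lemma zero_sum_minimum_twice:
  assumes "finite I" "(\<Sum>i\<in>I. u i) = 0" "\<exists>i\<in>I. u i \<noteq> 0"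
  shows "\<exists>k\<in>I. \<exists>l\<in>I. k \<noteq> l \<and> u k \<noteq> 0 \<and> u k \<asymp> u l"
proof (rule ccontr)
  assume n: "\<not> ?thesis"
  obtain k where k: "k \<in> I" "\<And>i. i \<in> I \<Longrightarrow> u k \<preceq> u i" using vdvd_minimum[of I u] assms by auto
  then have k0: "u k \<noteq> 0" using assms(3) by auto
  have "\<exists>z\<in>M. u l = u k * z" if "l \<in> I - {k}" for l
    using n k k0 that by (intro not_vdvd) (auto simp: vassoc_def)
  then obtain z where z: "\<And>l. l \<in> I - {k} \<Longrightarrow> z l \<in> M" "\<And>l. l \<in> I - {k} \<Longrightarrow> u l = u k * z l" by metis
  have "(\<Sum>i\<in>I. u i) = u k + (\<Sum>l\<in>I - {k}. u k * z l)"
    using assms k z(2) by (simp add: sum.remove)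
  also have "\<dots> = u k * (1 + (\<Sum>l\<in>I - {k}. z l))" by (simp add: sum_distrib_left distrib_left)
  finally have "1 + (\<Sum>l\<in>I - {k}. z l) = 0" using assms k0 by simp
  moreover have "(\<Sum>l\<in>I - {k}. z l) \<in> M" using z by (intro M_sum) auto
  ultimately show False using one_notin_M M_uminus by (metis add_eq_0_iff2 add.inverse_inverse)
qed

text \<open>Dividing by the coefficient of least value makes all coefficients integral and one of
  them 1, so that the relation stays nontrivial after reduction modulo M.\<close>

lemma normalized_relation:
  assumes W: "field_set W" and "finite I" "\<And>i. i \<in> I \<Longrightarrow> w i \<in> W" "\<exists>i\<in>I. w i \<noteq> 0" "(\<Sum>i\<in>I. w i * u i) = 0"
  shows "\<exists>k\<in>I. \<exists>w'. w' k = 1 \<and> (\<forall>i\<in>I. w' i \<in> W \<inter> V) \<and> (\<Sum>i\<in>I. w' i * u i) = 0"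
proof -
  obtain k where k: "k \<in> I" "\<And>i. i \<in> I \<Longrightarrow> w k \<preceq> w i" using vdvd_minimum[of I w] assms by auto
  then have k0: "w k \<noteq> 0" using assms(4) by auto
  have "(\<Sum>i\<in>I. w i / w k * u i) = (\<Sum>i\<in>I. w i * u i) / w k" by (simp add: sum_divide_distrib)
  then show ?thesis using k k0 assms
    by (intro bexI[of _ k] exI[of _ "\<lambda>i. w i / w k"]) (auto simp: field_set_divide vdvd_iff_div)
qed

text \<open>With v(\<pi>) = 1, the values on K are fractions with denominator at most D; for \<pi>
  in M, positive values are then at least 1/D. Nothing is asked of V outside K.\<close>

definition discrete_on :: "'a \<Rightarrow> nat \<Rightarrow> 'a set \<Rightarrow> bool" where
  "discrete_on \<pi> D K \<longleftrightarrow> (\<forall>y\<in>K. y \<noteq> 0 \<longrightarrow> (\<exists>i j. 1 \<le> i \<and> i \<le> D \<and> y ^ i \<asymp> \<pi> powi j))"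

text \<open>In an equation for y two nonzero terms a y^k and b y^l with different exponents have the
  same value, so (l - k) v(y) = v(a) - v(b) is an integer, and the exponents differ by at most
  D.\<close>

lemma discrete_on_algdeg:
  assumes "\<pi> \<noteq> 0" and W: "\<And>w. w \<in> W \<Longrightarrow> w \<noteq> 0 \<Longrightarrow> \<exists>j. w \<asymp> \<pi> powi j"
  shows "discrete_on \<pi> D (algdeg W D)"
  unfolding discrete_on_def
proof (intro ballI impI)
  fix y assume y: "y \<in> algdeg W D" "y \<noteq> 0"
  obtain P where P: "P \<noteq> 0" "poly_over W P" "degree P \<le> D" "poly P y = 0"
    using y unfolding algdeg_def by blast
  have "\<exists>k\<in>{..degree P}. \<exists>l\<in>{..degree P}. k \<noteq> l \<and> coeff P k * y ^ k \<noteq> 0 \<and> coeff P k * y ^ k \<asymp> coeff P l * y ^ l"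
    using P y by (intro zero_sum_minimum_twice) (auto simp: poly_altdef intro!: bexI[of _ "degree P"])
  then obtain k l where kl: "k \<le> degree P" "l \<le> degree P" "k \<noteq> l" "coeff P k * y ^ k \<noteq> 0"
    "coeff P k * y ^ k \<asymp> coeff P l * y ^ l" by blast
  have *: "\<exists>i j. 1 \<le> i \<and> i \<le> D \<and> y ^ i \<asymp> \<pi> powi j"
    if h: "k < l" "l \<le> D" "a \<in> W" "b \<in> W" "a * y ^ k \<noteq> 0" "a * y ^ k \<asymp> b * y ^ l" for k l a b
  proof -
    have "a \<noteq> 0" "b \<noteq> 0" using that by auto
    then obtain i j where ij: "a \<asymp> \<pi> powi i" "b \<asymp> \<pi> powi j"
      using W[OF h(3)] W[OF h(4)] by blast
    have "y ^ l = y ^ k * y ^ (l - k)" using that by (simp add: power_add[symmetric])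
    then have "y ^ k * a \<asymp> y ^ k * (b * y ^ (l - k))" using that by (simp add: mult_ac)
    then have "a \<asymp> b * y ^ (l - k)" using y vassoc_cancel by auto
    then have "inverse b * a \<asymp> inverse b * (b * y ^ (l - k))" by (rule vassoc_mult[OF vassoc_refl])
    then have "y ^ (l - k) \<asymp> inverse b * a" using \<open>b \<noteq> 0\<close> vassoc_sym by (simp add: mult.assoc[symmetric])
    also have "inverse b * a \<asymp> inverse (\<pi> powi j) * \<pi> powi i" using ij by (intro vassoc_mult vassoc_inverse)
    also have "inverse (\<pi> powi j) * \<pi> powi i = \<pi> powi (i - j)"
      using \<open>\<pi> \<noteq> 0\<close> by (simp add: power_int_diff field_simps)
    finally have "y ^ (l - k) \<asymp> \<pi> powi (i - j)" .
    then show ?thesis using that by (intro exI[of _ "l - k"] exI[of _ "i - j"]) auto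
  qed
  have cW: "coeff P k \<in> W" "coeff P l \<in> W" using P unfolding poly_over_def by auto
  show "\<exists>i j. 1 \<le> i \<and> i \<le> D \<and> y ^ i \<asymp> \<pi> powi j"
  proof (cases "k < l")
    case True then show ?thesis using *[of k l] cW kl P by auto
  next
    case False
    then have "l < k" using kl by auto
    moreover have "coeff P l * y ^ l \<noteq> 0" using kl(4,5) y(2) by auto
    ultimately show ?thesis using *[of l k] cW kl P vassoc_sym by auto
  qed
qed

context
  fixes \<pi> assumes \<pi>: "\<pi> \<in> M" "\<pi> \<noteq> 0"
begin

lemma power_notin: "j > 0 \<Longrightarrow> \<not> \<pi> ^ j \<preceq> 1"
proof
  assume "j > 0" "\<pi> ^ j \<preceq> 1"
  moreover have "\<pi> ^ j \<in> M" using \<pi> M_power_iff M_in_V calculation(1) by blast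
  ultimately show False using vdvd_in_M one_notin_M by blast
qed

lemma power_vdvd_power: "\<pi> ^ i \<preceq> \<pi> ^ j \<longleftrightarrow> i \<le> j"
proof
  assume a: "\<pi> ^ i \<preceq> \<pi> ^ j"
  show "i \<le> j"
  proof (rule ccontr)
    assume n: "\<not> i \<le> j"
    then have "\<pi> ^ j * \<pi> ^ (i - j) \<preceq> \<pi> ^ j * 1" using a by (simp add: power_add[symmetric])
    then have "\<pi> ^ (i - j) \<preceq> 1" using \<pi> vdvd_cancel by (metis power_not_zero)
    then show False using power_notin n by auto
  qed
next
  assume "i \<le> j"
  then have "\<pi> ^ j = \<pi> ^ i * \<pi> ^ (j - i)" by (simp add: power_add[symmetric])
  then show "\<pi> ^ i \<preceq> \<pi> ^ j" using vdvd_multI[of "\<pi> ^ (j - i)" "\<pi> ^ i"] V_intros(7)[OF M_in_V[OF \<pi>(1)]] by simp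
qed

lemma discrete_on_vmax:
  assumes d: "discrete_on \<pi> D K" and y: "y \<in> K" "y \<in> M" "y \<noteq> 0"
  obtains i j where "1 \<le> i" "i \<le> D" "1 \<le> j" "y ^ i \<asymp> \<pi> ^ j"
proof -
  obtain i j where ij: "1 \<le> i" "i \<le> D" "y ^ i \<asymp> \<pi> powi j" using d y unfolding discrete_on_def by blast
  have yi: "y ^ i \<in> M" using y ij M_power_iff M_in_V by auto
  have "j > 0"
  proof (rule ccontr)
    assume "\<not> j > 0"
    then have e: "\<pi> powi j = inverse (\<pi> ^ nat (- j))" by (simp add: power_int_def power_inverse)
    have "\<pi> ^ nat (-j) * (y ^ i) \<asymp> \<pi> ^ nat (-j) * (\<pi> powi j)" using ij vassoc_mult vassoc_refl by blast
    then have "\<pi> ^ nat (-j) * (y ^ i) \<preceq> 1" using \<pi> e by (simp add: vassoc_def)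
    moreover have "\<pi> ^ nat (-j) * (y ^ i) \<in> M" using yi V_intros(7)[OF M_in_V[OF \<pi>(1)]] by (intro M_mult')
    ultimately show False using vdvd_in_M one_notin_M by blast
  qed
  then have "y ^ i \<asymp> \<pi> ^ nat j" using ij by (simp add: power_int_def)
  then show thesis using that[of i "nat j"] ij \<open>j > 0\<close> by auto
qed

lemma discrete_on_lower:
  assumes d: "discrete_on \<pi> D K" "D > 0" and y: "y \<in> K" "y \<in> M"
  shows "\<pi> \<preceq> y ^ D"
proof (cases "y = 0")
  case True then show ?thesis using d by (simp add: power_0_left)
next
  case False
  obtain i j where ij: "1 \<le> i" "i \<le> D" "1 \<le> j" "y ^ i \<asymp> \<pi> ^ j"
    using discrete_on_vmax[OF d(1) y False] by blast
  have "\<pi> \<preceq> \<pi> ^ j" using power_vdvd_power[of 1 j] ij by simp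
  also have "\<pi> ^ j \<preceq> y ^ i" using ij by (simp add: vassoc_def)
  also have "y ^ i \<preceq> y ^ i * y ^ (D - i)" using y by (intro vdvd_multI V_intros M_in_V) auto
  also have "y ^ i * y ^ (D - i) = y ^ D" using ij by (simp add: power_add[symmetric])
  finally show ?thesis .
qed

lemma discrete_on_upper:
  assumes d: "discrete_on \<pi> D K" and y: "y \<in> K" "y \<noteq> 0" "y \<in> M"
  shows "\<exists>B. y \<preceq> \<pi> ^ B"
proof -
  obtain i j where ij: "1 \<le> i" "i \<le> D" "1 \<le> j" "y ^ i \<asymp> \<pi> ^ j"
    using discrete_on_vmax[OF d y(1,3,2)] by blast
  have "y \<preceq> y * y ^ (i - 1)" using y by (intro vdvd_multI V_intros M_in_V) auto
  also have "y * y ^ (i - 1) = y ^ i" using ij by (simp add: power_eq_if)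
  also have "y ^ i \<preceq> \<pi> ^ j" using ij by (simp add: vassoc_def)
  finally show ?thesis by blast
qed

text \<open>Combine v(y) \<ge> 1/D with N v(y) \<le> k. Both factor bounds below rest on this: there
  N is q^n up to a constant factor, and k is a constant times the number of roots.\<close>

lemma discrete_on_bound:
  assumes d: "discrete_on \<pi> D K" "D > 0" and y: "y \<in> K" "y \<in> M" and N: "y ^ N \<preceq> \<pi> ^ k"
  shows "N \<le> D * k"
proof -
  have "\<pi> ^ N \<preceq> (y ^ D) ^ N" using discrete_on_lower[OF d y] vdvd_power by blast
  also have "(y ^ D) ^ N = (y ^ N) ^ D" by (simp add: power_mult[symmetric] mult.commute)
  also have "(y ^ N) ^ D \<preceq> (\<pi> ^ k) ^ D" using N vdvd_power by blast
  also have "(\<pi> ^ k) ^ D = \<pi> ^ (D * k)" by (simp add: power_mult[symmetric] mult.commute)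
  finally have "\<pi> ^ N \<preceq> \<pi> ^ (D * k)" .
  then show ?thesis using power_vdvd_power by blast
qed

end

end

section \<open>Existence of valuation rings\<close>

lemma ring_set_polys:
  fixes S :: "'a::idom set"
  assumes "ring_set S" shows "ring_set {poly P x | P. poly_over S P}"
  unfolding ring_set_def
proof (intro conjI ballI)
  show "1 \<in> {poly P x | P. poly_over S P}" using poly_over_1[OF assms] by (intro CollectI exI[of _ 1]) auto
  fix u v assume "u \<in> {poly P x | P. poly_over S P}" "v \<in> {poly P x | P. poly_over S P}"
  then obtain P Q where PQ: "u = poly P x" "poly_over S P" "v = poly Q x" "poly_over S Q" by blast
  show "u - v \<in> {poly P x | P. poly_over S P}"
    using PQ poly_over_diff[OF assms] by (intro CollectI exI[of _ "P - Q"]) auto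
  show "u * v \<in> {poly P x | P. poly_over S P}"
    using PQ poly_over_mult[OF assms] by (intro CollectI exI[of _ "P * Q"]) auto
qed

lemma polys_superset:
  fixes S :: "'a::idom set"
  assumes "ring_set S" shows "S \<subseteq> {poly P x | P. poly_over S P}" "x \<in> {poly P x | P. poly_over S P}"
proof -
  show "S \<subseteq> {poly P x | P. poly_over S P}"
  proof
    fix s assume "s \<in> S"
    then show "s \<in> {poly P x | P. poly_over S P}"
      using poly_over_const[OF assms] by (intro CollectI exI[of _ "[:s:]"]) auto
  qed
  have "poly_over S [:0, 1:]" using assms by (intro poly_over_pCons poly_over_0 ring_set_0 ring_set_1)
  then show "x \<in> {poly P x | P. poly_over S P}" by (intro CollectI exI[of _ "[:0, 1:]"]) auto
qed

text \<open>A ring maximal among those in which \<open>\<pi>\<close> is not invertible is a valuation ring (Chevalley).\<close>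

lemma valuation_ring_exists:
  assumes A: "ring_set A" and \<pi>: "\<pi> \<in> A" "\<pi> \<noteq> 0" "inverse \<pi> \<notin> (A :: 'a::field set)"
  obtains V where "valuation_ring V" "A \<subseteq> V" "\<pi> \<in> vmax V"
proof -
  let ?F = "{R. ring_set R \<and> A \<subseteq> R \<and> inverse \<pi> \<notin> R}"
  have "\<exists>V\<in>(?F). \<forall>T\<in>(?F). V \<subseteq> T \<longrightarrow> T = V"
  proof (rule subset_Zorn_nonempty)
    show "?F \<noteq> {}" using assms by blast
    fix C assume C: "C \<noteq> {}" "subset.chain ?F C"
    have CF: "R \<in> C \<Longrightarrow> ring_set R \<and> A \<subseteq> R \<and> inverse \<pi> \<notin> R" for R
      using C unfolding subset.chain_def by blast
    have "ring_set (\<Union>C)" unfolding ring_set_def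
    proof (intro conjI ballI)
      show "1 \<in> \<Union>C" using C CF ring_set_1 by blast
      fix x y assume "x \<in> \<Union>C" "y \<in> \<Union>C"
      then obtain T Y where UY: "x \<in> T" "T \<in> C" "y \<in> Y" "Y \<in> C" by blast
      then have "T \<subseteq> Y \<or> Y \<subseteq> T" using C unfolding subset.chain_def by blast
      then obtain Z where Z: "Z \<in> C" "x \<in> Z" "y \<in> Z" using UY by blast
      then show "x - y \<in> \<Union>C" "x * y \<in> \<Union>C"
        using CF[OF Z(1)] ring_set_diff[of Z x y] ring_set_mult[of Z x y] by blast+
    qed
    then show "\<Union>C \<in> ?F" using C CF by auto
  qed
  then obtain V where V: "ring_set V" "A \<subseteq> V" "inverse \<pi> \<notin> V"
    and maxi: "\<And>T. ring_set T \<Longrightarrow> V \<subseteq> T \<Longrightarrow> inverse \<pi> \<notin> T \<Longrightarrow> T = V" by (auto 4 4)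
  have \<pi>V: "\<pi> \<in> V" using V \<pi> by blast
  note i = ring_set_1[OF V(1)] ring_set_0[OF V(1)] ring_set_mult[OF V(1)] ring_set_add[OF V(1)]
    ring_set_diff[OF V(1)] ring_set_uminus[OF V(1)] ring_set_power[OF V(1)]
  \<comment> \<open>Adjoining the inverse of \<open>1 - \<pi> * b\<close> does not make \<pi>
    invertible, because the powers of this element are 1 modulo \<pi>. By maximality the inverse is
    already in V.\<close>
  have unit: "inverse (1 - \<pi> * b) \<in> V" if b: "b \<in> V" for b
  proof -
    let ?u = "1 - \<pi> * b"
    have u: "?u \<noteq> 0" "?u \<in> V"
      using V(3) b inverse_unique[of \<pi> b] by (auto intro!: i \<pi>V)
    define T where "T = {a / ?u ^ k | a k. a \<in> V}"
    have TI: "a \<in> V \<Longrightarrow> a / ?u ^ k \<in> T" for a k unfolding T_def by blast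
    have "ring_set T" unfolding ring_set_def
    proof (intro conjI ballI)
      show "1 \<in> T" using TI[of 1 0] i(1) by simp
      fix x y assume "x \<in> T" "y \<in> T"
      then obtain a k a' k' where ak: "x = a / ?u ^ k" "y = a' / ?u ^ k'" "a \<in> V" "a' \<in> V" unfolding T_def by blast
      have "x - y = (a * ?u ^ k' - a' * ?u ^ k) / ?u ^ (k + k')" using u by (simp add: ak diff_frac_eq power_add)
      moreover have "a * ?u ^ k' - a' * ?u ^ k \<in> V" by (intro i ak u)
      ultimately show "x - y \<in> T" using TI[of _ "k + k'"] by (simp only:)
      have "x * y = (a * a') / ?u ^ (k + k')" by (simp add: ak power_add)
      then show "x * y \<in> T" using TI[OF i(3)[OF ak(3,4)], of "k + k'"] by (simp only:)
    qed
    moreover have "V \<subseteq> T" using TI[of _ 0] by auto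
    moreover have "inverse \<pi> \<notin> T"
    proof
      assume "inverse \<pi> \<in> T"
      then obtain a k where ak: "a \<in> V" "inverse \<pi> = a / ?u ^ k" unfolding T_def by blast
      have "\<exists>c\<in>V. ?u ^ k = 1 - \<pi> * c" for k
      proof (induction k)
        case 0 then show ?case by (intro bexI[of _ 0]) (auto simp: i)
      next
        case (Suc k)
        then obtain c where c: "c \<in> V" "?u ^ k = 1 - \<pi> * c" by blast
        have "?u ^ Suc k = ?u * (1 - \<pi> * c)" by (simp only: power_Suc c(2))
        also have "\<dots> = 1 - \<pi> * (b + c - \<pi> * b * c)" by (simp add: algebra_simps)
        finally have "?u ^ Suc k = 1 - \<pi> * (b + c - \<pi> * b * c)" .
        moreover have "b + c - \<pi> * b * c \<in> V" by (intro i b c(1) \<pi>V)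
        ultimately show ?case by blast
      qed
      then obtain c where c: "c \<in> V" "?u ^ k = 1 - \<pi> * c" by blast
      have "\<pi> * a = ?u ^ k" using ak u \<pi> by (simp add: field_simps)
      then have "\<pi> * (a + c) = 1" using c by (simp add: algebra_simps)
      then have "inverse \<pi> = a + c" by (rule inverse_unique)
      then show False using V(3) ak(1) c(1) i(4)[of a c] by simp
    qed
    ultimately have "T = V" using maxi by blast
    then show ?thesis using TI[of 1 1] i(1) by (simp add: divide_inverse)
  qed
  \<comment> \<open>V[x] is strictly larger than V, so by maximality it contains the inverse of
    \<pi>.\<close>
  have adjoin: "\<exists>P. poly_over V P \<and> \<pi> * poly P x = 1" if "x \<notin> V" for x
  proof (rule ccontr)
    assume n: "\<not> ?thesis"
    let ?T = "{poly P x | P. poly_over V P}"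
    have "inverse \<pi> \<notin> ?T"
    proof
      assume "inverse \<pi> \<in> ?T"
      then obtain P where P: "poly_over V P" "inverse \<pi> = poly P x" by blast
      then have "\<pi> * poly P x = 1" using \<pi>(2) by (metis right_inverse)
      then show False using n P by blast
    qed
    then have "?T = V" using maxi ring_set_polys[OF V(1)] polys_superset[OF V(1)] by blast
    then show False using polys_superset(2)[OF V(1), of x] that by blast
  qed
  \<comment> \<open>The relation for the inverse of x, multiplied by x^n, expresses x^n through
    lower powers of x, because its own coefficient of x^n is the unit
    \<open>1 - \<pi> * coeff Q 0\<close>. Substituting this into the leading term of P contradicts
    the minimality of its degree. The roles of x and its inverse are interchanged according to which
    degree is larger.\<close>
  have reduce: False if x: "x \<noteq> 0" and P: "poly_over V P" "\<pi> * poly P x = 1"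
    and least: "\<And>R. poly_over V R \<Longrightarrow> \<pi> * poly R x = 1 \<Longrightarrow> degree P \<le> degree R"
    and Q: "poly_over V Q" "\<pi> * poly Q (inverse x) = 1" and le: "degree Q \<le> degree P" for x P Q
  proof -
    let ?n = "degree P" and ?m = "degree Q"
    have "?n > 0"
    proof (rule ccontr)
      assume "\<not> ?n > 0"
      then obtain a where "P = [:a:]" using degree_eq_zeroE by auto
      then have "\<pi> * a = 1" "a \<in> V" using P unfolding poly_over_def by (auto, metis coeff_pCons_0)
      then show False using V(3) inverse_unique by metis
    qed
    define u where "u = 1 - \<pi> * coeff Q 0"
    have q: "coeff Q j \<in> V" for j using Q unfolding poly_over_def by blast
    have iu: "inverse u \<in> V" unfolding u_def using unit q by blast
    have u0: "u \<noteq> 0" unfolding u_def using V(3) q inverse_unique by (metis eq_iff_diff_eq_0)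
    define R where "R = (\<Sum>j\<in>{1..?m}. monom (coeff Q j * inverse u) (?n - j))"
    have RV: "poly_over V R" unfolding R_def using q iu i V(1) by (intro poly_over_sum poly_over_monom) auto
    have dR: "degree R < ?n" unfolding R_def using \<open>?n > 0\<close>
      by (intro le_less_trans[OF degree_sum_le[where n = "?n - 1"]])
         (auto intro!: order_trans[OF degree_monom_le])
    have "u = \<pi> * (poly Q (inverse x) - coeff Q 0)" using Q(2) by (simp add: u_def algebra_simps)
    also have "poly Q (inverse x) = coeff Q 0 + (\<Sum>j\<in>{1..?m}. coeff Q j * inverse x ^ j)"
      unfolding poly_altdef by (simp add: atMost_atLeast0 sum.atLeast_Suc_atMost)
    finally have u: "u = \<pi> * (\<Sum>j\<in>{1..?m}. coeff Q j * inverse x ^ j)" by simp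
    have "x ^ ?n = inverse u * u * x ^ ?n" using u0 by simp
    also have "\<dots> = \<pi> * (\<Sum>j\<in>{1..?m}. coeff Q j * inverse u * (inverse x ^ j * x ^ ?n))"
      by (subst (2) u) (simp add: sum_distrib_left sum_distrib_right mult_ac)
    also have "(\<Sum>j\<in>{1..?m}. coeff Q j * inverse u * (inverse x ^ j * x ^ ?n)) = poly R x"
      unfolding R_def poly_sum poly_monom
    proof (rule sum.cong)
      fix j assume j: "j \<in> {1..?m}"
      have "x ^ ?n = x ^ j * x ^ (?n - j)" using j le by (simp add: power_add[symmetric])
      then show "coeff Q j * inverse u * (inverse x ^ j * x ^ ?n) = coeff Q j * inverse u * x ^ (?n - j)"
        using x by (simp add: power_inverse)
    qed simp
    finally have xn: "x ^ ?n = \<pi> * poly R x" .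
    define P' where "P' = P - monom (lead_coeff P) ?n + smult (lead_coeff P * \<pi>) R"
    have lV: "lead_coeff P \<in> V" using P unfolding poly_over_def by blast
    have "poly P' x = poly P x" by (simp add: P'_def poly_monom xn mult.assoc)
    moreover have "poly_over V P'" unfolding P'_def using P lV RV \<pi>V V(1) i
      by (intro poly_over_add poly_over_diff poly_over_monom poly_over_smult) auto
    ultimately have "?n \<le> degree P'" using least P by simp
    moreover have "degree (P - monom (lead_coeff P) ?n) < ?n"
      using \<open>?n > 0\<close> by (intro coeff_0_degree_minus_1[THEN le_less_trans] degree_lessI) (auto intro!: degree_le simp: coeff_eq_0)
    moreover have "degree (smult (lead_coeff P * \<pi>) R) < ?n" using dR degree_smult_le le_less_trans by blast
    ultimately show False unfolding P'_def using degree_add_less by fastforce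
  qed
  have "valuation_ring V"
  proof
    show "ring_set V" by (rule V)
    fix x show "x \<in> V \<or> inverse x \<in> V"
    proof (rule ccontr)
      assume n: "\<not> ?thesis"
      then have x0: "x \<noteq> 0" using i(2) by auto
      obtain P where P: "poly_over V P" "\<pi> * poly P x = 1"
        "\<And>R. poly_over V R \<Longrightarrow> \<pi> * poly R x = 1 \<Longrightarrow> degree P \<le> degree R"
        using ex_has_least_nat[of "\<lambda>P. poly_over V P \<and> \<pi> * poly P x = 1" _ degree] adjoin[of x] n by metis
      obtain Q where Q: "poly_over V Q" "\<pi> * poly Q (inverse x) = 1"
        "\<And>R. poly_over V R \<Longrightarrow> \<pi> * poly R (inverse x) = 1 \<Longrightarrow> degree Q \<le> degree R"
        using ex_has_least_nat[of "\<lambda>P. poly_over V P \<and> \<pi> * poly P (inverse x) = 1" _ degree] adjoin[of "inverse x"] n by metis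
      show False
      proof (cases "degree Q \<le> degree P")
        case True then show ?thesis using reduce[of x P Q] x0 P Q by blast
      next
        case False then show ?thesis using reduce[of "inverse x" Q P] x0 P Q by auto
      qed
    qed
  qed
  then show thesis using that[of V] V \<pi>V by (simp add: vmax_def)
qed

section \<open>Unicritical maps and discrete valuations\<close>

lemma prime_dvd_prime_power_choose:
  fixes p :: nat
  assumes "Factorial_Ring.prime p" "0 < k" "k < p ^ r"
  shows "p dvd (p ^ r choose k)"
proof (rule ccontr)
  assume "\<not> ?thesis"
  then have "coprime (p ^ r) (p ^ r choose k)" using assms by (simp add: prime_imp_coprime)
  moreover have "k * (p ^ r choose k) = p ^ r * (p ^ r - 1 choose (k - 1))"
    using times_binomial_minus1_eq[of k "p ^ r"] assms by simp
  then have "p ^ r dvd k * (p ^ r choose k)" by simp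
  ultimately have "p ^ r dvd k" by (simp add: coprime_dvd_mult_left_iff)
  then show False using assms by (auto dest: dvd_imp_le)
qed

text \<open>Expand ((x - y) + y)^q: the middle binomial coefficients are divisible by p, and each
  middle term also has a factor x - y. The second factor is essential for x close to y, where (x -
  y)^q competes with p (x - y).\<close>

lemma power_diff_prime_power:
  fixes p :: nat and R :: "'a::idom set"
  assumes p: "Factorial_Ring.prime p" and R: "ring_set R" and xy: "x \<in> R" "y \<in> R"
  shows "\<exists>u\<in>R. x ^ (p ^ r) - y ^ (p ^ r) = (x - y) ^ (p ^ r) + of_nat p * (x - y) * u"
proof -
  let ?q = "p ^ r" and ?z = "x - y"
  define u where "u = (\<Sum>k\<in>{1..<?q}. of_nat ((?q choose k) div p) * ?z ^ (k - 1) * y ^ (?q - k))"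
  have q: "?q > 0" using p prime_gt_0_nat by simp
  have "x ^ ?q = (?z + y) ^ ?q" by simp
  also have "\<dots> = (\<Sum>k\<le>?q. of_nat (?q choose k) * ?z ^ k * y ^ (?q - k))" by (rule binomial_ring)
  also have "{..?q} = insert 0 (insert ?q {1..<?q})" using q by auto
  also have "(\<Sum>k\<in>insert 0 (insert ?q {1..<?q}). of_nat (?q choose k) * ?z ^ k * y ^ (?q - k)) =
      y ^ ?q + (?z ^ ?q + (\<Sum>k\<in>{1..<?q}. of_nat (?q choose k) * ?z ^ k * y ^ (?q - k)))"
    using q by simp
  also have "(\<Sum>k\<in>{1..<?q}. of_nat (?q choose k) * ?z ^ k * y ^ (?q - k)) = of_nat p * ?z * u"
    unfolding u_def sum_distrib_left
  proof (rule sum.cong)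
    fix k assume k: "k \<in> {1..<?q}"
    have "?q choose k = p * ((?q choose k) div p)"
      using prime_dvd_prime_power_choose[OF p, of k r] k by simp
    then have "(of_nat (?q choose k) :: 'a) = of_nat p * of_nat ((?q choose k) div p)" by (metis of_nat_mult)
    moreover have "?z ^ k = ?z * ?z ^ (k - 1)" using k power_Suc[of ?z "k - 1"] by simp
    ultimately show "of_nat (?q choose k) * ?z ^ k * y ^ (?q - k) =
        of_nat p * ?z * (of_nat ((?q choose k) div p) * ?z ^ (k - 1) * y ^ (?q - k))"
      by (simp only: mult_ac)
  qed simp
  finally have "x ^ ?q - y ^ ?q = ?z ^ ?q + of_nat p * ?z * u" by simp
  moreover have "u \<in> R" unfolding u_def using R xy
    by (intro ring_set_sum ring_set_mult ring_set_power ring_set_diff ring_set_of_nat)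
  ultimately show ?thesis by blast
qed

abbreviation unicrit :: "nat \<Rightarrow> 'a::comm_ring_1 \<Rightarrow> 'a \<Rightarrow> 'a" where
  "unicrit q c \<equiv> \<lambda>x. x ^ q + c"

lemma unicrit_in_ring_set:
  fixes R :: "'a::idom set"
  assumes R: "ring_set R" and "c \<in> R" "x \<in> R" shows "(unicrit q c ^^ n) x \<in> R"
  by (induction n) (auto intro: assms ring_set_add[OF R] ring_set_power[OF R])

section \<open>Preimages and orbits under x^q + c in a valuation ring\<close>

context valuation_ring
begin

lemma unicrit_preimage_in_V:
  assumes c: "c \<in> V" and q: "q > 0" shows "(unicrit q c ^^ n) x \<in> V \<Longrightarrow> x \<in> V"
proof (induction n)
  case (Suc n)
  then have "(unicrit q c ^^ n) x ^ q + c \<in> V" by simp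
  then have "(unicrit q c ^^ n) x ^ q + c - c \<in> V" using c V_intros(5) by blast
  then have "(unicrit q c ^^ n) x ^ q \<in> V" by simp
  then show ?case using Suc.IH V_power_iff[OF q] by simp
qed simp

text \<open>Outside V the summand c is negligible against x^q, so each application of the map
  multiplies the value by exactly q.\<close>

lemma unicrit_preimage_escaping:
  assumes c: "c \<in> V" and q: "q > 0" and \<beta>: "\<beta> \<notin> V"
  shows "(unicrit q c ^^ n) x = \<beta> \<Longrightarrow> x \<notin> V \<and> \<beta> \<asymp> x ^ (q ^ n)"
proof (induction n arbitrary: x)
  case 0 then show ?case using \<beta> by simp
next
  case (Suc n)
  have "(unicrit q c ^^ n) (x ^ q + c) = \<beta>" using Suc.prems by (simp only: funpow_Suc_right o_apply)
  then have IH: "x ^ q + c \<notin> V" "\<beta> \<asymp> (x ^ q + c) ^ (q ^ n)"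
    using Suc.IH[of "x ^ q + c"] by blast+
  have xq: "x ^ q \<notin> V" using IH(1) c V_intros(4) by blast
  then have "x \<notin> V" "x \<noteq> 0" using V_power_iff[OF q] V_intros(2) by auto
  have "c * inverse (x ^ q) \<in> M" using inverse_in_M[OF xq] c M_mult' by blast
  then have "x ^ q * (1 + c * inverse (x ^ q)) \<asymp> x ^ q" by (rule vassoc_one_plus)
  moreover have "x ^ q * (1 + c * inverse (x ^ q)) = x ^ q + c" using \<open>x \<noteq> 0\<close> by (simp add: field_simps)
  ultimately have "x ^ q + c \<asymp> x ^ q" by (simp only:)
  then have "(x ^ q + c) ^ (q ^ n) \<asymp> (x ^ q) ^ (q ^ n)" by (rule vassoc_power)
  then have "\<beta> \<asymp> x ^ (q ^ Suc n)" using IH(2) vassoc_trans by (simp add: power_mult[symmetric])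
  then show ?case using \<open>x \<notin> V\<close> by blast
qed

lemma prod_mset_const_power: "(\<Prod>x\<in>#A. y ^ k) = (y :: 'b::comm_monoid_mult) ^ (k * size A)"
  by (induction A) (auto simp: power_add)

lemma prod_mset_power: "(\<Prod>x\<in>#A. u x) ^ k = (\<Prod>x\<in>#A. (u x :: 'b::comm_monoid_mult) ^ k)"
  by (induction A) (auto simp: power_mult_distrib)

lemma prod_mset_in_M: "A \<noteq> {#} \<Longrightarrow> (\<And>x. x \<in># A \<Longrightarrow> u x \<in> M) \<Longrightarrow> (\<Prod>x\<in>#A. u x) \<in> M"
proof (induction A)
  case (add x A)
  have "(\<Prod>x\<in>#A. u x) \<in> V" by (rule ring_set_prod_mset[OF ring]) (use add.prems M_in_V in auto)
  then show ?case using add.prems by (auto intro: M_mult)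
qed simp

text \<open>In both cases below a factor of \<open>f\<^sup>n(x) - \<beta>\<close> is evaluated at a point \<open>r\<close> of \<open>K\<close> for which
  every root \<open>x\<close> satisfies \<open>0 < \<bar>v(r - x)\<bar> = O(q\<^sup>-\<^sup>n)\<close>; discreteness of \<open>v\<close> on \<open>K\<close> then forces the factor
  to have many roots.\<close>

lemma escaping_factor_bound:
  assumes \<pi>: "\<pi> \<in> M" "\<pi> \<noteq> 0" and K: "field_set K" "discrete_on \<pi> D K" "D > 0"
    and c: "c \<in> V" and \<beta>: "\<beta> \<in> K" "\<beta> \<notin> V" and q: "q > 0"
  shows "\<exists>N. \<forall>n A. A \<noteq> {#} \<and> (\<forall>x\<in>#A. (unicrit q c ^^ n) x = \<beta>) \<and> (\<forall>r\<in>K. (\<Prod>x\<in>#A. r - x) \<in> K)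
           \<longrightarrow> q ^ n \<le> N * size A"
proof -
  have "inverse \<beta> \<in> M" "inverse \<beta> \<noteq> 0" "inverse \<beta> \<in> K"
    using \<beta> inverse_in_M V_intros(2) K field_set_inverse by auto
  then obtain B where B: "inverse \<beta> \<preceq> \<pi> ^ B" using discrete_on_upper[OF \<pi> K(2)] by blast
  have "q ^ n \<le> (D * B) * size A"
    if A: "A \<noteq> {#}" "\<forall>x\<in>#A. (unicrit q c ^^ n) x = \<beta>" "\<forall>r\<in>K. (\<Prod>x\<in>#A. r - x) \<in> K" for n A
  proof -
    \<comment> \<open>The evaluation point is 0. The preimages of a non-integral \<beta> are not
      integral, so it is the inverse of the product that has positive value.\<close>
    define y where "y = (\<Prod>x\<in>#A. inverse (0 - x))"
    have x: "x \<notin> V" "\<beta> \<asymp> x ^ (q ^ n)" if "x \<in># A" for x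
      using unicrit_preimage_escaping[OF c q \<beta>(2)] A that by auto
    have "y = inverse (\<Prod>x\<in>#A. 0 - x)" unfolding y_def by (induction A) auto
    moreover have "(\<Prod>x\<in>#A. 0 - x) \<in> K" using A(3) ring_set_0[OF field_setD[OF K(1)]] by blast
    ultimately have yK: "y \<in> K" using field_set_inverse[OF K(1)] by (simp only:)
    have xn: "0 - x \<notin> V" if "x \<in># A" for x
      using x(1)[OF that] V_intros(6)[of "0 - x"] by auto
    have yM: "y \<in> M" unfolding y_def using A(1) inverse_in_M[OF xn] by (rule prod_mset_in_M)
    have "y ^ (q ^ n) = (\<Prod>x\<in>#A. inverse (0 - x) ^ (q ^ n))" unfolding y_def by (rule prod_mset_power)
    also have "\<dots> \<preceq> (\<Prod>x\<in>#A. \<pi> ^ B)"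
    proof (rule vdvd_prod_mset)
      fix x assume xA: "x \<in># A"
      have "0 - x \<asymp> x" unfolding vassoc_def using vdvd_uminus[of x x] vdvd_uminus[of "-x" "-x"] by simp
      then have "(0 - x) ^ (q ^ n) \<asymp> \<beta>" using x(2)[OF xA] vassoc_power vassoc_sym vassoc_trans by blast
      then have "inverse ((0 - x) ^ (q ^ n)) \<asymp> inverse \<beta>" by (rule vassoc_inverse)
      then have "inverse (0 - x) ^ (q ^ n) \<preceq> inverse \<beta>" by (simp only: vassoc_def power_inverse)
      then show "inverse (0 - x) ^ (q ^ n) \<preceq> \<pi> ^ B" using B by (rule vdvd_trans)
    qed
    also have "(\<Prod>x\<in>#A. \<pi> ^ B) = \<pi> ^ (B * size A)" by (rule prod_mset_const_power)
    finally show ?thesis using discrete_on_bound[OF \<pi> K(2,3) yK yM] by (simp add: mult.assoc)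
  qed
  then show ?thesis by blast
qed

text \<open>The index k is the point of the cycle to which the n-th preimages reduce. Two invariants
  are carried along. First, v(z) < v(b): the cycle closes only up to b, and strictness makes this
  error negligible when k passes through 0. Second, j v(p) + q^t v(z) \<le> B v(p): each further
  step back increases t if v(z^q) \<le> v(p z) and j otherwise, and j cannot exceed B. The first
  step only produces the initial bound from b, hence t + j + 1 = n.\<close>

lemma periodic_residue_preimages:
  fixes p :: nat
  assumes p: "Factorial_Ring.prime p" "of_nat p \<in> M" "of_nat p \<noteq> (0::'a)" and q: "q = p ^ r" "r \<ge> 1"
    and c: "c \<in> V" and \<beta>: "\<beta> \<in> V" and m: "m \<ge> 1" and b: "b = (unicrit q c ^^ m) \<beta> - \<beta>" "b \<in> M" "b \<noteq> 0"
    and B: "b \<preceq> of_nat p ^ B"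
  shows "\<exists>k<m. (n = 0 \<longrightarrow> k = 0) \<and> (\<forall>x. (unicrit q c ^^ n) x = \<beta> \<longrightarrow>
    (let z = x - (unicrit q c ^^ k) \<beta> in z \<in> M \<and> (n \<ge> 1 \<longrightarrow> z \<noteq> 0 \<and> (\<exists>w\<in>M. b = z * w) \<and>
       (\<exists>j t. t + j + 1 = n \<and> of_nat p ^ j * z ^ (q ^ t) \<preceq> of_nat p ^ B))))"
proof (induction n)
  case 0
  then show ?case using m zero_in_M by (intro exI[of _ 0]) auto
next
  case (Suc n)
  let ?f = "unicrit q c" and ?p = "of_nat p :: 'a"
  have q2: "q \<ge> 2"
    using q p(1) prime_ge_2_nat[of p] power_increasing[of 1 r p] by simp
  obtain k where k: "k < m" "n = 0 \<longrightarrow> k = 0" and IH: "\<And>x. (?f ^^ n) x = \<beta> \<Longrightarrow>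
    (let z = x - (?f ^^ k) \<beta> in z \<in> M \<and> (n \<ge> 1 \<longrightarrow> z \<noteq> 0 \<and> (\<exists>w\<in>M. b = z * w) \<and>
       (\<exists>j t. t + j + 1 = n \<and> ?p ^ j * z ^ (q ^ t) \<preceq> ?p ^ B)))"
    using Suc.IH by blast
  \<comment> \<open>One step back on the cycle; before 0 comes m - 1.\<close>
  define k' where "k' = (if k = 0 then m - 1 else k - 1)"
  define r' where "r' = (?f ^^ k') \<beta>"
  have r'V: "r' \<in> V" unfolding r'_def using ring c \<beta> by (rule unicrit_in_ring_set)
  \<comment> \<open>At the wrap-around the image is f^m(\<beta>) = \<beta> + b instead of
    \<beta>.\<close>
  have fr: "?f r' = (?f ^^ k) \<beta> + (if k = 0 then b else 0)"
  proof (cases "k = 0")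
    case True
    then have "?f r' = (?f ^^ Suc (m - 1)) \<beta>" by (simp add: r'_def k'_def)
    then show ?thesis using True m b(1) by simp
  next
    case False
    then have "k' = k - 1" by (simp add: k'_def)
    then have "?f r' = (?f ^^ Suc (k - 1)) \<beta>" unfolding r'_def funpow.simps o_apply by (simp only:)
    moreover have "Suc (k - 1) = k" using False by simp
    ultimately show ?thesis using False by (simp only: if_False add_0_right)
  qed
  show ?case
  proof (intro exI[of _ k'] conjI allI impI)
    show "k' < m" using k m by (auto simp: k'_def)
    fix x assume x: "(?f ^^ Suc n) x = \<beta>"
    then have fx: "(?f ^^ n) (?f x) = \<beta>" by (simp only: funpow_Suc_right o_apply)
    have xV: "x \<in> V" using unicrit_preimage_in_V[OF c, of q "Suc n" x] x \<beta> q2 by simp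
    define z where "z = x - r'"
    define z0 where "z0 = ?f x - (?f ^^ k) \<beta>"
    define e where "e = ?f x - ?f r'"
    have zV: "z \<in> V" unfolding z_def using xV r'V V_intros(5) by blast
    have z0M: "z0 \<in> M" using IH[OF fx] by (simp add: z0_def Let_def)
    have e0: "e = z0 - (if k = 0 then b else 0)" unfolding e_def z0_def fr by simp
    have eM: "e \<in> M" unfolding e0 using z0M b M_diff zero_in_M by auto
    obtain u where u: "u \<in> V" "x ^ q - r' ^ q = z ^ q + ?p * z * u"
      using power_diff_prime_power[OF p(1) ring xV r'V, of r] unfolding q(1) z_def by blast
    have e: "e = z ^ q + ?p * z * u" unfolding e_def using u(2) by simp
    have pzuM: "?p * z * u \<in> M" using p(2) zV u(1) M_mult by blast
    then have "z ^ q \<in> M" using eM M_diff[OF eM pzuM] unfolding e by simp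
    then have zM: "z \<in> M" using M_power_iff zV q2 by auto
    \<comment> \<open>The cofactor of z in e lies in M, so v(z) < v(e) when e is nonzero; this keeps
      the first invariant strict.\<close>
    have "z * (z ^ (q - 1) + ?p * u) = e"
      unfolding e using q2 power_Suc[of z "q - 1"] by (simp add: distrib_left mult_ac)
    moreover have "z ^ (q - 1) + ?p * u \<in> M"
      using M_add[of "z ^ (q - 1)" "?p * u"] M_power_iff[OF zV, of "q - 1"] zM q2 M_mult[OF p(2) u(1)] by simp
    ultimately obtain w where w: "w \<in> M" "e = z * w" by metis
    show "let z = x - (?f ^^ k') \<beta> in z \<in> M \<and> (1 \<le> Suc n \<longrightarrow> z \<noteq> 0 \<and> (\<exists>w\<in>M. b = z * w) \<and>
       (\<exists>j t. t + j + 1 = Suc n \<and> ?p ^ j * z ^ (q ^ t) \<preceq> ?p ^ B))"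
      unfolding r'_def[symmetric] z_def[symmetric] Let_def
    proof (intro conjI impI zM)
      have main: "z \<noteq> 0 \<and> (\<exists>w\<in>M. b = z * w) \<and> (\<exists>j t. t + j + 1 = Suc n \<and> ?p ^ j * z ^ (q ^ t) \<preceq> ?p ^ B)"
      proof (cases "n = 0")
        case True
        then have "z0 = 0" using fx k by (simp add: z0_def)
        then have be: "b = - e" using e0 True k by simp
        then have "b = z * (- w)" "- w \<in> M" using w M_uminus by auto
        moreover have "z \<preceq> ?p ^ B" using calculation B vdvd_trans vdvd_multI[OF M_in_V] by metis
        moreover have "\<exists>w\<in>M. b = z * w" using calculation by blast
        ultimately show ?thesis using b(3) True by (intro conjI exI[of _ 0]) auto
      next
        case False
        then obtain w0 j t where o: "z0 \<noteq> 0" "w0 \<in> M" "b = z0 * w0" "t + j + 1 = n"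
          "?p ^ j * z0 ^ (q ^ t) \<preceq> ?p ^ B"
          using IH[OF fx] by (auto simp: z0_def[symmetric] Let_def)
        define w1 where "w1 = (if k = 0 then - w0 else 0)"
        have w1M: "w1 \<in> M" using o(2) M_uminus zero_in_M by (auto simp: w1_def)
        \<comment> \<open>As v(z0) < v(b), the correction by b does not change the value of
          z0.\<close>
        have "e = z0 * (1 + w1)" unfolding e0 w1_def using o(3) by (auto simp: algebra_simps)
        then have ez: "e \<asymp> z0" using vassoc_one_plus[OF w1M] by simp
        then have "e \<noteq> 0" using o(1) vassoc_sym by force
        then have z0: "z \<noteq> 0" using w by auto
        have "\<exists>v\<in>V. z0 = e * v" using ez unfolding vassoc_def vdvd_def by blast
        then obtain v where v: "v \<in> V" "z0 = e * v" by blast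
        have "b = z * (w * (v * w0))" using o(3) v(2) w(2) by (simp add: mult_ac)
        moreover have "w * (v * w0) \<in> M" using w(1) v(1) o(2) M_in_V V_intros(3) M_mult by blast
        ultimately have bz: "\<exists>w\<in>M. b = z * w" by blast
        have "z ^ q \<preceq> ?p * z \<or> ?p * z \<preceq> z ^ q" by (rule vdvd_total)
        then have "\<exists>j t. t + j + 1 = Suc n \<and> ?p ^ j * z ^ (q ^ t) \<preceq> ?p ^ B"
        proof
          assume a: "z ^ q \<preceq> ?p * z"
          have "z ^ q \<preceq> ?p * z * u" using vdvd_trans[OF a] vdvd_multI u by blast
          then have "z ^ q \<preceq> e" unfolding e by (intro vdvd_add) auto
          then have "z ^ q \<preceq> z0" using ez vdvd_trans unfolding vassoc_def by blast
          then have "?p ^ j * (z ^ q) ^ (q ^ t) \<preceq> ?p ^ j * z0 ^ (q ^ t)" by (intro vdvd_mult vdvd_power) auto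
          then have "?p ^ j * (z ^ q) ^ (q ^ t) \<preceq> ?p ^ B" using o(5) by (rule vdvd_trans)
          then have "?p ^ j * z ^ (q ^ Suc t) \<preceq> ?p ^ B" by (simp add: power_mult[symmetric])
          then show ?thesis using o(4) by (intro exI[of _ j] exI[of _ "Suc t"]) auto
        next
          assume a: "?p * z \<preceq> z ^ q"
          then have "?p * z \<preceq> e" unfolding e using u(1) by (intro vdvd_add vdvd_multI) auto
          then have "?p * z \<preceq> z0" using ez vdvd_trans unfolding vassoc_def by blast
          then have s: "?p ^ j * (?p * z) ^ (q ^ t) \<preceq> ?p ^ j * z0 ^ (q ^ t)" by (intro vdvd_mult vdvd_power) auto
          \<comment> \<open>Of the factor p^(q^t) a single p is kept, which is enough to increase j
            by 1.\<close>
          have "?p ^ 1 \<preceq> ?p ^ (q ^ t)" using power_vdvd_power[OF p(2,3), of 1 "q ^ t"] one_le_power[of q t] q2 by simp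
          then have "?p ^ j * (?p ^ 1 * z ^ (q ^ t)) \<preceq> ?p ^ j * (?p ^ (q ^ t) * z ^ (q ^ t))"
            by (intro vdvd_mult) auto
          also have "\<dots> = ?p ^ j * (?p * z) ^ (q ^ t)" by (simp add: power_mult_distrib)
          also note s
          also note o(5)
          finally have "?p ^ Suc j * z ^ (q ^ t) \<preceq> ?p ^ B" by (simp add: mult_ac)
          then show ?thesis using o(4) by (intro exI[of _ "Suc j"] exI[of _ t]) auto
        qed
        then show ?thesis using z0 bz by blast
      qed
      then show "z \<noteq> 0" "\<exists>w\<in>M. b = z * w" "\<exists>j t. t + j + 1 = Suc n \<and> ?p ^ j * z ^ (q ^ t) \<preceq> ?p ^ B"
        by blast+
    qed
  qed simp
qed

lemma periodic_residue_factor_bound: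
  fixes p :: nat
  assumes p: "Factorial_Ring.prime p" "of_nat p \<in> M" "of_nat p \<noteq> (0::'a)" and q: "q = p ^ r" "r \<ge> 1"
    and K: "field_set K" "discrete_on (of_nat p) D K" "D > 0"
    and c: "c \<in> V" "c \<in> K" and \<beta>: "\<beta> \<in> V" "\<beta> \<in> K"
    and m: "m \<ge> 1" and b: "(unicrit q c ^^ m) \<beta> - \<beta> \<in> M" "(unicrit q c ^^ m) \<beta> \<noteq> \<beta>"
  shows "\<exists>N. \<forall>n A. A \<noteq> {#} \<and> (\<forall>x\<in>#A. (unicrit q c ^^ n) x = \<beta>) \<and> (\<forall>r\<in>K. (\<Prod>x\<in>#A. r - x) \<in> K)
           \<longrightarrow> q ^ n \<le> N * size A"
proof -
  let ?f = "unicrit q c" and ?p = "of_nat p :: 'a"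
  define b where "b = (?f ^^ m) \<beta> - \<beta>"
  have orbit: "(?f ^^ k) \<beta> \<in> K" for k using field_setD[OF K(1)] c \<beta> by (intro unicrit_in_ring_set)
  have bb: "b \<in> M" "b \<noteq> 0" "b \<in> K"
    using b orbit \<beta> ring_set_diff[OF field_setD[OF K(1)]] by (auto simp: b_def)
  obtain B where B: "b \<preceq> ?p ^ B" using discrete_on_upper[OF p(2,3) K(2) bb(3,2,1)] by blast
  have q1: "q \<ge> 1" using q prime_gt_0_nat[OF p(1)] by (simp add: Suc_le_eq)
  \<comment> \<open>In the constant, q^(B+1) makes up for the exponent n - 1 - B, where the
    subtraction is truncated at 0; the final 1 covers n = 0.\<close>
  have "q ^ n \<le> (q ^ Suc B * (D * B) + 1) * size A"
    if A: "A \<noteq> {#}" "\<forall>x\<in>#A. (?f ^^ n) x = \<beta>" "\<forall>r\<in>K. (\<Prod>x\<in>#A. r - x) \<in> K" for n A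
  proof (cases "n = 0")
    case True
    then show ?thesis using A(1) by (simp add: Suc_le_eq nonempty_has_size)
  next
    case False
    obtain k where k: "\<And>x. (?f ^^ n) x = \<beta> \<Longrightarrow>
      (let z = x - (?f ^^ k) \<beta> in z \<in> M \<and> (n \<ge> 1 \<longrightarrow> z \<noteq> 0 \<and> (\<exists>w\<in>M. b = z * w) \<and>
         (\<exists>j t. t + j + 1 = n \<and> ?p ^ j * z ^ (q ^ t) \<preceq> ?p ^ B)))"
      using periodic_residue_preimages[OF p q c(1) \<beta>(1) m b_def bb(1,2) B, of n] by blast
    define r where "r = (?f ^^ k) \<beta>"
    define y where "y = (\<Prod>x\<in>#A. r - x)"
    have x: "r - x \<in> M" "(r - x) ^ (q ^ (n - 1 - B)) \<preceq> ?p ^ B" if xA: "x \<in># A" for x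
    proof -
      let ?z = "x - r"
      obtain j t where z: "?z \<in> M" "t + j + 1 = n" "?p ^ j * ?z ^ (q ^ t) \<preceq> ?p ^ B"
        using k[of x, folded r_def, unfolded Let_def] A(2) xA False by auto
      have zV: "?z \<in> V" using z(1) M_in_V by blast
      have pV: "?p \<in> V" using p(2) M_in_V by blast
      \<comment> \<open>Since z is integral, the second invariant bounds j by B, so t is at least n
        - 1 - B.\<close>
      have "?p ^ j \<preceq> ?p ^ j * ?z ^ (q ^ t)" using zV V_intros(7) by (intro vdvd_multI)
      then have "?p ^ j \<preceq> ?p ^ B" using z(3) by (rule vdvd_trans)
      then have "j \<le> B" using power_vdvd_power[OF p(2,3)] by blast
      then have "n - 1 - B \<le> t" using z(2) by simp
      then have "q ^ (n - 1 - B) \<le> q ^ t" using q1 by (rule power_increasing)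
      then have "?z ^ (q ^ t) = ?z ^ (q ^ (n - 1 - B)) * ?z ^ (q ^ t - q ^ (n - 1 - B))"
        by (simp add: power_add[symmetric])
      then have "?z ^ (q ^ (n - 1 - B)) \<preceq> ?z ^ (q ^ t)" using vdvd_multI[OF V_intros(7)[OF zV]] by metis
      also have "?z ^ (q ^ t) \<preceq> ?z ^ (q ^ t) * ?p ^ j" using pV V_intros(7) by (intro vdvd_multI)
      also have "\<dots> \<preceq> ?p ^ B" using z(3) by (simp add: mult.commute)
      finally have s: "?z ^ (q ^ (n - 1 - B)) \<preceq> ?p ^ B" .
      have "r - x = - ?z" by simp
      then show "r - x \<in> M" using z(1) M_uminus by metis
      have "(r - x) \<preceq> ?z" using \<open>r - x = - ?z\<close> vdvd_uminus[of "- ?z" "- ?z"] by simp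
      then show "(r - x) ^ (q ^ (n - 1 - B)) \<preceq> ?p ^ B" using s vdvd_power vdvd_trans by blast
    qed
    have yK: "y \<in> K" using A(3) orbit by (simp add: y_def r_def)
    have yM: "y \<in> M" unfolding y_def using A x by (intro prod_mset_in_M) auto
    have "y ^ (q ^ (n - 1 - B)) = (\<Prod>x\<in>#A. (r - x) ^ (q ^ (n - 1 - B)))" unfolding y_def by (rule prod_mset_power)
    also have "\<dots> \<preceq> (\<Prod>x\<in>#A. ?p ^ B)" using x by (intro vdvd_prod_mset) auto
    also have "\<dots> = ?p ^ (B * size A)" by (rule prod_mset_const_power)
    finally have le: "q ^ (n - 1 - B) \<le> D * (B * size A)" using discrete_on_bound[OF p(2,3) K(2,3) yK yM] by blast
    have "q ^ n \<le> q ^ (Suc B + (n - 1 - B))" using q1 by (intro power_increasing) auto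
    also have "\<dots> = q ^ Suc B * q ^ (n - 1 - B)" by (rule power_add)
    also have "\<dots> \<le> q ^ Suc B * (D * (B * size A))" using le by (rule mult_le_mono2)
    also have "\<dots> \<le> (q ^ Suc B * (D * B) + 1) * size A" by (simp add: algebra_simps)
    finally show ?thesis .
  qed
  then show ?thesis by blast
qed

text \<open>A nonzero polynomial over the residue field has no more roots than its degree. Splitting
  off one root modulo M at a time avoids forming the quotient V/M.\<close>

lemma incongruent_roots_bound:
  assumes "poly_over V P" "finite S" "S \<subseteq> V" "\<And>x y. x \<in> S \<Longrightarrow> y \<in> S \<Longrightarrow> x \<noteq> y \<Longrightarrow> x - y \<notin> M"
    "\<And>x. x \<in> S \<Longrightarrow> poly P x \<in> M" "card S > degree P"
  shows "coeff P i \<in> M"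
  using assms
proof (induction "degree P" arbitrary: P S i rule: less_induct)
  case less
  have "S \<noteq> {}" using less.prems by auto
  then obtain s where s: "s \<in> S" by blast
  show ?case
  proof (cases "degree P = 0")
    case True
    then obtain a where "P = [:a:]" by (rule degree_eq_zeroE)
    then show ?thesis using less.prems(5)[OF s] zero_in_M by (cases i) auto
  next
    case False
    define R where "R = synthetic_div P s"
    have PR: "P = [:- s, 1:] * R + [:poly P s:]" unfolding R_def using synthetic_div_correct'[of s P] by simp
    have dR: "degree R = degree P - 1" unfolding R_def by (rule degree_synthetic_div)
    have RV: "poly_over V R" unfolding R_def
      using less.prems(1,3) s by (intro poly_over_synthetic_div[OF ring]) auto
    have "coeff R j \<in> M" for j
    proof (rule less.hyps[of R "S - {s}"])
      show "degree R < degree P" using dR False by simp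
      show "degree R < card (S - {s})" using dR False less.prems s by (simp add: card_Diff_singleton)
      fix x assume x: "x \<in> S - {s}"
      have "(x - s) * poly R x = poly P x - poly P s" by (subst PR) (simp add: algebra_simps)
      then have "(x - s) * poly R x \<in> M" using less.prems(5) s x M_diff by auto
      moreover have "x - s \<notin> M" using x s less.prems(4) by auto
      moreover have "x \<in> V" "s \<in> V" using x s less.prems(3) by auto
      then have "x - s \<in> V" "poly R x \<in> V"
        using RV poly_in_ring_set[OF ring RV] V_intros(5) by blast+
      ultimately show "poly R x \<in> M" using M_prime by blast
    qed (use less.prems RV in auto)
    moreover have "coeff P i = - s * coeff R i + (if i = 0 then 0 else coeff R (i - 1)) + (if i = 0 then poly P s else 0)"
      by (subst PR) (auto simp: coeff_pCons split: nat.splits)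
    moreover have "s \<in> V" "poly P s \<in> M" using less.prems(3,5) s by auto
    ultimately show ?thesis using zero_in_M V_intros(6) by (simp only:) (intro M_add M_mult', auto)
  qed
qed

text \<open>By \<open>res\<close> the residue of every integral element of K is a root of a nonzero
  polynomial of degree at most D over the field with p elements. These polynomials are finitely
  many, so the orbit of \<beta> repeats modulo M. The map is injective modulo M, since x^q - y^q is
  (x - y)^q there; so a repetition can be pulled back to \<beta> itself.\<close>

lemma unicrit_periodic_residue:
  fixes p :: nat
  assumes p: "Factorial_Ring.prime p" "of_nat p \<in> M" and q: "q = p ^ r" "r \<ge> 1"
    and c: "c \<in> V" and \<beta>: "\<beta> \<in> V" and K: "\<And>n. (unicrit q c ^^ n) \<beta> \<in> K"
    and res: "\<And>y. y \<in> K \<Longrightarrow> y \<in> V \<Longrightarrow>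
      \<exists>t. (\<exists>i\<le>D. t i = 1) \<and> (\<forall>i. t i \<in> {0..<int p}) \<and> (\<Sum>i\<le>D. of_int (t i) * y ^ i) \<in> M"
  shows "\<exists>m\<ge>1. (unicrit q c ^^ m) \<beta> - \<beta> \<in> M"
proof -
  let ?f = "unicrit q c"
  have orb: "(?f ^^ n) \<beta> \<in> V" for n using ring c \<beta> by (rule unicrit_in_ring_set)
  have inj: "x - y \<in> M" if xy': "x \<in> V" "y \<in> V" "?f x - ?f y \<in> M" for x y
  proof -
    obtain u where u: "u \<in> V" "x ^ q - y ^ q = (x - y) ^ q + of_nat p * (x - y) * u"
      using power_diff_prime_power[OF p(1) ring xy'(1,2), of r] unfolding q(1) by blast
    have xy: "x - y \<in> V" using xy' V_intros(5) by blast
    have "of_nat p * (x - y) * u \<in> M" using p(2) xy u(1) M_mult by blast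
    moreover have "(x - y) ^ q + of_nat p * (x - y) * u \<in> M" using xy'(3) u(2) by simp
    ultimately have "(x - y) ^ q + of_nat p * (x - y) * u - of_nat p * (x - y) * u \<in> M" using M_diff by blast
    then have "(x - y) ^ q \<in> M" by simp
    then show ?thesis using M_power_iff[OF xy, of q] q prime_gt_0_nat[OF p(1)] by auto
  qed
  have "\<exists>i j. i < j \<and> (?f ^^ j) \<beta> - (?f ^^ i) \<beta> \<in> M"
  proof (rule ccontr)
    assume n: "\<not> ?thesis"
    have inc: "(?f ^^ j) \<beta> - (?f ^^ i) \<beta> \<notin> M" if "i \<noteq> j" for i j
      using n that M_uminus[of "(?f ^^ j) \<beta> - (?f ^^ i) \<beta>"] by (cases "i < j") auto
    have "\<exists>t. (\<exists>i\<le>D. t i = 1) \<and> (\<forall>i. t i \<in> {0..<int p}) \<and> (\<Sum>i\<le>D. of_int (t i) * (?f ^^ n) \<beta> ^ i) \<in> M" for n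
      using res[OF K orb] .
    then obtain t where t: "\<And>n. \<exists>i\<le>D. t n i = 1" "\<And>n i. t n i \<in> {0..<int p}"
      "\<And>n. (\<Sum>i\<le>D. of_int (t n i) * (?f ^^ n) \<beta> ^ i) \<in> M" by metis
    \<comment> \<open>Restricting to {..D} puts the coefficient vectors into a finite set of
      functions.\<close>
    define T where "T n = restrict (t n) {..D}" for n
    have "range T \<subseteq> PiE {..D} (\<lambda>_. {0..<int p})"
    proof
      fix y assume "y \<in> range T"
      then obtain n where "y = T n" by blast
      then show "y \<in> PiE {..D} (\<lambda>_. {0..<int p})" using t(2) by (auto simp: T_def PiE_def)
    qed
    then have "finite (range T)" using finite_PiE[of "{..D}" "\<lambda>_. {0..<int p}"] finite_subset by auto
    then obtain n0 where "infinite {n. T n = T n0}"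
      using pigeonhole_infinite[of UNIV T] by auto
    \<comment> \<open>D + 1 pairwise incongruent orbit points share one polynomial of degree at most
      D, which is too many roots.\<close>
    then obtain I where I: "I \<subseteq> {n. T n = T n0}" "finite I" "card I = Suc D"
      using infinite_arbitrarily_large by blast
    define P where "P = (\<Sum>i\<le>D. monom (of_int (t n0 i)) i :: 'a poly)"
    have cP: "coeff P i = (if i \<le> D then of_int (t n0 i) else 0)" for i
      by (simp add: P_def coeff_sum sum.delta)
    have inj: "inj_on (\<lambda>n. (?f ^^ n) \<beta>) I" using inc zero_in_M by (intro inj_onI) (metis diff_self)
    obtain i where i: "i \<le> D" "t n0 i = 1" using t(1) by blast
    have "coeff P i \<in> M"
    proof (rule incongruent_roots_bound[of P "(\<lambda>n. (?f ^^ n) \<beta>) ` I"])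
      show "poly_over V P" unfolding poly_over_def cP using V_intros by auto
      have "degree P \<le> D" by (rule degree_le) (auto simp: cP)
      then show "degree P < card ((\<lambda>n. (?f ^^ n) \<beta>) ` I)" using card_image[OF inj] I by simp
      fix x assume "x \<in> (\<lambda>n. (?f ^^ n) \<beta>) ` I"
      then obtain n where nI: "n \<in> I" "x = (?f ^^ n) \<beta>" by blast
      have "T n = T n0" using nI I by blast
      then have "\<And>i. i \<le> D \<Longrightarrow> t n i = t n0 i" unfolding T_def by (metis atMost_iff restrict_apply')
      then have "poly P x = (\<Sum>i\<le>D. of_int (t n i) * x ^ i)" by (simp add: P_def poly_sum poly_monom)
      then show "poly P x \<in> M" using t(3) nI by simp
      fix x y assume "x \<in> (\<lambda>n. (?f ^^ n) \<beta>) ` I" "y \<in> (\<lambda>n. (?f ^^ n) \<beta>) ` I" "x \<noteq> y"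
      then obtain n n' where "x = (?f ^^ n) \<beta>" "y = (?f ^^ n') \<beta>" "n' \<noteq> n" by auto
      then show "x - y \<notin> M" using inc by simp
    qed (use I(2) orb in auto)
    then show False using i cP one_notin_M by simp
  qed
  then obtain i j where ij: "i < j" "(?f ^^ j) \<beta> - (?f ^^ i) \<beta> \<in> M" by blast
  have "i < j \<Longrightarrow> (?f ^^ j) \<beta> - (?f ^^ i) \<beta> \<in> M \<Longrightarrow> \<exists>m\<ge>1. (?f ^^ m) \<beta> - \<beta> \<in> M" for i j
  proof (induction i arbitrary: j)
    case 0 then show ?case by (intro exI[of _ j]) auto
  next
    case (Suc i)
    then obtain j' where j': "j = Suc j'" "i < j'" by (cases j) auto
    have "?f ((?f ^^ j') \<beta>) - ?f ((?f ^^ i) \<beta>) \<in> M" using Suc.prems j' by simp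
    then have "(?f ^^ j') \<beta> - (?f ^^ i) \<beta> \<in> M" using inj orb by blast
    then show ?case using Suc.IH j' by blast
  qed
  then show ?thesis using ij by blast
qed

end

section \<open>Polynomials and ring homomorphisms\<close>

definition ring_map :: "('a::comm_ring_1 \<Rightarrow> 'b::comm_ring_1) \<Rightarrow> bool" where
  "ring_map h \<longleftrightarrow> h 1 = 1 \<and> (\<forall>x y. h (x + y) = h x + h y \<and> h (x * y) = h x * h y)"

context
  fixes h :: "'a::comm_ring_1 \<Rightarrow> 'b::comm_ring_1"
  assumes h: "ring_map h"
begin

lemma ring_map_1: "h 1 = 1" and ring_map_add: "h (x + y) = h x + h y" and ring_map_mult: "h (x * y) = h x * h y"
  using h by (auto simp: ring_map_def)

lemma ring_map_0: "h 0 = 0" using ring_map_add[of 0 0] by simp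

lemma ring_map_uminus: "h (- x) = - h x"
  using ring_map_add[of x "- x"] by (simp add: ring_map_0 eq_neg_iff_add_eq_0 add.commute)

lemma ring_map_diff: "h (x - y) = h x - h y"
  using ring_map_add[of x "- y"] by (simp add: ring_map_uminus)

lemma ring_map_sum: "h (sum u I) = (\<Sum>i\<in>I. h (u i))"
  by (induction I rule: infinite_finite_induct) (auto simp: ring_map_0 ring_map_add)

lemma map_poly_add: "map_poly h (P + Q) = map_poly h P + map_poly h Q"
  by (rule poly_eqI) (simp add: coeff_map_poly ring_map_0 ring_map_add)

lemma map_poly_diff: "map_poly h (P - Q) = map_poly h P - map_poly h Q"
  by (rule poly_eqI) (simp add: coeff_map_poly ring_map_0 ring_map_diff)

lemma map_poly_mult: "map_poly h (P * Q) = map_poly h P * map_poly h Q"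
  by (rule poly_eqI) (simp add: coeff_map_poly ring_map_0 coeff_mult ring_map_sum ring_map_mult)

lemma poly_map_poly: "poly (map_poly h P) (h x) = h (poly P x)"
  by (induction P) (auto simp: map_poly_pCons ring_map_0 ring_map_add ring_map_mult)

end

lemma ring_map_of_int: "ring_map of_int" by (simp add: ring_map_def)

lemma poly_over_Ints_iff: "poly_over \<int> P \<longleftrightarrow> (\<exists>Q :: int poly. P = map_poly of_int Q)"
proof
  assume P: "poly_over \<int> P"
  then have "\<forall>i. \<exists>z :: int. coeff P i = of_int z" unfolding poly_over_def by (auto elim: Ints_cases)
  then obtain z :: "nat \<Rightarrow> int" where z: "\<And>i. coeff P i = of_int (z i)" by metis
  have "P = map_poly of_int (\<Sum>i\<le>degree P. monom (z i) i)"
    by (rule poly_eqI) (auto simp: coeff_map_poly coeff_sum coeff_eq_0 simp flip: z)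
  then show "\<exists>Q :: int poly. P = map_poly of_int Q" by blast
next
  assume "\<exists>Q :: int poly. P = map_poly of_int Q"
  then show "poly_over \<int> P" by (auto simp: poly_over_def coeff_map_poly)
qed

lemma Ints_ring_set: "ring_set \<int>" by (simp add: ring_set_def)

section \<open>A transcendental p-adic integer\<close>

text \<open>The increments grow so fast that \<open>\<bar>P(a\<^sub>n)\<bar> < p ^ e\<^sub>n\<close> eventually holds for every
  integer polynomial \<open>P\<close>, where \<open>e\<^sub>n\<close> is the exponent below. Hence the \<open>p\<close>-adic valuation of
  \<open>P(a\<^sub>n)\<close> is eventually constant.\<close>

fun liouville :: "nat \<Rightarrow> nat \<Rightarrow> nat" where
  "liouville p 0 = 0"
| "liouville p (Suc n) = liouville p n + p ^ (n * (liouville p n + 1) ^ n)"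

abbreviation liouville_exp :: "nat \<Rightarrow> nat \<Rightarrow> nat" where
  "liouville_exp p n \<equiv> n * (liouville p n + 1) ^ n"

lemma poly_diff_dvd: "(x - y) dvd (poly P x - poly P y)" for P :: "'a::comm_ring_1 poly"
proof (induction P)
  case (pCons a P)
  have "poly (pCons a P) x - poly (pCons a P) y = x * (poly P x - poly P y) + (x - y) * poly P y"
    by (simp add: algebra_simps)
  then show ?case using pCons by simp
qed simp

lemma abs_poly_le: "\<bar>poly P (int x)\<bar> \<le> (\<Sum>i\<le>degree P. \<bar>coeff P i\<bar>) * (int x + 1) ^ degree P"
proof -
  have "\<bar>poly P (int x)\<bar> \<le> (\<Sum>i\<le>degree P. \<bar>coeff P i * int x ^ i\<bar>)"
    unfolding poly_altdef by (rule sum_abs)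
  also have "\<dots> \<le> (\<Sum>i\<le>degree P. \<bar>coeff P i\<bar> * (int x + 1) ^ degree P)"
  proof (rule sum_mono)
    fix i assume "i \<in> {..degree P}"
    have "int x ^ i \<le> (int x + 1) ^ i" by (rule power_mono) auto
    also have "\<dots> \<le> (int x + 1) ^ degree P" using \<open>i \<in> _\<close> by (intro power_increasing) auto
    finally show "\<bar>coeff P i * int x ^ i\<bar> \<le> \<bar>coeff P i\<bar> * (int x + 1) ^ degree P"
      by (simp add: abs_mult power_abs mult_left_mono)
  qed
  finally show ?thesis by (simp add: sum_distrib_right)
qed

context
  fixes p :: nat assumes p: "Factorial_Ring.prime p"
begin

lemma liouville_less: "liouville p n < liouville p (Suc n)"
  using prime_gt_0_nat[OF p] by simp

lemma liouville_strict_mono: "strict_mono (liouville p)"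
  unfolding strict_mono_Suc_iff using liouville_less by blast

lemma liouville_exp_mono: "n \<le> m \<Longrightarrow> liouville_exp p n \<le> liouville_exp p m"
proof -
  assume nm: "n \<le> m"
  have "(liouville p n + 1) ^ n \<le> (liouville p m + 1) ^ n"
    using nm strict_mono_less_eq[OF liouville_strict_mono] by (intro power_mono) auto
  also have "\<dots> \<le> (liouville p m + 1) ^ m" using nm by (intro power_increasing) auto
  finally show ?thesis using nm mult_le_mono by blast
qed

lemma liouville_cong:
  assumes "n \<le> m" shows "int p ^ liouville_exp p n dvd int (liouville p m) - int (liouville p n)"
  using assms
proof (induction rule: dec_induct)
  case (step k)
  have "int p ^ liouville_exp p n dvd int p ^ liouville_exp p k"
    using liouville_exp_mono[OF step(1)] by (rule le_imp_power_dvd)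
  then have "int p ^ liouville_exp p n dvd (int (liouville p k) - int (liouville p n)) + int p ^ liouville_exp p k"
    using step.IH by (rule dvd_add[rotated])
  then show ?case by (simp add: algebra_simps)
qed simp

lemma liouville_poly_cong:
  "n \<le> m \<Longrightarrow> int p ^ liouville_exp p n dvd poly P (int (liouville p m)) - poly P (int (liouville p n))"
  using liouville_cong poly_diff_dvd dvd_trans by blast

lemma liouville_exp_ge: "n \<le> liouville_exp p n"
  by simp

text \<open>The exponent e_n is designed for this chain: if n is at least deg P and at least the sum
  S of the absolute values of the coefficients, then |P(a_n)| \<le> S (a_n + 1)^deg P \<le> n (a_n +
  1)^n = e_n < 2^e_n \<le> p^e_n.\<close>

lemma liouville_poly_bound:
  "\<exists>N. \<forall>n\<ge>N. \<bar>poly P (int (liouville p n))\<bar> < int p ^ liouville_exp p n"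
proof -
  define S where "S = (\<Sum>i\<le>degree P. \<bar>coeff P i\<bar>)"
  have "\<bar>poly P (int (liouville p n))\<bar> < int p ^ liouville_exp p n" if n: "n \<ge> nat S" "n \<ge> degree P" for n
  proof -
    let ?x = "liouville p n"
    have "\<bar>poly P (int ?x)\<bar> \<le> S * (int ?x + 1) ^ degree P" unfolding S_def by (rule abs_poly_le)
    also have "\<dots> \<le> int n * (int ?x + 1) ^ n"
      using n by (intro mult_mono power_increasing) auto
    also have "\<dots> = int (liouville_exp p n)" by (simp add: add.commute)
    also have "\<dots> < int (2 ^ liouville_exp p n)" by (simp only: of_nat_less_iff less_exp)
    also have "\<dots> \<le> int (p ^ liouville_exp p n)"
      using prime_ge_2_nat[OF p] by (simp only: of_nat_le_iff power_mono)
    finally show ?thesis by simp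
  qed
  then show ?thesis by (intro exI[of _ "max (nat S) (degree P)"]) auto
qed

text \<open>A nonzero P(a_N) of absolute value less than p^e_N has p-adic valuation less than e_N,
  and all later values agree with it modulo p^e_N. For large N the value is nonzero, since the a_n
  are distinct and P has finitely many roots.\<close>

lemma liouville_valuation:
  assumes "P \<noteq> 0"
  shows "\<exists>v N. \<forall>n\<ge>N. \<exists>m. poly P (int (liouville p n)) = int p ^ v * m \<and> \<not> int p dvd m"
proof -
  obtain N1 where N1: "\<And>n. n \<ge> N1 \<Longrightarrow> \<bar>poly P (int (liouville p n))\<bar> < int p ^ liouville_exp p n"
    using liouville_poly_bound by blast
  have "finite {x. poly P x = 0}" using assms by (rule poly_roots_finite)
  moreover have "inj (\<lambda>n. int (liouville p n))"
    using strict_mono_eq[OF liouville_strict_mono] by (auto simp: inj_def)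
  ultimately have "finite {n. poly P (int (liouville p n)) = 0}"
    using finite_vimageI[of "{x. poly P x = 0}" "\<lambda>n. int (liouville p n)"] by (simp add: vimage_def)
  then obtain N2 where N2: "\<And>n. poly P (int (liouville p n)) = 0 \<Longrightarrow> n < N2"
    using finite_nat_set_iff_bounded by auto
  define N where "N = max N1 N2"
  let ?y = "poly P (int (liouville p N))"
  have y0: "?y \<noteq> 0" using N2[of N] by (auto simp: N_def)
  have pp: "prime_elem (int p)" using p by simp
  define v where "v = multiplicity (int p) ?y"
  obtain m where m: "?y = int p ^ v * m" "\<not> int p dvd m"
    using multiplicity_decompose'[OF y0 prime_elem_not_unit[OF pp]] unfolding v_def by blast
  have "int p ^ v \<le> \<bar>?y\<bar>" using y0 m(1) by (intro zdvd_imp_le) auto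
  also have "\<dots> < int p ^ liouville_exp p N" using N1 by (simp add: N_def)
  finally have "v < liouville_exp p N" using prime_gt_1_nat[OF p] by (subst (asm) power_strict_increasing_iff) auto
  then have vs: "int p ^ Suc v dvd int p ^ liouville_exp p N" by (intro le_imp_power_dvd) simp
  have "\<exists>m. poly P (int (liouville p n)) = int p ^ v * m \<and> \<not> int p dvd m" if "n \<ge> N" for n
  proof -
    have "int p ^ Suc v dvd poly P (int (liouville p n)) - ?y"
      using vs liouville_poly_cong[OF that] dvd_trans by blast
    then obtain k where "poly P (int (liouville p n)) - ?y = int p ^ Suc v * k" by blast
    then have "poly P (int (liouville p n)) = int p ^ v * (m + int p * k)" using m(1) by (simp add: algebra_simps)
    moreover have "\<not> int p dvd m + int p * k" using m(2) by (simp add: dvd_add_left_iff)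
    ultimately show ?thesis by blast
  qed
  then show ?thesis by blast
qed

text \<open>The localization of \<int> at p; the denominator 0 is excluded because p divides
  it.\<close>

definition local_int :: "rat set" where
  "local_int = {x. \<exists>m k :: int. x = of_int m / of_int k \<and> \<not> int p dvd k}"

lemma local_int_ring_set: "ring_set local_int"
  unfolding ring_set_def
proof (intro conjI ballI)
  have pp: "prime (int p)" using p by simp
  have "\<not> int p dvd 1" using prime_gt_1_nat[OF p] by auto
  then show "1 \<in> local_int" unfolding local_int_def by (intro CollectI exI[of _ 1]) auto
  fix x y assume "x \<in> local_int" "y \<in> local_int"
  then obtain m k m' k' :: int where xy: "x = of_int m / of_int k" "\<not> int p dvd k" "y = of_int m' / of_int k'" "\<not> int p dvd k'"
    unfolding local_int_def by blast
  have kk: "\<not> int p dvd k * k'" "k \<noteq> 0" "k' \<noteq> 0" using xy pp by (auto simp: prime_dvd_mult_iff)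
  have "x - y = of_int (m * k' - m' * k) / of_int (k * k')" using kk by (simp add: xy diff_frac_eq)
  then show "x - y \<in> local_int" using kk unfolding local_int_def by blast
  have "x * y = of_int (m * m') / of_int (k * k')" by (simp add: xy)
  then show "x * y \<in> local_int" using kk unfolding local_int_def by blast
qed

lemma inverse_notin_local_int: "inverse (of_nat p) \<notin> local_int"
proof
  assume "inverse (of_nat p) \<in> local_int"
  then obtain m k :: int where mk: "inverse (of_nat p :: rat) = of_int m / of_int k" "\<not> int p dvd k"
    unfolding local_int_def by blast
  then have "k \<noteq> 0" by auto
  then have "(of_int k :: rat) = of_int (int p * m)" using mk prime_gt_0_nat[OF p] by (simp add: field_simps)
  then have "k = int p * m" by (simp only: of_int_eq_iff)
  then show False using mk by simp
qed

text \<open>c is treated as the p-adic limit of the sequence \<open>liouville p\<close> without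
  constructing the p-adic numbers: the P(c)/R(c) whose values along the sequence are eventually
  p-integral form a ring in which p is not invertible, and Chevalley's theorem applies to it. The
  last two claims say that on \<rat>(c) the values are integers when v(p) = 1 and that every residue
  comes from an integer.\<close>

lemma padic_valuation_ring_exists:
  fixes c :: "'a::field"
  assumes tr: "\<And>P :: int poly. P \<noteq> 0 \<Longrightarrow> poly (map_poly of_int P) c \<noteq> 0"
  obtains V where "valuation_ring V" "of_nat p \<in> vmax V" "c \<in> V"
    "\<And>w. w \<in> adj \<int> c \<Longrightarrow> w \<noteq> 0 \<Longrightarrow> \<exists>j. vassoc V w (of_nat p powi j)"
    "\<And>w. w \<in> adj \<int> c \<Longrightarrow> w \<in> V \<Longrightarrow> \<exists>t\<in>{0..<int p}. w - of_int t \<in> vmax V"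
proof -
  define ev where "ev P = poly (map_poly of_int P) c" for P :: "int poly"
  define a where "a n = int (liouville p n)" for n
  define q where "q P n = (of_int (poly P (a n)) :: rat)" for P n
  note om = ring_map_of_int
  have ev_simps: "ev (P + Q) = ev P + ev Q" "ev (P - Q) = ev P - ev Q" "ev (P * Q) = ev P * ev Q"
    "ev 1 = 1" "ev [:t:] = of_int t" "ev (smult t P) = of_int t * ev P" for P Q t
    by (auto simp: ev_def map_poly_add[OF om] map_poly_diff[OF om] map_poly_mult[OF om] map_poly_pCons map_poly_smult)
  have ev0: "ev P = 0 \<longleftrightarrow> P = 0" for P using tr[of P] by (auto simp: ev_def)
  have adj: "\<exists>P R. w = ev P / ev R \<and> R \<noteq> 0" if w: "w \<in> adj \<int> c" for w
  proof -
    obtain P R where PR: "poly_over \<int> P" "poly_over \<int> R" "poly R c \<noteq> 0" "w = poly P c / poly R c"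
      using w by (rule adjE)
    then obtain P' R' :: "int poly" where "P = map_poly of_int P'" "R = map_poly of_int R'"
      unfolding poly_over_Ints_iff by blast
    then show ?thesis using PR by (intro exI[of _ P'] exI[of _ R']) (auto simp: ev_def)
  qed
  have nz: "\<exists>N. \<forall>n\<ge>N. q R n \<noteq> 0" if R0: "R \<noteq> 0" for R
  proof -
    obtain v N where "\<forall>n\<ge>N. \<exists>m. poly R (a n) = int p ^ v * m \<and> \<not> int p dvd m"
      using liouville_valuation[OF R0] unfolding a_def by blast
    moreover have "int p \<noteq> 0" using prime_gt_0_nat[OF p] by simp
    ultimately have "\<forall>n\<ge>N. poly R (a n) \<noteq> 0" by (metis dvd_0_right mult_eq_0_iff power_not_zero)
    then show ?thesis by (auto simp: q_def)
  qed
  define A where "A = {ev P / ev R | P R. R \<noteq> 0 \<and> (\<exists>N. \<forall>n\<ge>N. q P n / q R n \<in> local_int)}"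
  have AI: "ev P / ev R \<in> A" if "R \<noteq> 0" "\<And>n. n \<ge> N \<Longrightarrow> q P n / q R n \<in> local_int" for P R N
    using that unfolding A_def by blast
  have A: "ring_set A" unfolding ring_set_def
  proof (intro conjI ballI)
    have "\<And>n. q 1 n / q 1 n \<in> local_int" using ring_set_1[OF local_int_ring_set] by (simp add: q_def)
    then show "1 \<in> A" using AI[of 1 0 1] by (simp add: ev_simps)
    fix x y assume "x \<in> A" "y \<in> A"
    then obtain P R N P' R' N' where x: "x = ev P / ev R" "R \<noteq> 0" "\<And>n. n \<ge> N \<Longrightarrow> q P n / q R n \<in> local_int"
      and y: "y = ev P' / ev R'" "R' \<noteq> 0" "\<And>n. n \<ge> N' \<Longrightarrow> q P' n / q R' n \<in> local_int"
      unfolding A_def by blast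
    obtain N1 N2 where N12: "\<And>n. n \<ge> N1 \<Longrightarrow> q R n \<noteq> 0" "\<And>n. n \<ge> N2 \<Longrightarrow> q R' n \<noteq> 0"
      using nz[OF x(2)] nz[OF y(2)] by blast
    have RR: "R * R' \<noteq> 0" using x y by simp
    have "ev (P * R' - P' * R) / ev (R * R') \<in> A"
    proof (rule AI[OF RR, of "Max {N, N', N1, N2}"])
      fix n assume "n \<ge> Max {N, N', N1, N2}"
      then have n: "n \<ge> N" "n \<ge> N'" "n \<ge> N1" "n \<ge> N2" by auto
      have "q (P * R' - P' * R) n / q (R * R') n = q P n / q R n - q P' n / q R' n"
        using N12[of n] n by (simp add: q_def diff_frac_eq)
      then show "q (P * R' - P' * R) n / q (R * R') n \<in> local_int"
        using ring_set_diff[OF local_int_ring_set x(3)[OF n(1)] y(3)[OF n(2)]] by (simp only:)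
    qed
    moreover have "x - y = ev (P * R' - P' * R) / ev (R * R')"
      using x y by (simp add: ev_simps ev0 diff_frac_eq)
    ultimately show "x - y \<in> A" by (simp only:)
    have "ev (P * P') / ev (R * R') \<in> A"
    proof (rule AI[OF RR, of "max N N'"])
      fix n assume "n \<ge> max N N'"
      then have n: "n \<ge> N" "n \<ge> N'" by auto
      have "q (P * P') n / q (R * R') n = q P n / q R n * (q P' n / q R' n)" by (simp add: q_def)
      then show "q (P * P') n / q (R * R') n \<in> local_int"
        using ring_set_mult[OF local_int_ring_set x(3)[OF n(1)] y(3)[OF n(2)]] by (simp only:)
    qed
    moreover have "x * y = ev (P * P') / ev (R * R')" by (simp add: x y ev_simps)
    ultimately show "x * y \<in> A" by (simp only:)
  qed
  have evA: "ev P \<in> A" for P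
    using AI[of 1 0 P] ring_set_of_int[OF local_int_ring_set] by (simp add: ev_simps q_def)
  have p0: "(of_nat p :: 'a) \<noteq> 0"
    using ev0[of "[:int p:]"] prime_gt_0_nat[OF p] by (simp add: ev_simps)
  have evp: "ev [:int p:] = of_nat p" by (simp add: ev_simps)
  have pA: "of_nat p \<in> A" using evA[of "[:int p:]"] by (simp add: ev_simps)
  have ipA: "inverse (of_nat p) \<notin> A"
  proof
    assume "inverse (of_nat p) \<in> A"
    then obtain P R N where w: "inverse (of_nat p) = ev P / ev R" "R \<noteq> 0" "\<And>n. n \<ge> N \<Longrightarrow> q P n / q R n \<in> local_int"
      unfolding A_def by blast
    \<comment> \<open>By transcendence of c this is an identity of polynomials, so P/R equals 1/p at
      all late terms of the sequence.\<close>
    then have "ev R = ev ([:int p:] * P)" using p0 ev0 by (simp add: ev_simps field_simps)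
    then have "ev (R - [:int p:] * P) = 0" by (simp add: ev_simps)
    then have R: "R = [:int p:] * P" using ev0 by simp
    obtain N1 where N1: "\<And>n. n \<ge> N1 \<Longrightarrow> q R n \<noteq> 0" using nz[OF w(2)] by blast
    define n where "n = max N N1"
    have "q R n = of_nat p * q P n" by (simp add: R q_def)
    then have "q P n / q R n = inverse (of_nat p)" using N1[of n] by (simp add: n_def field_simps)
    then show False using w(3)[of n] inverse_notin_local_int by (simp add: n_def)
  qed
  obtain V where V: "valuation_ring V" "A \<subseteq> V" "of_nat p \<in> vmax V"
    using valuation_ring_exists[OF A pA p0 ipA] .
  interpret valuation_ring V by (rule V)
  have val: "\<exists>P R v u N. w = ev P / ev R \<and> R \<noteq> 0 \<and> vassoc V w (of_nat p powi (int v - int u)) \<and>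
      (\<forall>n\<ge>N. (\<exists>m. poly P (a n) = int p ^ v * m \<and> \<not> int p dvd m) \<and> (\<exists>m. poly R (a n) = int p ^ u * m \<and> \<not> int p dvd m))"
    if w: "w \<in> adj \<int> c" "w \<noteq> 0" for w
  proof -
    obtain P R where PR: "w = ev P / ev R" "R \<noteq> 0" using adj[OF w(1)] by blast
    then have P0: "P \<noteq> 0" using w(2) ev0 by auto
    obtain v N1 where v: "\<forall>n\<ge>N1. \<exists>m. poly P (a n) = int p ^ v * m \<and> \<not> int p dvd m"
      using liouville_valuation[OF P0] unfolding a_def by blast
    obtain u N2 where u: "\<forall>n\<ge>N2. \<exists>m. poly R (a n) = int p ^ u * m \<and> \<not> int p dvd m"
      using liouville_valuation[OF PR(2)] unfolding a_def by blast
    \<comment> \<open>If numerator and denominator have the same eventual p-adic valuation, the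
      quotient lies in A. Multiplying by powers of p reduces w and its inverse to this situation, so
      w and p^(v-u) divide each other.\<close>
    have *: "ev P' / ev R' \<in> V"
      if h: "R' \<noteq> 0" "\<forall>n\<ge>N. \<exists>m. poly P' (a n) = int p ^ k * m \<and> \<not> int p dvd m"
        "\<forall>n\<ge>N'. \<exists>m. poly R' (a n) = int p ^ k * m \<and> \<not> int p dvd m" for P' R' k N N'
    proof -
      have "ev P' / ev R' \<in> A"
      proof (rule AI[OF h(1), of "max N N'"])
        fix n assume "n \<ge> max N N'"
        then obtain m m' where "poly P' (a n) = int p ^ k * m" "poly R' (a n) = int p ^ k * m'" "\<not> int p dvd m'"
          using h(2,3) by (metis max.bounded_iff)
        then have "q P' n / q R' n = of_int m / of_int m'" "\<not> int p dvd m'"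
          using prime_gt_0_nat[OF p] by (auto simp: q_def)
        then show "q P' n / q R' n \<in> local_int" unfolding local_int_def by blast
      qed
      then show ?thesis using V by blast
    qed
    have scale: "\<forall>n\<ge>N. \<exists>m. poly (Q * [:int p:] ^ j) (a n) = int p ^ (k + j) * m \<and> \<not> int p dvd m"
      if h: "\<forall>n\<ge>N. \<exists>m. poly Q (a n) = int p ^ k * m \<and> \<not> int p dvd m" for Q N k j
    proof (intro allI impI)
      fix n assume "n \<ge> N"
      then obtain m where "poly Q (a n) = int p ^ k * m" "\<not> int p dvd m" using h by blast
      then show "\<exists>m. poly (Q * [:int p:] ^ j) (a n) = int p ^ (k + j) * m \<and> \<not> int p dvd m"
        by (intro exI[of _ m]) (simp add: power_add mult_ac)
    qed
    have evpow: "ev ([:int p:] ^ j) = of_nat p ^ j" for j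
      by (induction j) (auto simp: ev_simps)
    have "[:int p:] \<noteq> 0" using prime_gt_0_nat[OF p] by simp
    then have ne: "P * [:int p:] ^ u \<noteq> 0" "R * [:int p:] ^ v \<noteq> 0" using P0 PR(2) by (metis mult_eq_0_iff power_not_zero)+
    have "ev (P * [:int p:] ^ u) / ev (R * [:int p:] ^ v) \<in> V"
      using *[OF ne(2) scale[OF v] scale[OF u, of v, unfolded add.commute[of u]]] .
    moreover have "ev (R * [:int p:] ^ v) / ev (P * [:int p:] ^ u) \<in> V"
      using *[OF ne(1) scale[OF u, of v, unfolded add.commute[of u]] scale[OF v]] .
    moreover have pw: "of_nat p powi (int v - int u) = (of_nat p ^ v / of_nat p ^ u :: 'a)"
      using p0 by (simp add: power_int_diff)
    have "w / of_nat p powi (int v - int u) = ev (P * [:int p:] ^ u) / ev (R * [:int p:] ^ v)"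
      "of_nat p powi (int v - int u) / w = ev (R * [:int p:] ^ v) / ev (P * [:int p:] ^ u)"
      unfolding pw PR(1) ev_simps(3) evpow by (simp_all add: mult.commute)
    ultimately have "w / of_nat p powi (int v - int u) \<in> V" "of_nat p powi (int v - int u) / w \<in> V"
      by (simp_all only:)
    then have "vassoc V w (of_nat p powi (int v - int u))"
      unfolding vassoc_def using w(2) p0 by (simp add: vdvd_iff_div)
    then show ?thesis using PR v u
      by (intro exI[of _ P] exI[of _ R] exI[of _ v] exI[of _ u] exI[of _ "max N1 N2"]) auto
  qed
  show thesis
  proof (rule that[OF V(1,3)])
    show "c \<in> V" using evA[of "[:0, 1:]"] V(2) by (auto simp: ev_def map_poly_pCons)
    show "\<exists>j. vassoc V w (of_nat p powi j)" if "w \<in> adj \<int> c" "w \<noteq> 0" for w using val[OF that] by blast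
    fix w assume w: "w \<in> adj \<int> c" "w \<in> V"
    show "\<exists>t\<in>{0..<int p}. w - of_int t \<in> vmax V"
    proof (cases "w = 0")
      case True
      then show ?thesis using zero_in_M prime_gt_0_nat[OF p] by (intro bexI[of _ 0]) auto
    next
      case False
      obtain P R v u N where PR: "w = ev P / ev R" "R \<noteq> 0" "vassoc V w (of_nat p powi (int v - int u))"
        "\<And>n. n \<ge> N \<Longrightarrow> \<exists>m. poly P (a n) = int p ^ v * m \<and> \<not> int p dvd m"
        "\<And>n. n \<ge> N \<Longrightarrow> \<exists>m. poly R (a n) = int p ^ u * m \<and> \<not> int p dvd m"
        using val[OF w(1) False] by blast
      have "u \<le> v"
      proof -
        have "vassoc V (of_nat p ^ u * w) (of_nat p ^ u * of_nat p powi (int v - int u))"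
          using PR(3) by (intro vassoc_mult) auto
        then have "vassoc V (of_nat p ^ u * w) (of_nat p ^ v)" using p0 by (simp add: power_int_diff)
        then have "vdvd V (of_nat p ^ u) ((of_nat p :: 'a) ^ v)"
          using vdvd_multI[OF w(2)] vdvd_trans unfolding vassoc_def by blast
        then show ?thesis using power_vdvd_power[OF V(3) p0] by blast
      qed
      \<comment> \<open>From index u + 1 on, the values of a polynomial along the sequence agree
        modulo p^(u+1), one power more than the valuation of the values of R.\<close>
      define n where "n = max N (Suc u)"
      obtain mP where mP: "poly P (a n) = int p ^ v * mP" using PR(4)[of n] by (auto simp: n_def)
      obtain mR where mR: "poly R (a n) = int p ^ u * mR" "\<not> int p dvd mR" using PR(5)[of n] by (auto simp: n_def)
      have "coprime (int p) mR" using mR(2) p by (intro prime_imp_coprime) auto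
      then obtain s r where s: "s * mR + r * int p = 1"
        using bezout_int[of mR "int p"] by (metis coprime_iff_gcd_eq_1 gcd.commute)
      define e where "e = int p ^ (v - u) * mP"
      \<comment> \<open>At the n-th term w becomes e / mR, and s inverts mR modulo p; so t is the
        residue of w.\<close>
      define t where "t = (e * s) mod int p"
      have "e - mR * (e * s) = e * (s * mR + r * int p) - mR * (e * s)" using s by simp
      also have "\<dots> = int p * (e * r)" by (simp add: algebra_simps)
      finally have "int p dvd e - mR * (e * s)" by simp
      moreover have "int p dvd e * s - t" unfolding t_def by (rule dvd_minus_mod)
      ultimately have "int p dvd (e - mR * (e * s)) + mR * (e * s - t)" by simp
      also have "(e - mR * (e * s)) + mR * (e * s - t) = e - mR * t" by (simp add: algebra_simps)
      finally have "int p dvd int p ^ (v - u) * mP - mR * t" unfolding e_def .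
      then have "int p ^ u * int p dvd int p ^ u * (int p ^ (v - u) * mP - mR * t)" by (rule mult_dvd_mono[OF dvd_refl])
      also have "int p ^ u * (int p ^ (v - u) * mP - mR * t) = poly (P - [:t:] * R) (a n)"
        using \<open>u \<le> v\<close> by (simp add: mP mR algebra_simps power_add[symmetric])
      finally have d: "int p ^ Suc u dvd poly (P - [:t:] * R) (a n)" by (simp only: power_Suc2)
      have un: "Suc u \<le> liouville_exp p n" using liouville_exp_ge[of n] by (simp add: n_def del: mult_Suc)
      have "ev (P - [:t:] * R) / ev (R * [:int p:]) \<in> A"
      proof (rule AI[where N = n])
        show "R * [:int p:] \<noteq> 0" using PR(2) prime_gt_0_nat[OF p] by simp
        fix k assume k: "k \<ge> n"
        have "int p ^ Suc u dvd poly (P - [:t:] * R) (a k) - poly (P - [:t:] * R) (a n)"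
          using dvd_trans[OF le_imp_power_dvd[OF un] liouville_poly_cong[OF k]] unfolding a_def .
        then have "int p ^ Suc u dvd poly (P - [:t:] * R) (a k)" using d by (metis diff_add_cancel dvd_add)
        then obtain m where m: "poly (P - [:t:] * R) (a k) = int p ^ Suc u * m" by blast
        obtain mk where mk: "poly R (a k) = int p ^ u * mk" "\<not> int p dvd mk" using PR(5)[of k] k by (auto simp: n_def)
        have "poly (R * [:int p:]) (a k) = int p ^ Suc u * mk" by (simp add: mk)
        then have "q (R * [:int p:]) k = of_int (int p ^ Suc u * mk)" unfolding q_def by (simp only:)
        moreover have "q (P - [:t:] * R) k = of_int (int p ^ Suc u * m)" unfolding q_def by (simp only: m)
        ultimately have "q (P - [:t:] * R) k / q (R * [:int p:]) k = of_int m / of_int mk"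
          using prime_gt_0_nat[OF p] by simp
        then show "q (P - [:t:] * R) k / q (R * [:int p:]) k \<in> local_int" using mk(2) unfolding local_int_def by blast
      qed
      then have "of_nat p * (ev (P - [:t:] * R) / ev (R * [:int p:])) \<in> vmax V" using V(2,3) M_mult by blast
      moreover have "of_nat p * (ev (P - [:t:] * R) / ev (R * [:int p:])) = w - of_int t"

        using PR(1,2) ev0[of R] p0 unfolding ev_simps by (simp add: field_simps)
      ultimately have "w - of_int t \<in> vmax V" by (simp only:)
      moreover have "t \<in> {0..<int p}" unfolding t_def using prime_gt_0_nat[OF p] by simp
      ultimately show ?thesis by blast
    qed
  qed
qed

end

section \<open>A place at infinity\<close>

text \<open>V is trivial on C and c has a pole. The locale is also used with \<beta> in the role of
  c, over a field that contains the actual c.\<close>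

locale pole_place = valuation_ring V for V :: "'a::field set" +
  fixes C :: "'a set" and c :: 'a
  assumes C: "field_set C" and CV: "C \<subseteq> V" and cV: "c \<notin> V"
begin

abbreviation "\<pi> \<equiv> inverse c"
abbreviation "Alg \<equiv> algover (adj C c)"

lemmas RC = field_setD[OF C]
lemmas C_intros = ring_set_1[OF RC] ring_set_0[OF RC] ring_set_mult[OF RC] ring_set_add[OF RC]
  ring_set_diff[OF RC] ring_set_uminus[OF RC] ring_set_power[OF RC] ring_set_of_nat[OF RC] field_set_divide[OF C]

lemma pi_in_M: "\<pi> \<in> M" using cV by (rule inverse_in_M)
lemma c_nonzero: "c \<noteq> 0" using cV V_intros(2) by auto
lemma pi_nonzero: "\<pi> \<noteq> 0" using c_nonzero by simp
lemma pi_in_V: "\<pi> \<in> V" using pi_in_M by (rule M_in_V)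

lemma const_notin_M: "a \<in> C \<Longrightarrow> a \<noteq> 0 \<Longrightarrow> a \<notin> M"
  using CV field_set_inverse[OF C] by (auto simp: vmax_def)

lemma const_in_M: "a \<in> C \<Longrightarrow> a \<in> M \<Longrightarrow> a = 0"
  using const_notin_M by blast

lemma adj_field: "field_set (adj C c)" using RC by (rule adj_field_set)
lemma Alg_field: "field_set Alg" using adj_field by (rule algover_field_set)
lemmas RAlg = field_setD[OF Alg_field]
lemma adj_in_Alg: "adj C c \<subseteq> Alg" using adj_field by (rule algover_superset)
lemma C_in_Alg: "C \<subseteq> Alg" using adj_in_Alg adj_base[OF RC] by blast
lemma c_in_Alg: "c \<in> Alg" using adj_in_Alg adj_gen[OF RC] by blast

text \<open>All lower terms keep a positive power of \<pi>. The exponent n may exceed the degree,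
  and then the residue is 0; numerators are compared in this way with denominators of larger
  degree.\<close>

lemma poly_at_infinity:
  assumes "poly_over C P" "degree P \<le> n"
  shows "poly P c * \<pi> ^ n - coeff P n \<in> M"
proof -
  have "poly P c = (\<Sum>i\<le>n. coeff P i * c ^ i)" unfolding poly_altdef
    using assms by (intro sum.mono_neutral_left) (auto simp: coeff_eq_0)
  also have "\<dots> = coeff P n * c ^ n + (\<Sum>i<n. coeff P i * c ^ i)"
    by (simp add: lessThan_Suc_atMost[symmetric])
  finally have "poly P c * \<pi> ^ n = coeff P n * (c ^ n * \<pi> ^ n) + (\<Sum>i<n. coeff P i * (c ^ i * \<pi> ^ n))"
    by (simp add: distrib_right sum_distrib_right mult.assoc)
  also have "c ^ n * \<pi> ^ n = 1" using c_nonzero by (simp add: power_mult_distrib[symmetric])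
  finally have e: "poly P c * \<pi> ^ n - coeff P n = (\<Sum>i<n. coeff P i * (c ^ i * \<pi> ^ n))" by simp
  have "coeff P i * (c ^ i * \<pi> ^ n) \<in> M" if "i < n" for i
  proof -
    have "\<pi> ^ n = \<pi> ^ i * \<pi> ^ (n - i)" using that by (simp add: power_add[symmetric])
    then have "c ^ i * \<pi> ^ n = (c ^ i * \<pi> ^ i) * \<pi> ^ (n - i)" by (simp only: mult.assoc)
    then have "c ^ i * \<pi> ^ n = \<pi> ^ (n - i)" using c_nonzero by (simp add: power_mult_distrib[symmetric])
    moreover have "\<pi> ^ (n - i) \<in> M" using pi_in_M pi_in_V M_power_iff that by auto
    moreover have "coeff P i \<in> V" using assms(1) CV unfolding poly_over_def by blast
    ultimately show ?thesis using M_mult' by simp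
  qed
  then show ?thesis unfolding e by (intro M_sum) auto
qed

lemma poly_assoc_power:
  assumes "poly_over C P" "P \<noteq> 0" shows "poly P c * \<pi> ^ degree P \<asymp> 1"
proof -
  let ?a = "lead_coeff P"
  have a: "?a \<in> C" "?a \<noteq> 0" using assms unfolding poly_over_def by auto
  have m: "poly P c * \<pi> ^ degree P - ?a \<in> M" using poly_at_infinity[OF assms(1) order_refl] .
  have "poly P c * \<pi> ^ degree P \<in> V" using V_intros(4)[OF M_in_V[OF m], of ?a] a CV by auto
  moreover have "poly P c * \<pi> ^ degree P \<notin> M"
    using M_diff[OF _ m, of "poly P c * \<pi> ^ degree P"] const_notin_M[OF a] by auto
  ultimately show ?thesis by (rule vassoc_one)
qed

text \<open>On C(c) the valuation is minus the degree in c, once v(\<pi>) = 1.\<close>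

lemma adj_assoc_power:
  assumes "w \<in> adj C c" "w \<noteq> 0" shows "\<exists>j. w \<asymp> \<pi> powi j"
proof -
  obtain P Q where PQ: "poly_over C P" "poly_over C Q" "poly Q c \<noteq> 0" "w = poly P c / poly Q c"
    using assms(1) by (rule adjE)
  have ne: "P \<noteq> 0" "Q \<noteq> 0" using PQ assms(2) by auto
  let ?m = "degree P" and ?n = "degree Q"
  have "poly P c * \<pi> ^ ?m * inverse (poly Q c * \<pi> ^ ?n) \<asymp> 1 * inverse 1"
    using PQ ne by (intro vassoc_mult vassoc_inverse poly_assoc_power)
  then have "\<pi> ^ ?n * (poly P c * \<pi> ^ ?m * inverse (poly Q c * \<pi> ^ ?n)) \<asymp> \<pi> ^ ?n * 1"
    by (intro vassoc_mult) auto
  moreover have "\<pi> ^ ?n * (poly P c * \<pi> ^ ?m * inverse (poly Q c * \<pi> ^ ?n)) = \<pi> ^ ?m * w"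
    using PQ c_nonzero by (simp add: field_simps)
  ultimately have "\<pi> ^ ?m * w \<asymp> \<pi> ^ ?n" by (simp only: mult_1_right)
  then have "inverse (\<pi> ^ ?m) * (\<pi> ^ ?m * w) \<asymp> inverse (\<pi> ^ ?m) * \<pi> ^ ?n" by (intro vassoc_mult) auto
  moreover have "inverse (\<pi> ^ ?m) * (\<pi> ^ ?m * w) = w" using c_nonzero by simp
  moreover have "inverse (\<pi> ^ ?m) * \<pi> ^ ?n = \<pi> powi (int ?n - int ?m)"
    using pi_nonzero by (simp only: power_int_diff power_int_of_nat divide_inverse mult.commute not_False_eq_True simp_thms)
  ultimately show ?thesis by auto
qed

lemma discrete_Alg: "discrete_on \<pi> D (algdeg (adj C c) D)"
  using pi_nonzero adj_assoc_power by (rule discrete_on_algdeg)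

end

text \<open>Chevalley's theorem for the ring C[1/c]. There 1/c is not invertible: multiplying c =
  P(1/c) by a power of c would give an algebraic equation for c over C.\<close>

lemma pole_place_exists:
  fixes C :: "'a::field set"
  assumes C: "field_set C" and c: "c \<notin> algover C"
  shows "\<exists>V. pole_place V C c"
proof -
  note R = field_setD[OF C]
  have c0: "c \<noteq> 0" using c algover_superset[OF C] ring_set_0[OF R] by auto
  let ?A = "{poly P (inverse c) | P. poly_over C P}"
  have inv: "inverse (inverse c) \<notin> ?A"
  proof
    assume "inverse (inverse c) \<in> ?A"
    then obtain P where P: "poly_over C P" "c = poly P (inverse c)" by auto
    let ?n = "degree P"
    define Q where "Q = monom 1 (Suc ?n) - (\<Sum>i\<le>?n. monom (coeff P i) (?n - i))"
    have "coeff (monom a (?n - i)) (Suc ?n) = 0" for a :: 'a and i by simp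
    then have "coeff Q (Suc ?n) = 1" by (simp add: Q_def coeff_sum)
    then have "Q \<noteq> 0" by auto
    moreover have "poly_over C Q" unfolding Q_def using P(1) ring_set_1[OF R]
      by (intro poly_over_diff[OF R] poly_over_sum[OF R] poly_over_monom[OF R]) (auto simp: poly_over_def)
    moreover have "poly Q c = 0"
    proof -
      have "c ^ Suc ?n = c ^ ?n * poly P (inverse c)" using P(2) by simp
      also have "\<dots> = (\<Sum>i\<le>?n. coeff P i * (c ^ ?n * inverse c ^ i))"
        by (simp add: poly_altdef sum_distrib_left mult_ac)
      also have "\<dots> = (\<Sum>i\<le>?n. coeff P i * c ^ (?n - i))"
        using c0 by (intro sum.cong) (auto simp: power_diff power_inverse divide_inverse)
      finally show ?thesis by (simp add: Q_def poly_monom poly_sum)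
    qed
    ultimately show False using c unfolding algover_def by blast
  qed
  have "inverse c \<noteq> 0" using c0 by simp
  then obtain V where V: "valuation_ring V" "?A \<subseteq> V" "inverse c \<in> vmax V"
    using inv by (rule valuation_ring_exists[OF ring_set_polys[OF R] polys_superset(2)[OF R]])
  interpret valuation_ring V by (rule V)
  have "c \<notin> V" using V(3) c0 by (simp add: vmax_def)
  moreover have "C \<subseteq> V" using V(2) polys_superset(1)[OF R] by blast
  ultimately show ?thesis using C valuation_ring_axioms
    by (intro exI[of _ V]) (simp add: pole_place_def pole_place_axioms_def)
qed

locale place_at_infinity = pole_place +
  assumes closed: "\<And>P. poly_over C P \<Longrightarrow> degree P > 0 \<Longrightarrow> \<exists>a\<in>C. poly P a = 0"
    and trans: "c \<notin> algover C"
begin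

text \<open>Integrality of P(c)/Q(c) forces deg P \<le> deg Q, and the residue is the quotient of
  the coefficients at deg Q. That it stays in the subfield S matters later for S = \<rat>.\<close>

lemma adj_residue:
  assumes S: "field_set S" "S \<subseteq> C" and w: "w \<in> adj S c" "w \<in> V"
  shows "\<exists>a\<in>S. w - a \<in> M"
proof (cases "w = 0")
  case True
  then show ?thesis using ring_set_0[OF field_setD[OF S(1)]] zero_in_M by (intro bexI[of _ 0]) auto
next
  case False
  obtain P Q where PQ: "poly_over S P" "poly_over S Q" "poly Q c \<noteq> 0" "w = poly P c / poly Q c"
    using w(1) by (rule adjE)
  let ?m = "degree P" and ?n = "degree Q"
  have PQC: "poly_over C P" "poly_over C Q" using PQ S poly_over_mono by blast+
  have ne: "P \<noteq> 0" "Q \<noteq> 0" using PQ False by auto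
  have mn: "?m \<le> ?n"
  proof (rule ccontr)
    assume n: "\<not> ?m \<le> ?n"
    have pm: "\<pi> ^ ?m = \<pi> ^ ?n * \<pi> ^ (?m - ?n)" using n by (simp only: power_add[symmetric]) simp
    have "poly P c = w * poly Q c" using PQ by simp
    then have e: "poly P c * \<pi> ^ ?m = w * (poly Q c * \<pi> ^ ?n) * \<pi> ^ (?m - ?n)"
      unfolding pm by (simp only: mult.assoc)
    have "poly Q c * \<pi> ^ ?n \<in> V"
      using poly_assoc_power[OF PQC(2) ne(2)] vassoc_sym unfolding vassoc_def by simp
    moreover have "\<pi> ^ (?m - ?n) \<in> M" using pi_in_M pi_in_V M_power_iff n by auto
    ultimately have "poly P c * \<pi> ^ ?m \<in> M" unfolding e using w(2) by (intro M_mult'[OF V_intros(3)])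
    moreover have "poly P c * \<pi> ^ ?m \<preceq> 1" using poly_assoc_power[OF PQC(1) ne(1)] unfolding vassoc_def by simp
    ultimately show False using vdvd_in_M one_notin_M by blast
  qed
  let ?b = "coeff P ?n" and ?l = "lead_coeff Q"
  have bl: "?b \<in> S" "?l \<in> S" "?l \<noteq> 0" using PQ ne unfolding poly_over_def by auto
  have 1: "poly P c * \<pi> ^ ?n - ?b \<in> M" using poly_at_infinity[OF PQC(1) mn] .
  have 2: "poly Q c * \<pi> ^ ?n - ?l \<in> M" using poly_at_infinity[OF PQC(2) order_refl] .
  have lV: "inverse ?l \<in> V" "?b / ?l \<in> S"
    using bl S CV field_set_inverse[OF S(1)] field_set_divide[OF S(1)] by auto
  have "?l * (w - ?b / ?l) = (poly P c * \<pi> ^ ?n - ?b) - w * (poly Q c * \<pi> ^ ?n - ?l)"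
    using PQ bl by (simp add: field_simps)
  then have "?l * (w - ?b / ?l) \<in> M" using M_diff[OF 1 M_mult'[OF w(2) 2]] by simp
  then have "inverse ?l * (?l * (w - ?b / ?l)) \<in> M" using lV M_mult' by blast
  moreover have "inverse ?l * (?l * (w - ?b / ?l)) = w - ?b / ?l"
    using bl(3) by (simp only: mult.assoc[symmetric] left_inverse mult_1_left not_False_eq_True)
  ultimately have "w - ?b / ?l \<in> M" by (simp only:)
  then show ?thesis using lV by blast
qed

text \<open>Split off the roots of A in C one at a time; as M is prime, one of the linear factors
  lies in M at y.\<close>

lemma poly_residue_root:
  assumes "poly_over C A" "A \<noteq> 0" "y \<in> V" "poly A y \<in> M"
  shows "\<exists>a\<in>C. y - a \<in> M"
  using assms
proof (induction "degree A" arbitrary: A rule: less_induct)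
  case less
  show ?case
  proof (cases "degree A = 0")
    case True
    then obtain b where "A = [:b:]" by (rule degree_eq_zeroE)
    then have "b \<in> C" "b \<noteq> 0" "b \<in> M" using less.prems unfolding poly_over_def by (auto, metis coeff_pCons_0)
    then show ?thesis using const_notin_M by blast
  next
    case False
    then obtain a where a: "a \<in> C" "poly A a = 0" using closed less.prems(1) by blast
    define R where "R = synthetic_div A a"
    have AR: "A = [:- a, 1:] * R" unfolding R_def using synthetic_div_correct'[of a A] a(2) by simp
    have dR: "degree R < degree A" unfolding R_def using False by (simp add: degree_synthetic_div)
    have RV: "poly_over C R" unfolding R_def using less.prems(1) a(1) by (rule poly_over_synthetic_div[OF RC])
    have "R \<noteq> 0" using AR less.prems(2) by auto
    have "poly A y = (y - a) * poly R y" by (subst AR) (simp add: algebra_simps)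
    then have m: "(y - a) * poly R y \<in> M" using less.prems(4) by simp
    have "y - a \<in> V" using less.prems(3) a(1) CV V_intros(5) by blast
    moreover have "poly R y \<in> V" using poly_over_mono[OF RV CV] less.prems(3) by (rule poly_in_ring_set[OF ring])
    ultimately have "y - a \<in> M \<or> poly R y \<in> M" using m by (rule M_prime)
    then show ?thesis using a(1) less.hyps[OF dR RV \<open>R \<noteq> 0\<close> less.prems(3)] by blast
  qed
qed

text \<open>Reducing a normalized relation shows that the residue of y is algebraic over C, which is
  algebraically closed.\<close>

lemma Alg_residue:
  assumes y: "y \<in> Alg" "y \<in> V" shows "\<exists>a\<in>C. y - a \<in> M"
proof -
  obtain P where P: "P \<noteq> 0" "poly_over (adj C c) P" "poly P y = 0" using y(1) unfolding algover_def by blast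
  have "\<exists>k\<in>{..degree P}. \<exists>w'. w' k = 1 \<and> (\<forall>i\<in>{..degree P}. w' i \<in> adj C c \<inter> V) \<and> (\<Sum>i\<le>degree P. w' i * y ^ i) = 0"
    using P adj_field by (intro normalized_relation[where w = "coeff P"])
      (auto simp: poly_altdef poly_over_def intro!: bexI[of _ "degree P"])
  then obtain k w where k: "k \<le> degree P" "w k = 1" "\<And>i. i \<le> degree P \<Longrightarrow> w i \<in> adj C c \<and> w i \<in> V"
    "(\<Sum>i\<le>degree P. w i * y ^ i) = 0" by auto
  have "\<exists>a. a \<in> C \<and> w i - a \<in> M" if "i \<le> degree P" for i
    using adj_residue[OF C order_refl] k(3)[OF that] by blast
  then obtain a where a: "\<And>i. i \<le> degree P \<Longrightarrow> a i \<in> C \<and> w i - a i \<in> M" by metis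
  define A where "A = (\<Sum>i\<le>degree P. monom (a i) i)"
  have cA: "coeff A i = (if i \<le> degree P then a i else 0)" for i
    by (simp add: A_def coeff_sum sum.delta)
  have "poly_over C A" unfolding poly_over_def cA using a C_intros(2) by auto
  moreover have "A \<noteq> 0"
  proof
    assume "A = 0"
    then have "a k = 0" using cA[of k] k(1) by simp
    then show False using a[OF k(1)] k(2) one_notin_M by simp
  qed
  moreover have "poly A y \<in> M"
  proof -
    have "poly A y = (\<Sum>i\<le>degree P. a i * y ^ i)" by (simp add: A_def poly_sum poly_monom)
    also have "\<dots> = - (\<Sum>i\<le>degree P. (w i - a i) * y ^ i)"
      using k(4) by (simp add: left_diff_distrib sum_subtractf)
    also have "\<dots> \<in> M" using a y(2) V_intros(7) by (intro M_uminus M_sum M_mult) auto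
    finally show ?thesis .
  qed
  ultimately show ?thesis using poly_residue_root y(2) by blast
qed

section \<open>Boundedness and approximation at the pole of c\<close>

lemma Alg_bounded: assumes "y \<in> Alg" shows "\<exists>k. y * \<pi> ^ k \<in> V"
proof (cases "y \<in> V")
  case True then show ?thesis by (intro exI[of _ 0]) auto
next
  case False
  then have y: "inverse y \<in> M" "inverse y \<noteq> 0" "inverse y \<in> Alg"
    using inverse_in_M V_intros(2) assms field_set_inverse[OF Alg_field] by auto
  then obtain D where D: "inverse y \<in> algdeg (adj C c) D" using algover_algdeg by blast
  obtain B where "inverse y \<preceq> \<pi> ^ B"
    using discrete_on_upper[OF pi_in_M pi_nonzero discrete_Alg D y(2,1)] by blast
  then have "\<pi> ^ B / inverse y \<in> V" using y(2) vdvd_iff_div by blast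
  then show ?thesis by (intro exI[of _ B]) (simp add: divide_inverse mult.commute)
qed

text \<open>Powers of an element of M inside \<open>Alg\<close> become as small as powers of \<pi>.
  This converts the progress of Newton's iteration into convergence in the sense of
  \<open>vclosure\<close>.\<close>

lemma Alg_small: assumes "y \<in> Alg" "y \<in> M" shows "\<exists>D. \<pi> \<preceq> y ^ D"
proof -
  obtain D where D: "y \<in> algdeg (adj C c) D" using assms algover_algdeg by blast
  then have "y \<in> algdeg (adj C c) (Suc D)" using algdeg_mono[of y _ D _ "Suc D"] by simp
  then show ?thesis using discrete_on_lower[OF pi_in_M pi_nonzero discrete_Alg _ _ assms(2), of "Suc D"] by blast
qed

text \<open>Elements outside \<open>Alg\<close> are excluded because they could be infinitesimal.\<close>

definition vclosure :: "'a set \<Rightarrow> 'a set" where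
  "vclosure F = {y \<in> Alg. \<forall>k. \<exists>u\<in>F. \<pi> ^ k \<preceq> y - u}"

lemma vclosure_subset: "F \<subseteq> Alg \<Longrightarrow> F \<subseteq> vclosure F"
  unfolding vclosure_def by (auto intro: bexI[rotated])

lemma vclosure_in_Alg: "vclosure F \<subseteq> Alg" unfolding vclosure_def by blast

lemma vclosure_idem: "vclosure (vclosure F) \<subseteq> vclosure F"
proof
  fix y assume y: "y \<in> vclosure (vclosure F)"
  have "\<exists>u\<in>F. \<pi> ^ k \<preceq> y - u" for k
  proof -
    obtain z where z: "z \<in> vclosure F" "\<pi> ^ k \<preceq> y - z" using y unfolding vclosure_def by blast
    then obtain u where u: "u \<in> F" "\<pi> ^ k \<preceq> z - u" unfolding vclosure_def by blast
    have "\<pi> ^ k \<preceq> (y - z) + (z - u)" using z u by (intro vdvd_add)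
    then show ?thesis using u by (intro bexI[of _ u]) simp_all
  qed
  then show "y \<in> vclosure F" using y unfolding vclosure_def by blast
qed

text \<open>Passing to products and inverses multiplies an error by elements of \<open>Alg\<close>,
  and their size is bounded by \<open>Alg_bounded\<close>.\<close>

lemma vclosure_field:
  assumes F: "field_set F" "F \<subseteq> Alg" shows "field_set (vclosure F)"
proof -
  have mono: "\<pi> ^ j \<preceq> \<pi> ^ k" if "j \<le> k" for j k
    using power_vdvd_power[OF pi_in_M pi_nonzero] that by blast
  have approx: "\<exists>u\<in>F. \<pi> ^ k \<preceq> y - u" if "y \<in> vclosure F" for y k using that unfolding vclosure_def by blast
  have vI: "y \<in> vclosure F" if "y \<in> Alg" "\<And>k. \<exists>u\<in>F. \<pi> ^ k \<preceq> y - u" for y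
    using that unfolding vclosure_def by blast
  note RF = field_setD[OF F(1)]
  show ?thesis unfolding field_set_def ring_set_def
  proof (intro conjI ballI)
    show "1 \<in> vclosure F" using vclosure_subset[OF F(2)] ring_set_1[OF RF] by blast
  next
    fix x y assume xy: "x \<in> vclosure F" "y \<in> vclosure F"
    then have xyA: "x \<in> Alg" "y \<in> Alg" using vclosure_in_Alg by auto
    show "x - y \<in> vclosure F"
    proof (rule vI)
      show "x - y \<in> Alg" using xyA by (rule ring_set_diff[OF RAlg])
      fix k
      obtain u v where uv: "u \<in> F" "\<pi> ^ k \<preceq> x - u" "v \<in> F" "\<pi> ^ k \<preceq> y - v" using approx xy by blast
      have "\<pi> ^ k \<preceq> (x - u) - (y - v)" using uv(2,4) by (rule vdvd_diff)
      then show "\<exists>u\<in>F. \<pi> ^ k \<preceq> x - y - u"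
        using uv ring_set_diff[OF RF uv(1,3)] by (intro bexI[of _ "u - v"]) (simp_all add: algebra_simps)
    qed
    show "x * y \<in> vclosure F"
    proof (rule vI)
      show "x * y \<in> Alg" using xyA by (rule ring_set_mult[OF RAlg])
      fix k
      obtain a where a: "y * \<pi> ^ a \<in> V" using Alg_bounded xyA by blast
      obtain u where u: "u \<in> F" "\<pi> ^ (k + a) \<preceq> x - u" using approx xy by blast
      \<comment> \<open>The size of u is known only once u is chosen, so the precision for y is
        fixed after it.\<close>
      obtain b where b: "u * \<pi> ^ b \<in> V" using Alg_bounded u F by blast
      obtain v where v: "v \<in> F" "\<pi> ^ (k + b) \<preceq> y - v" using approx xy by blast
      have red: "\<pi> ^ k \<preceq> s * t" if h: "t * \<pi> ^ a \<in> V" "\<pi> ^ (k + a) \<preceq> s" for s t a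
      proof -
        obtain z where z: "z \<in> V" "s = \<pi> ^ (k + a) * z" using h(2) unfolding vdvd_def by blast
        then have "s * t = \<pi> ^ k * (t * \<pi> ^ a * z)" by (simp add: power_add mult_ac)
        moreover have "t * \<pi> ^ a * z \<in> V" using h(1) z(1) by (rule V_intros(3))
        ultimately show ?thesis unfolding vdvd_def by blast
      qed
      have "\<pi> ^ k \<preceq> (x - u) * y + (y - v) * u" using red a u b v by (intro vdvd_add) auto
      then show "\<exists>u\<in>F. \<pi> ^ k \<preceq> x * y - u"
        using ring_set_mult[OF RF u(1) v(1)] by (intro bexI[of _ "u * v"]) (simp_all add: algebra_simps)
    qed
  next
    fix x assume x: "x \<in> vclosure F"
    then have xA: "x \<in> Alg" using vclosure_in_Alg by auto
    show "inverse x \<in> vclosure F"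
    proof (cases "x = 0")
      case True then show ?thesis using x by simp
    next
      case False
      show ?thesis
      proof (rule vI)
        show ixA: "inverse x \<in> Alg" using xA by (rule field_set_inverse[OF Alg_field])
        fix k
        obtain a where a: "inverse x * \<pi> ^ a \<in> V" using Alg_bounded ixA by blast
        then have ax: "x \<preceq> \<pi> ^ a" using False by (simp add: vdvd_iff_div divide_inverse mult.commute)
        \<comment> \<open>Passing to inverses costs v(x) + v(u) \<le> 2a of the precision; the
          additional 1 makes u / x a 1-unit even for k = 0.\<close>
        obtain u where u: "u \<in> F" "\<pi> ^ (k + a + Suc a) \<preceq> x - u" using approx x by blast
        have "x * (\<pi> ^ Suc k) \<preceq> \<pi> ^ a * \<pi> ^ Suc k" using ax by (intro vdvd_mult) auto
        also have "\<pi> ^ a * \<pi> ^ Suc k = \<pi> ^ (Suc k + a)" by (simp add: power_add mult.commute)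
        also have "\<pi> ^ (Suc k + a) \<preceq> \<pi> ^ (k + a + Suc a)" by (rule mono) simp
        also note u(2)
        finally obtain z where z: "z \<in> V" "x - u = x * \<pi> ^ Suc k * z" unfolding vdvd_def by blast
        have "\<pi> ^ Suc k * z \<in> M" using pi_in_M pi_in_V M_power_iff z(1) M_mult by blast
        then have mM: "- (\<pi> ^ Suc k * z) \<in> M" by (rule M_uminus)
        have m: "1 + - (\<pi> ^ Suc k * z) \<in> V" "1 + - (\<pi> ^ Suc k * z) \<notin> M"
          using V_intros(4)[OF V_intros(1) M_in_V[OF mM]] M_diff[OF _ mM, of "1 + - (\<pi> ^ Suc k * z)"] one_notin_M
          by auto
        define e where "e = 1 + - (\<pi> ^ Suc k * z)"
        have e: "e \<in> V" "e \<notin> M" "e \<noteq> 0" using m zero_in_M unfolding e_def by auto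
        have ux: "u = x * e" using z(2) by (simp add: e_def algebra_simps)
        have "inverse x - inverse u = (e - 1) * (inverse e * inverse x)"
          unfolding ux using False e(3) by (simp add: field_simps)
        moreover have "e - 1 = - (\<pi> ^ Suc k * z)" by (simp add: e_def)
        ultimately have "inverse x - inverse u = - (\<pi> ^ Suc k * z) * (inverse e * inverse x)" by (simp only:)
        moreover have "\<pi> ^ (k + a + Suc a) \<preceq> x * (\<pi> ^ Suc k * z)" using u(2) z(2) by (simp add: mult.assoc)
        ultimately have "x * (x * (inverse x - inverse u)) = - (x * (\<pi> ^ Suc k * z)) * inverse e"
          using False by simp
        moreover have "\<pi> ^ (k + a + Suc a) \<preceq> - (x * (\<pi> ^ Suc k * z)) * inverse e"
        proof -
          have "\<pi> ^ (k + a + Suc a) \<preceq> - (x * (\<pi> ^ Suc k * z))"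
            using \<open>\<pi> ^ (k + a + Suc a) \<preceq> x * (\<pi> ^ Suc k * z)\<close> by (rule vdvd_uminus)
          then show ?thesis using vdvd_multI[OF inverse_in_V[OF e(1,2)]] vdvd_trans by blast
        qed
        ultimately have d: "\<pi> ^ (k + a + Suc a) \<preceq> x * (x * (inverse x - inverse u))" by (simp only:)
        have "x * x * \<pi> ^ k \<preceq> \<pi> ^ a * \<pi> ^ a * \<pi> ^ k" using ax by (intro vdvd_mult) auto
        also have "\<pi> ^ a * \<pi> ^ a * \<pi> ^ k = \<pi> ^ (k + a + a)" by (simp add: power_add mult_ac)
        also have "\<pi> ^ (k + a + a) \<preceq> \<pi> ^ (k + a + Suc a)" by (rule mono) simp
        also note d
        finally have "x * x * \<pi> ^ k \<preceq> x * x * (inverse x - inverse u)" by (simp only: mult.assoc)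
        then have "\<pi> ^ k \<preceq> inverse x - inverse u" using False vdvd_cancel[of "x * x"] by simp
        then show "\<exists>u\<in>F. \<pi> ^ k \<preceq> inverse x - u" using u(1) field_set_inverse[OF F(1)] by blast
      qed
    qed
  qed
qed

lemma poly_taylor:
  assumes "poly_over V P" "u \<in> V" "a \<in> V"
  shows "\<exists>s\<in>V. poly P a = poly P u + (a - u) * poly (pderiv P) u + (a - u)\<^sup>2 * s"
  using assms(1)
proof (induction P)
  case 0 then show ?case using V_intros(2) by (intro bexI[of _ 0]) auto
next
  case (pCons b P)
  then have P: "poly_over V P" unfolding poly_over_def by (metis coeff_pCons_Suc)
  then obtain s where s: "s \<in> V" "poly P a = poly P u + (a - u) * poly (pderiv P) u + (a - u)\<^sup>2 * s"
    using pCons.IH by blast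
  have v: "poly (pderiv P) u + a * s \<in> V"
    using poly_in_ring_set[OF ring poly_over_pderiv[OF ring P] assms(2)] V_intros(3)[OF assms(3) s(1)] by (rule V_intros(4))
  have "poly (pCons b P) a = poly (pCons b P) u + (a - u) * poly (pderiv (pCons b P)) u + (a - u)\<^sup>2 * (poly (pderiv P) u + a * s)"
    by (simp add: pderiv_pCons s(2)) (simp add: algebra_simps power2_eq_square)
  then show ?case using v by (rule bexI)
qed

text \<open>Newton's iteration does not leave the closure, because the closure is a field.\<close>

lemma vclosure_hensel:
  assumes F: "field_set F" "F \<subseteq> Alg" and P: "poly_over (vclosure F) P" "poly_over V P"
    and a: "a \<in> Alg" "a \<in> V" "poly P a = 0" "poly (pderiv P) a \<notin> M" and u0: "u0 \<in> vclosure F" "u0 - a \<in> M"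
  shows "a \<in> vclosure F"
proof -
  note G = vclosure_field[OF F]
  note RG = field_setD[OF G]
  define m where "m = u0 - a"
  have mM: "m \<in> M" "m \<in> V" using u0 M_in_V by (auto simp: m_def)
  have dV: "poly_over V (pderiv P)" using P(2) by (rule poly_over_pderiv[OF ring])
  have newton: "\<exists>u\<in>vclosure F. m ^ Suc k \<preceq> u - a" for k
  proof (induction k)
    case 0 then show ?case using u0 by (intro bexI[of _ u0]) (auto simp: m_def)
  next
    case (Suc k)
    then obtain u where u: "u \<in> vclosure F" "m ^ Suc k \<preceq> u - a" by blast
    have mk: "m ^ Suc k \<in> M" using M_power_iff[OF mM(2), of "Suc k"] mM(1) by simp
    have ua: "u - a \<in> M" using u(2) mk by (rule vdvd_in_M)
    have uV: "u \<in> V" using V_intros(4)[OF M_in_V[OF ua] a(2)] by simp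
    obtain s where s: "s \<in> V" "poly P a = poly P u + (a - u) * poly (pderiv P) u + (a - u)\<^sup>2 * s"
      using poly_taylor[OF P(2) uV a(2)] by blast
    let ?d = "poly (pderiv P) u"
    have dV': "?d \<in> V" using dV uV by (rule poly_in_ring_set[OF ring])
    \<comment> \<open>The derivative at u is congruent to the one at a, hence a unit.\<close>
    have "?d \<notin> M"
    proof
      assume "?d \<in> M"
      obtain w where w: "poly (pderiv P) u - poly (pderiv P) a = (u - a) * w" "w \<in> V"
      proof -
        obtain t where t: "t \<in> V" "poly (pderiv P) a = ?d + (a - u) * poly (pderiv (pderiv P)) u + (a - u)\<^sup>2 * t"
          using poly_taylor[OF dV uV a(2)] by blast
        have mem: "poly (pderiv (pderiv P)) u + (a - u) * t \<in> V"
          by (rule V_intros(4)[OF poly_in_ring_set[OF ring poly_over_pderiv[OF ring dV] uV]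
                V_intros(3)[OF V_intros(5)[OF a(2) uV] t(1)]])
        have "poly (pderiv P) u - poly (pderiv P) a = (u - a) * (poly (pderiv (pderiv P)) u + (a - u) * t)"
          unfolding t(2) by (simp add: algebra_simps power2_eq_square)
        then show thesis using mem by (rule that)
      qed
      have "?d - (u - a) * w \<in> M" using \<open>?d \<in> M\<close> M_mult[OF ua w(2)] by (rule M_diff)
      moreover have "?d - (u - a) * w = poly (pderiv P) a" using w(1) by (simp add: algebra_simps)
      ultimately show False using a(4) by simp
    qed
    then have idV: "inverse ?d \<in> V" "?d \<noteq> 0" using dV' inverse_in_V zero_in_M by auto
    define u' where "u' = u - poly P u / ?d"
    have "u' \<in> vclosure F" unfolding u'_def
      using u(1) P(1) G poly_in_ring_set[OF RG] poly_over_pderiv[OF RG]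
      by (intro ring_set_diff[OF RG] field_set_divide[OF G]) auto
    moreover have "u' - a = (u - a)\<^sup>2 * (s * inverse ?d)"
    proof -
      have "poly P u + ((a - u) * ?d + (a - u)\<^sup>2 * s) = 0" using s(2) a(3) by (simp add: add.assoc)
      then have "poly P u = - ((a - u) * ?d + (a - u)\<^sup>2 * s)" by (simp only: eq_neg_iff_add_eq_0)
      also have "\<dots> = (u - a) * ?d - (u - a)\<^sup>2 * s"
        by (simp add: power2_commute[of a u]) (simp add: algebra_simps)
      finally have "poly P u = (u - a) * ?d - (u - a)\<^sup>2 * s" .
      then have "poly P u / ?d = (u - a) - (u - a)\<^sup>2 * s / ?d"
        using idV(2) by (simp only: diff_divide_distrib nonzero_mult_div_cancel_right not_False_eq_True)
      then have "poly P u / ?d = (u - a) - (u - a)\<^sup>2 * (s * inverse ?d)"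
        by (simp only: divide_inverse mult.assoc)
      then show ?thesis unfolding u'_def by simp
    qed
    moreover have "m ^ Suc (Suc k) \<preceq> (u - a)\<^sup>2 * (s * inverse ?d)"
    proof -
      have "m ^ Suc (Suc k) \<preceq> m ^ Suc (Suc k) * m ^ k" using mM V_intros(7) by (intro vdvd_multI)
      also have "m ^ Suc (Suc k) * m ^ k = m ^ Suc k * m ^ Suc k" by (simp add: power_add[symmetric])
      also have "\<dots> \<preceq> (u - a) * (u - a)" using u(2) by (intro vdvd_mult)
      also have "\<dots> \<preceq> (u - a) * (u - a) * (s * inverse ?d)" using s(1) idV(1) V_intros(3) by (intro vdvd_multI)
      finally show ?thesis by (simp add: power2_eq_square)
    qed
    ultimately show ?case by (intro bexI[of _ u']) (simp_all only:)
  qed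
  have mA: "m \<in> Alg" unfolding m_def using u0(1) vclosure_in_Alg a(1) ring_set_diff[OF RAlg] by blast
  obtain D where D: "\<pi> \<preceq> m ^ D" using Alg_small[OF mA mM(1)] by blast
  have "\<exists>u\<in>vclosure F. \<pi> ^ k \<preceq> a - u" for k
  proof -
    obtain u where u: "u \<in> vclosure F" "m ^ Suc (D * k) \<preceq> u - a" using newton by blast
    have "\<pi> ^ k \<preceq> (m ^ D) ^ k" using D by (rule vdvd_power)
    also have "(m ^ D) ^ k \<preceq> (m ^ D) ^ k * m" using mM(2) by (rule vdvd_multI)
    also have "(m ^ D) ^ k * m = m ^ Suc (D * k)" by (simp add: power_mult[symmetric] mult.commute)
    also note u(2)
    finally have "\<pi> ^ k \<preceq> - (u - a)" by (rule vdvd_uminus)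
    then show ?thesis using u(1) by (intro bexI[of _ u]) simp_all
  qed
  then have "a \<in> vclosure (vclosure F)" using a(1) unfolding vclosure_def[of "vclosure F"] by blast
  then show ?thesis using vclosure_idem by blast
qed

text \<open>Residues of elements of \<open>Alg\<close> are represented by unique constants, so for F
  inside \<open>Alg\<close> the residue field appears as a subset of C.\<close>

definition residues :: "'a set \<Rightarrow> 'a set" where
  "residues F = {a \<in> C. \<exists>u\<in>F. u - a \<in> M}"

lemma vclosure_residue:
  assumes "y \<in> vclosure F" "y \<in> V" shows "\<exists>a\<in>residues F. y - a \<in> M"
proof -
  obtain a where a: "a \<in> C" "y - a \<in> M" using Alg_residue assms vclosure_in_Alg by blast
  obtain u where u: "u \<in> F" "\<pi> ^ 1 \<preceq> y - u" using assms(1) unfolding vclosure_def by blast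
  have "y - u \<in> M" using u(2) pi_in_M vdvd_in_M by simp
  with a(2) have "(y - a) - (y - u) \<in> M" by (rule M_diff)
  then have "u - a \<in> M" by simp
  then show ?thesis using a u unfolding residues_def by blast
qed

text \<open>Hensel's lemma for an integer polynomial of least degree with root a. In characteristic
  0 its derivative at a is a nonzero constant, hence a unit, and an element of F with residue a
  starts the iteration.\<close>

lemma residues_in_vclosure:
  assumes F: "field_set F" "F \<subseteq> Alg" and alg: "C \<subseteq> algover \<int>" and char0: "\<And>n. n > 0 \<Longrightarrow> (of_nat n :: 'a) \<noteq> 0"
  shows "residues F \<subseteq> vclosure F"
proof
  fix a assume "a \<in> residues F"
  then obtain u where a: "a \<in> C" and u: "u \<in> F" "u - a \<in> M" unfolding residues_def by blast
  have "\<exists>P. P \<noteq> 0 \<and> poly_over \<int> P \<and> poly P a = 0" using a alg unfolding algover_def by blast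
  then obtain P where P: "P \<noteq> 0" "poly_over \<int> P" "poly P a = 0"
    and least: "\<And>Q. Q \<noteq> 0 \<Longrightarrow> poly_over \<int> Q \<Longrightarrow> poly Q a = 0 \<Longrightarrow> degree P \<le> degree Q"
    using ex_has_least_nat[of "\<lambda>P. P \<noteq> 0 \<and> poly_over \<int> P \<and> poly P a = 0" _ degree] by metis
  have d0: "degree P > 0" using P by (metis degree_eq_zeroE poly_const_conv pCons_0_0 gr0I)
  have ZF: "\<int> \<subseteq> vclosure F" using ring_set_of_int[OF field_setD[OF vclosure_field[OF F]]] by (auto elim: Ints_cases)
  have ZV: "\<int> \<subseteq> V" using ring_set_of_int[OF ring] by (auto elim: Ints_cases)
  have ZC: "\<int> \<subseteq> C" using ring_set_of_int[OF RC] by (auto elim: Ints_cases)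
  have "coeff (pderiv P) (degree P - 1) \<noteq> 0"
    using char0[OF d0] d0 P(1) by (simp add: coeff_pderiv del: of_nat_Suc)
  then have dne: "pderiv P \<noteq> 0" by auto
  have "degree (pderiv P) < degree P"
    by (rule le_less_trans[of _ "degree P - 1"]) (auto intro!: degree_le simp: coeff_pderiv coeff_eq_0 d0)
  then have "poly (pderiv P) a \<noteq> 0" using least[OF dne poly_over_pderiv[OF Ints_ring_set P(2)]] by auto
  moreover have "poly (pderiv P) a \<in> C"
    using poly_in_ring_set[OF RC poly_over_pderiv[OF RC poly_over_mono[OF P(2) ZC]] a] .
  ultimately have dM: "poly (pderiv P) a \<notin> M" using const_notin_M by blast
  show "a \<in> vclosure F"
    using vclosure_hensel[OF F poly_over_mono[OF P(2) ZF] poly_over_mono[OF P(2) ZV] _ _ P(3) dM _ u(2)]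
      a C_in_Alg CV u(1) vclosure_subset[OF F(2)] by blast
qed

text \<open>Gaussian elimination on leading terms.\<close>

lemma vclosure_dependent:
  assumes F: "field_set F" "F \<subseteq> Alg" and L: "residues F \<subseteq> vclosure F"
    and I: "finite I" "\<And>i. i \<in> I \<Longrightarrow> u i \<in> vclosure F" "\<And>i. i \<in> I \<Longrightarrow> g i \<in> C" "\<exists>i\<in>I. g i \<noteq> 0"
      "(\<Sum>i\<in>I. g i * u i) = 0"
  shows "\<exists>l. (\<forall>i\<in>I. l i \<in> residues F) \<and> (\<exists>i\<in>I. l i \<noteq> 0) \<and> (\<Sum>i\<in>I. l i * u i) = 0"
  using I
proof (induction "card I" arbitrary: I u g rule: less_induct)
  case less
  note G = vclosure_field[OF F]
  note RG = field_setD[OF G]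
  have r0: "0 \<in> residues F" "1 \<in> residues F"
    using ring_set_0[OF field_setD[OF F(1)]] ring_set_1[OF field_setD[OF F(1)]] C_intros(1,2) zero_in_M
    unfolding residues_def by force+
  have rring: "ring_set (residues F)"
    unfolding ring_set_def
  proof (intro conjI ballI r0)
    fix x y assume "x \<in> residues F" "y \<in> residues F"
    then obtain u v where uv: "x \<in> C" "y \<in> C" "u \<in> F" "v \<in> F" "u - x \<in> M" "v - y \<in> M" unfolding residues_def by blast
    have "(u - x) - (v - y) \<in> M" using uv(5,6) by (rule M_diff)
    then have "(u - v) - (x - y) \<in> M" by (simp add: algebra_simps)
    then show "x - y \<in> residues F"
      using uv C_intros(5) ring_set_diff[OF field_setD[OF F(1)]] unfolding residues_def by blast
    have vV: "v \<in> V" using V_intros(4)[OF M_in_V[OF uv(6)]] uv(2) CV by fastforce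
    have "(u - x) * v + x * (v - y) \<in> M" using uv CV vV M_mult M_mult' by (intro M_add) auto
    then have "u * v - x * y \<in> M" by (simp add: algebra_simps)
    then show "x * y \<in> residues F"
      using uv C_intros(3) ring_set_mult[OF field_setD[OF F(1)]] unfolding residues_def by blast
  qed
  have "I \<noteq> {}" using less.prems(4) by blast
  \<comment> \<open>The pivot has least value, so the quotients u i / u k are integral and have
    residues l i. Subtracting l i * u k leaves an element that is divisible by the pivot with
    quotient in M.\<close>
  then obtain k where k: "k \<in> I" "\<And>i. i \<in> I \<Longrightarrow> u k \<preceq> u i" using vdvd_minimum[OF less.prems(1)] by blast
  show ?case
  proof (cases "u k = 0")
    case True
    then have "\<And>i. i \<in> I \<Longrightarrow> u i = 0" using k(2) by fastforce
    then show ?thesis using r0 k(1) by (intro exI[of _ "\<lambda>_. 1"]) auto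
  next
    case False
    have "\<exists>l. l \<in> residues F \<and> u i / u k - l \<in> M" if "i \<in> I" for i
    proof -
      have "u i / u k \<in> V" using k(2)[OF that] False vdvd_iff_div by blast
      moreover have "u i / u k \<in> vclosure F" using less.prems(2) that k(1) field_set_divide[OF G] by blast
      ultimately show ?thesis using vclosure_residue by blast
    qed
    then obtain l where l: "\<And>i. i \<in> I \<Longrightarrow> l i \<in> residues F" "\<And>i. i \<in> I \<Longrightarrow> u i / u k - l i \<in> M" by metis
    define J where "J = I - {k}"
    define u' where "u' i = u i - l i * u k" for i
    \<comment> \<open>The coefficient of the pivot after elimination. It lies in C and, by the
      relation, in M; so it vanishes, and the relation passes to the remaining elements.\<close>
    define r where "r = g k + (\<Sum>i\<in>J. g i * l i)"
    have fin: "finite J" "k \<notin> J" "J \<subseteq> I" "I = insert k J" using less.prems(1) k(1) by (auto simp: J_def)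
    have "(\<Sum>i\<in>I. g i * u i) = g k * u k + (\<Sum>i\<in>J. g i * u i)" using fin by simp
    also have "(\<Sum>i\<in>J. g i * u i) = (\<Sum>i\<in>J. g i * u' i) + (\<Sum>i\<in>J. g i * l i) * u k"
      by (simp add: u'_def right_diff_distrib sum_subtractf sum_distrib_right mult.assoc)
    finally have e: "(\<Sum>i\<in>J. g i * u' i) + r * u k = 0"
      using less.prems(5) by (simp add: r_def algebra_simps)
    have "(\<Sum>i\<in>J. g i * (u' i / u k)) = (\<Sum>i\<in>J. g i * u' i) / u k" by (simp add: sum_divide_distrib)
    also have "\<dots> = - r" using e False by (simp add: field_simps add_eq_0_iff)
    finally have "- r = (\<Sum>i\<in>J. g i * (u' i / u k))" by simp
    moreover have "(\<Sum>i\<in>J. g i * (u' i / u k)) \<in> M"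
    proof (intro M_sum M_mult')
      fix i assume "i \<in> J"
      then have i: "i \<in> I" using fin by blast
      show "g i \<in> V" using less.prems(3)[OF i] CV by blast
      have "u' i / u k = u i / u k - l i" using False by (simp add: u'_def diff_divide_distrib)
      then show "u' i / u k \<in> M" using l(2)[OF i] by simp
    qed
    ultimately have "- r \<in> M" by (simp only:)
    moreover have "r \<in> C" unfolding r_def using less.prems(3) l(1) k(1) fin
      by (intro C_intros ring_set_sum[OF RC]) (auto simp: residues_def)
    then have "- r \<in> C" by (rule C_intros)
    ultimately have "- r = 0" using const_in_M by blast
    then have r: "r = 0" by simp
    then have s0: "(\<Sum>i\<in>J. g i * u' i) = 0" using e by simp
    have "\<exists>i\<in>J. g i \<noteq> 0"
    proof (rule ccontr)
      assume n: "\<not> ?thesis"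
      then have "g k = 0" using r by (simp add: r_def)
      then show False using n less.prems(4) fin by auto
    qed
    moreover have "u' i \<in> vclosure F" if "i \<in> J" for i unfolding u'_def
      using that fin l(1) L less.prems(2) k(1) by (intro ring_set_diff[OF RG] ring_set_mult[OF RG]) auto
    moreover have "card J < card I" using fin less.prems(1) by (simp add: card_insert_disjoint)
    ultimately obtain l' where l': "\<forall>i\<in>J. l' i \<in> residues F" "\<exists>i\<in>J. l' i \<noteq> 0" "(\<Sum>i\<in>J. l' i * u' i) = 0"
      using less.hyps[of J u' g] fin less.prems(3) s0 by blast
    define l2 where "l2 i = (if i = k then - (\<Sum>i\<in>J. l' i * l i) else l' i)" for i
    have J: "(\<Sum>i\<in>J. l2 i * u i) = (\<Sum>i\<in>J. l' i * u i)"
      using fin by (intro sum.cong) (auto simp: l2_def)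
    have "(\<Sum>i\<in>I. l2 i * u i) = l2 k * u k + (\<Sum>i\<in>J. l2 i * u i)" using fin by simp
    also have "\<dots> = (\<Sum>i\<in>J. l' i * u' i)"
      unfolding J by (simp add: l2_def u'_def right_diff_distrib sum_subtractf sum_distrib_right mult.assoc)
    finally have "(\<Sum>i\<in>I. l2 i * u i) = 0" using l'(3) by simp
    moreover have "\<forall>i\<in>I. l2 i \<in> residues F" unfolding l2_def using l' l fin
      by (auto intro!: ring_set_uminus[OF rring] ring_set_sum[OF rring] ring_set_mult[OF rring])
    moreover have "\<exists>i\<in>I. l2 i \<noteq> 0" using l'(2) fin by (auto simp: l2_def)
    ultimately show ?thesis by blast
  qed
qed

end

section \<open>Finite bases, and iterates as polynomials\<close>

lemma field_set_Int: "field_set F \<Longrightarrow> field_set E \<Longrightarrow> field_set (F \<inter> E)"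
  by (simp add: field_set_def ring_set_def)

lemma algoverI: "P \<noteq> 0 \<Longrightarrow> poly_over S P \<Longrightarrow> poly P y = 0 \<Longrightarrow> y \<in> algover S"
  unfolding algover_def by blast

text \<open>Independent subsets of L have at most D elements, and one of largest size spans.\<close>

lemma lspan_finite_basis:
  assumes Q: "field_set Q"
    and dep: "\<And>I. I \<subseteq> L \<Longrightarrow> finite I \<Longrightarrow> card I > D \<Longrightarrow>
      \<exists>a. (\<forall>b\<in>I. a b \<in> Q) \<and> (\<exists>b\<in>I. a b \<noteq> 0) \<and> (\<Sum>b\<in>I. a b * b) = 0"
  shows "\<exists>B. finite B \<and> B \<subseteq> L \<and> L \<subseteq> lspan Q B"
proof -
  define indep where "indep T \<longleftrightarrow> finite T \<and> T \<subseteq> L \<and>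
    (\<forall>a. (\<forall>b\<in>T. a b \<in> Q) \<longrightarrow> (\<Sum>b\<in>T. a b * b) = 0 \<longrightarrow> (\<forall>b\<in>T. a b = 0))" for T
  have bound: "card T \<le> D" if "indep T" for T
  proof (rule ccontr)
    assume "\<not> card T \<le> D"
    then show False using dep[of T] that unfolding indep_def by (metis not_le)
  qed
  have "indep {}" by (simp add: indep_def)
  then have "\<exists>T. indep T \<and> (\<forall>U. indep U \<longrightarrow> card U \<le> card T)"
    using bound ex_has_greatest_nat[of indep "{}" card "Suc D"] by (metis le_SucI less_Suc_eq_le)
  then obtain T where T: "indep T" and max: "\<And>U. indep U \<Longrightarrow> card U \<le> card T" by blast
  have fT: "finite T" "T \<subseteq> L" using T by (auto simp: indep_def)
  note R = field_setD[OF Q]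
  have "x \<in> lspan Q T" if x: "x \<in> L" for x
  proof (cases "x \<in> T")
    case True then show ?thesis using lspan_base[OF R] fT by blast
  next
    case False
    then have ni: "\<not> indep (insert x T)" using max[of "insert x T"] fT by auto
    have "\<exists>a. (\<forall>b\<in>insert x T. a b \<in> Q) \<and> (\<Sum>b\<in>insert x T. a b * b) = 0 \<and> (\<exists>b\<in>insert x T. a b \<noteq> 0)"
    proof (rule ccontr)
      assume n: "\<not> ?thesis"
      have "indep (insert x T)" unfolding indep_def
      proof (intro conjI allI impI)
        show "finite (insert x T)" "insert x T \<subseteq> L" using fT x by auto
        fix a assume "\<forall>b\<in>insert x T. a b \<in> Q" "(\<Sum>b\<in>insert x T. a b * b) = 0"
        then show "\<forall>b\<in>insert x T. a b = 0" using n by blast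
      qed
      then show False using ni by blast
    qed
    then obtain a where a: "\<forall>b\<in>insert x T. a b \<in> Q" "(\<Sum>b\<in>insert x T. a b * b) = 0" "\<exists>b\<in>insert x T. a b \<noteq> 0"
      by (elim exE conjE)
    have s: "a x * x + (\<Sum>b\<in>T. a b * b) = 0" using a(2) False fT by simp
    have ax: "a x \<noteq> 0"
    proof
      assume "a x = 0"
      then have "(\<Sum>b\<in>T. a b * b) = 0" "\<exists>b\<in>T. a b \<noteq> 0" using s a(3) by auto
      then show False using T a(1) unfolding indep_def by blast
    qed
    have "x = - (\<Sum>b\<in>T. a b * b) / a x" using s ax by (simp add: field_simps add_eq_0_iff)
    also have "\<dots> = (\<Sum>b\<in>T. (- (inverse (a x)) * a b) * b)"
      by (simp add: divide_inverse sum_distrib_left sum_distrib_right sum_negf mult_ac)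
    also have "\<dots> \<in> lspan Q T"
      using a(1) R fT field_set_inverse[OF Q]
      by (intro lspan_sum lspan_scale lspan_base ring_set_mult[OF R] ring_set_uminus[OF R]) auto
    finally show ?thesis .
  qed
  then show ?thesis using fT by blast
qed

definition iter_unicrit :: "nat \<Rightarrow> 'a::comm_ring_1 \<Rightarrow> nat \<Rightarrow> 'a poly" where
  "iter_unicrit q c n = ((\<lambda>P. P ^ q + [:c:]) ^^ n) [:0, 1:]"

lemma poly_iter_unicrit: "poly (iter_unicrit q c n) x = (unicrit q c ^^ n) x"
  unfolding iter_unicrit_def by (induction n) auto

lemma iter_unicrit_monic:
  fixes c :: "'a::idom"
  assumes "q > 0"
  shows "degree (iter_unicrit q c n) = q ^ n \<and> lead_coeff (iter_unicrit q c n) = 1"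
proof (induction n)
  case 0 then show ?case by (simp add: iter_unicrit_def)
next
  case (Suc n)
  let ?P = "iter_unicrit q c n"
  have d: "degree (?P ^ q) = q ^ Suc n" using Suc assms by (subst degree_power_eq) auto
  moreover have "degree [:c:] < degree (?P ^ q)" using d assms by simp
  ultimately have d': "degree (?P ^ q + [:c:]) = q ^ Suc n" by (simp only: degree_add_eq_left)
  have "lead_coeff (?P ^ q) = 1" by (simp only: lead_coeff_power conjunct2[OF Suc] power_one)
  moreover have "coeff [:c:] (q ^ Suc n) = 0" by (rule coeff_eq_0) (use assms in simp)
  ultimately have f: "degree (?P ^ q + [:c:]) = q ^ Suc n \<and> lead_coeff (?P ^ q + [:c:]) = 1"
    unfolding d' d by (simp only: coeff_add add_0_right simp_thms)
  have e: "iter_unicrit q c (Suc n) = ?P ^ q + [:c:]" by (simp add: iter_unicrit_def)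
  show ?case unfolding e by (rule f)
qed

lemma iter_unicrit_over:
  fixes R :: "'a::idom set"
  assumes R: "ring_set R" and c: "c \<in> R" shows "poly_over R (iter_unicrit q c n)"
proof (induction n)
  case 0
  show ?case unfolding iter_unicrit_def using R
    by (auto intro!: poly_over_pCons poly_over_0 ring_set_0 ring_set_1)
next
  case (Suc n)
  have "iter_unicrit q c (Suc n) = iter_unicrit q c n ^ q + [:c:]" by (simp add: iter_unicrit_def)
  then show ?case using Suc R c by (simp add: poly_over_add poly_over_power poly_over_const)
qed

lemma iter_unicrit_diff_nonzero:
  fixes c :: "'a::idom"
  assumes "q > 0" shows "iter_unicrit q c n - [:b:] \<noteq> 0"
proof
  assume "iter_unicrit q c n - [:b:] = 0"
  then have "degree (iter_unicrit q c n) = degree [:b:]" by simp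
  then show False using iter_unicrit_monic[OF assms, of c n] assms by simp
qed

lemma unicrit_preimage_algover:
  assumes F: "field_set F" "c \<in> F" "b \<in> F" and q: "q > 0" and x: "(unicrit q c ^^ n) x = b"
  shows "x \<in> algover F"
  unfolding algover_def
proof (intro CollectI exI conjI)
  show "iter_unicrit q c n - [:b:] \<noteq> 0" using q by (rule iter_unicrit_diff_nonzero)
  show "poly_over F (iter_unicrit q c n - [:b:])"
    using F field_setD by (intro poly_over_diff iter_unicrit_over poly_over_const) auto
  show "poly (iter_unicrit q c n - [:b:]) x = 0" using x by (simp add: poly_iter_unicrit)
qed

lemma finite_unicrit_preimages:
  fixes c :: "'a::idom"
  assumes "q > 0" shows "finite {x. (unicrit q c ^^ n) x = b}"
  using poly_roots_finite[OF iter_unicrit_diff_nonzero[OF assms, of c n b]] by (simp add: poly_iter_unicrit)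

section \<open>Descent to a field of bounded degree over \<rat>(c)\<close>

context place_at_infinity
begin

text \<open>Divide by c^q: (x/c)^q = (x0/c - 1) / c^(q-1), which lies in M because q \<ge>
  2.\<close>

lemma preimage_small_step:
  assumes q: "q \<ge> 2" and x: "x ^ q + c = x0" "x0 * \<pi> \<in> M"
  shows "x * \<pi> \<in> M"
proof -
  have q1: "\<pi> ^ q = \<pi> * \<pi> ^ (q - 1)" using q power_Suc[of \<pi> "q - 1"] by simp
  have "(x * \<pi>) ^ q = (x0 - c) * \<pi> ^ q" using x(1) by (auto simp: power_mult_distrib)
  also have "\<dots> = (x0 * \<pi> - 1) * \<pi> ^ (q - 1)" unfolding q1 using c_nonzero by (simp add: left_diff_distrib)
  also have "\<dots> \<in> M"
    using q pi_in_M pi_in_V M_power_iff x(2) M_in_V V_intros(1,5) by (intro M_mult') auto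
  finally have "(x * \<pi>) ^ q \<in> M" .
  moreover have "x * \<pi> \<in> V" using V_power_iff[of q "x * \<pi>"] q M_in_V[OF calculation] by simp
  ultimately show ?thesis using M_power_iff q by auto
qed

text \<open>As long as the preimages are not small against c, the power x^(q^j) stays bounded by
  \<pi>^(-k). This forces smallness once q^j > k, and by \<open>preimage_small_step\<close>
  smallness persists.\<close>

lemma preimages_eventually_small:
  assumes q: "q \<ge> 2" and \<beta>: "\<beta> \<in> Alg"
  shows "\<exists>N. \<forall>x. (unicrit q c ^^ N) x = \<beta> \<longrightarrow> x * \<pi> \<in> M"
proof -
  obtain k where k: "\<beta> * \<pi> ^ k \<in> V" using Alg_bounded[OF \<beta>] by blast
  have claim: "(unicrit q c ^^ j) x = \<beta> \<Longrightarrow> x ^ (q ^ j) * \<pi> ^ k \<in> V \<or> x * \<pi> \<in> M" for j x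
  proof (induction j arbitrary: x)
    case 0 then show ?case using k by simp
  next
    case (Suc j)
    define x0 where "x0 = x ^ q + c"
    have "(unicrit q c ^^ j) x0 = \<beta>" using Suc.prems unfolding x0_def by (simp only: funpow_Suc_right o_apply)
    then have IH: "x0 ^ (q ^ j) * \<pi> ^ k \<in> V \<or> x0 * \<pi> \<in> M" by (rule Suc.IH)
    show ?case
    proof (cases "x0 * \<pi> \<in> M")
      case True
      then show ?thesis using preimage_small_step[OF q] x0_def by blast
    next
      case False
      then have x0: "x0 \<noteq> 0" using zero_in_M by auto
      have iv: "inverse (x0 * \<pi>) \<in> V" using False inverse_in_V inverse_in_M M_in_V by blast
      \<comment> \<open>Here c / x0 is integral, so x^q = x0 * e is no larger than x0.\<close>
      define e where "e = 1 - inverse (x0 * \<pi>)"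
      have "e \<in> V" unfolding e_def using V_intros(1) iv by (rule V_intros(5))
      have "x ^ q = x0 * e" using x0 c_nonzero by (simp add: x0_def e_def field_simps)
      then have "x ^ (q ^ Suc j) = (x0 * e) ^ (q ^ j)" by (simp only: power_Suc power_mult)
      then have e': "x ^ (q ^ Suc j) * \<pi> ^ k = (x0 ^ (q ^ j) * \<pi> ^ k) * e ^ (q ^ j)"
        by (simp add: power_mult_distrib mult_ac)
      have "x0 ^ (q ^ j) * \<pi> ^ k \<in> V" using IH False by blast
      then have "(x0 ^ (q ^ j) * \<pi> ^ k) * e ^ (q ^ j) \<in> V" using V_intros(7)[OF \<open>e \<in> V\<close>] by (rule V_intros(3))
      then show ?thesis unfolding e' by blast
    qed
  qed
  have kq: "k < q ^ Suc k"
  proof -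
    have "k < 2 ^ k" by (rule less_exp)
    also have "(2::nat) ^ k \<le> q ^ k" using q by (intro power_mono) auto
    also have "\<dots> \<le> q ^ Suc k" using q by (intro power_increasing) auto
    finally show ?thesis .
  qed
  have "x * \<pi> \<in> M" if "(unicrit q c ^^ Suc k) x = \<beta>" for x
    using claim[OF that]
  proof
    let ?N = "q ^ Suc k"
    assume h: "x ^ ?N * \<pi> ^ k \<in> V"
    have "\<pi> ^ ?N = \<pi> ^ k * \<pi> ^ (?N - k)" using kq by (simp only: power_add[symmetric]) simp
    then have "(x * \<pi>) ^ ?N = x ^ ?N * \<pi> ^ k * \<pi> ^ (?N - k)"
      by (simp only: power_mult_distrib mult.assoc)
    moreover have "\<pi> ^ (?N - k) \<in> M" using pi_in_M pi_in_V M_power_iff kq by auto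
    ultimately have m: "(x * \<pi>) ^ ?N \<in> M" using h M_mult' by simp
    have "?N > 0" using q by simp
    then have "x * \<pi> \<in> V" using V_power_iff M_in_V[OF m] by blast
    then show ?thesis using M_power_iff \<open>?N > 0\<close> m by blast
  qed
  then show ?thesis by blast
qed

text \<open>Up to the fixed factor \<open>s\<close>, a preimage of \<open>x\<^sub>0\<close> is a \<open>q\<close>-th root of a 1-unit.\<close>

lemma preimage_in_vclosure:
  assumes F: "field_set F" "F \<subseteq> Alg" and q: "q \<ge> 2" and q0: "(of_nat q :: 'a) \<noteq> 0"
    and s: "s \<in> F" "s ^ q = - c" and mu: "\<And>z. z ^ q = 1 \<Longrightarrow> z \<in> F"
    and x0: "x0 \<in> vclosure F" "x0 * \<pi> \<in> M" and x: "x ^ q + c = x0"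
  shows "x \<in> vclosure F"
proof -
  note G = vclosure_field[OF F]
  note RG = field_setD[OF G]
  have s0: "s \<noteq> 0" using s(2) c_nonzero q by (auto simp: power_0_left)
  have FG: "F \<subseteq> vclosure F" using F(2) by (rule vclosure_subset)
  define w where "w = x / s"
  define t where "t = 1 - x0 * \<pi>"
  have wq: "w ^ q = t" using x s c_nonzero s0 by (auto simp: w_def t_def power_divide field_simps)
  have tV: "t \<in> V" unfolding t_def using V_intros(1) M_in_V[OF x0(2)] by (rule V_intros(5))
  have tM: "t \<notin> M" using M_add[OF _ x0(2), of t] one_notin_M by (auto simp: t_def)
  have wV: "w \<in> V" using V_power_iff[of q w] q wq tV by simp
  have wM: "w \<notin> M" using M_power_iff[OF wV, of q] q wq tM by simp
  have \<pi>A: "\<pi> \<in> Alg" using c_in_Alg by (rule field_set_inverse[OF Alg_field])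
  have tA: "t \<in> Alg" unfolding t_def using x0(1) vclosure_in_Alg \<pi>A
    by (intro ring_set_diff[OF RAlg] ring_set_mult[OF RAlg] ring_set_1[OF RAlg]) auto
  have cG: "c \<in> vclosure F"
  proof -
    have "- (s ^ q) \<in> vclosure F" using s(1) FG by (intro ring_set_uminus[OF RG] ring_set_power[OF RG]) auto
    then show ?thesis using s(2) by simp
  qed
  have tG: "t \<in> vclosure F" unfolding t_def using x0(1) cG field_set_inverse[OF G]
    by (intro ring_set_diff[OF RG] ring_set_mult[OF RG] ring_set_1[OF RG]) auto
  define P where "P = monom 1 q - [:t:]"
  have pP: "poly P z = z ^ q - t" for z by (simp add: P_def poly_monom)
  have dP: "poly (pderiv P) z = of_nat q * z ^ (q - 1)" for z
    by (simp add: P_def pderiv_diff pderiv_monom poly_monom pderiv_pCons)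
  have "coeff P q = 1" using q by (simp add: P_def coeff_pCons split: nat.splits)
  then have P0: "P \<noteq> 0" by auto
  have wAA: "w \<in> algover Alg"
  proof (rule algoverI[OF P0])
    show "poly_over Alg P" unfolding P_def using tA
      by (intro poly_over_diff[OF RAlg] poly_over_monom[OF RAlg] poly_over_const[OF RAlg] ring_set_1[OF RAlg])
    show "poly P w = 0" by (simp add: pP wq)
  qed
  have wA: "w \<in> Alg" using wAA by (rule algover_algover[OF adj_field])
  \<comment> \<open>The residue of w is a q-th root of unity, hence in F by \<open>mu\<close>; it is
    the starting point for Hensel's lemma.\<close>
  obtain z where z: "z \<in> C" "w - z \<in> M" using Alg_residue[OF wA wV] by blast
  have zV: "z \<in> V" using z CV by blast
  have "z ^ q = 1"
  proof -
    obtain u where u: "u \<in> V" "w ^ q - z ^ q = (w - z) * u"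
    proof
      show "(\<Sum>i<q. z ^ (q - Suc i) * w ^ i) \<in> V"
        by (intro ring_set_sum[OF ring] V_intros(3,7) wV zV)
      show "w ^ q - z ^ q = (w - z) * (\<Sum>i<q. z ^ (q - Suc i) * w ^ i)" by (rule power_diff_sumr2)
    qed
    have "w ^ q - z ^ q \<in> M" unfolding u(2) using z(2) u(1) by (rule M_mult)
    then have "(w ^ q - z ^ q) - (w ^ q - 1) \<in> M"
      by (rule M_diff) (use M_uminus[OF x0(2)] in \<open>simp add: wq t_def\<close>)
    then have "1 - z ^ q \<in> M" by (simp add: algebra_simps)
    moreover have "1 - z ^ q \<in> C" using z(1) by (intro C_intros)
    ultimately have "1 - z ^ q = 0" using const_in_M by blast
    then show ?thesis by simp
  qed
  then have zF: "z \<in> F" by (rule mu)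
  have "w \<in> vclosure F"
  proof (rule vclosure_hensel[OF F])
    show "poly_over (vclosure F) P" unfolding P_def using tG
      by (intro poly_over_diff[OF RG] poly_over_monom[OF RG] poly_over_const[OF RG] ring_set_1[OF RG])
    show "poly_over V P" unfolding P_def using tV
      by (intro poly_over_diff[OF ring] poly_over_monom[OF ring] poly_over_const[OF ring] V_intros(1))
    show "poly P w = 0" by (simp add: pP wq)
    show "poly (pderiv P) w \<notin> M"
    proof
      assume "poly (pderiv P) w \<in> M"
      then have "of_nat q * w ^ (q - 1) \<in> M" by (simp add: dP)
      then have "of_nat q \<in> M \<or> w ^ (q - 1) \<in> M" using V_intros(7)[OF wV] V_intros(8) by (intro M_prime)
      moreover have "of_nat q \<notin> M" using const_notin_M C_intros(8) q0 by blast
      moreover have "w ^ (q - 1) \<notin> M" using M_power_iff[OF wV, of "q - 1"] wM q by simp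
      ultimately show False by blast
    qed
    show "z \<in> vclosure F" using zF FG by blast
    show "z - w \<in> M" using M_uminus[OF z(2)] by simp
  qed (rule wA, rule wV)
  then have "w * s \<in> vclosure F" using s(1) FG by (intro ring_set_mult[OF RG]) auto
  then show ?thesis using s0 by (simp add: w_def)
qed

text \<open>The residue degree is at most the field degree: lifts of more than \<open>card B\<close>
  residues are dependent over S(c), and a normalized relation between them reduces to a nontrivial
  relation over S.\<close>

lemma residues_finite_dimensional:
  assumes S: "field_set S" "S \<subseteq> C" and F: "finext (adj S c) F"
  shows "\<exists>B. finite B \<and> B \<subseteq> residues F \<and> residues F \<subseteq> lspan S B"
proof -
  obtain B where B: "finite B" "F \<subseteq> lspan (adj S c) B" using F unfolding finext_def by blast
  have W: "field_set (adj S c)" using F by (rule finext_base)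
  show ?thesis
  proof (rule lspan_finite_basis[OF S(1), of _ "card B"])
    fix I assume I: "I \<subseteq> residues F" "finite I" "card I > card B"
    have "\<exists>u. u \<in> F \<and> u - a \<in> M" if "a \<in> I" for a using I that unfolding residues_def by blast
    then obtain u where u: "\<And>a. a \<in> I \<Longrightarrow> u a \<in> F" "\<And>a. a \<in> I \<Longrightarrow> u a - a \<in> M" by metis
    have aC: "a \<in> C" if "a \<in> I" for a using I that unfolding residues_def by blast
    have uV: "u a \<in> V" if "a \<in> I" for a
      using V_intros(4)[OF M_in_V[OF u(2)[OF that]], of a] aC[OF that] CV by auto
    have "\<exists>w. (\<forall>a\<in>I. w a \<in> adj S c) \<and> (\<exists>a\<in>I. w a \<noteq> 0) \<and> (\<Sum>a\<in>I. w a * u a) = 0"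
      by (rule lspan_dependent[OF W B(1) I(2,3)]) (use u(1) B(2) in auto)
    then obtain w where w: "\<forall>a\<in>I. w a \<in> adj S c" "\<exists>a\<in>I. w a \<noteq> 0" "(\<Sum>a\<in>I. w a * u a) = 0"
      by (elim exE conjE)
    have "\<exists>k\<in>I. \<exists>w'. w' k = 1 \<and> (\<forall>i\<in>I. w' i \<in> adj S c \<inter> V) \<and> (\<Sum>i\<in>I. w' i * u i) = 0"
      by (rule normalized_relation[OF W I(2) _ w(2,3)]) (use w(1) in auto)
    then obtain k w' where w': "k \<in> I" "w' k = 1" "\<forall>i\<in>I. w' i \<in> adj S c \<inter> V" "(\<Sum>a\<in>I. w' a * u a) = 0"
      by (elim bexE exE conjE)
    then have w'3: "w' a \<in> adj S c \<and> w' a \<in> V" if "a \<in> I" for a using that by blast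
    have "\<exists>t. t \<in> S \<and> w' a - t \<in> M" if "a \<in> I" for a using adj_residue[OF S] w'3[OF that] by blast
    then obtain t where t: "\<And>a. a \<in> I \<Longrightarrow> t a \<in> S" "\<And>a. a \<in> I \<Longrightarrow> w' a - t a \<in> M" by metis
    have "(\<Sum>a\<in>I. t a * a) = - (\<Sum>a\<in>I. (w' a - t a) * a + w' a * (u a - a))"
      using w'(4) by (simp add: algebra_simps sum.distrib sum_subtractf sum_negf)
    also have "\<dots> \<in> M"
      using t(2) u(2) w'3 aC CV by (intro M_uminus M_sum M_add M_mult M_mult') auto
    finally have "(\<Sum>a\<in>I. t a * a) \<in> M" .
    moreover have "(\<Sum>a\<in>I. t a * a) \<in> C" using t(1) S(2) aC by (intro ring_set_sum[OF RC] C_intros) auto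
    ultimately have "(\<Sum>a\<in>I. t a * a) = 0" using const_in_M by blast
    moreover have "t k \<noteq> 0" using t(2)[OF w'(1)] w'(2) one_notin_M by auto
    ultimately show "\<exists>a. (\<forall>b\<in>I. a b \<in> S) \<and> (\<exists>b\<in>I. a b \<noteq> 0) \<and> (\<Sum>b\<in>I. a b * b) = 0"
      using t(1) w'(1) by blast
  qed
qed

text \<open>A relation for y over C(c) is a linear dependence over C among the products c^j y^i.
  These lie in the closure, so \<open>vclosure_dependent\<close> replaces it by a dependence over
  the residues of F, with the same bound on the degree in y.\<close>

lemma vclosure_algdeg:
  assumes F: "field_set F" "F \<subseteq> Alg" "c \<in> F" and L: "residues F \<subseteq> vclosure F"
    and y: "y \<in> vclosure F" "y \<in> algdeg (adj C c) d"
    and E: "field_set E" "residues F \<subseteq> E" "c \<in> E"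
  shows "y \<in> algdeg E d"
proof -
  note RG = field_setD[OF vclosure_field[OF F(1,2)]]
  note RE = field_setD[OF E(1)]
  have cG: "c \<in> vclosure F" using F vclosure_subset by blast
  obtain P where P: "\<And>i. poly_over C (P i)" "\<exists>i\<le>d. poly (P i) c \<noteq> 0" "(\<Sum>i\<le>d. poly (P i) c * y ^ i) = 0"
    using algdeg_adj_clear[OF RC y(2)] by blast
  define m where "m = Max ((\<lambda>i. degree (P i)) ` {..d})"
  have dm: "degree (P i) \<le> m" if "i \<le> d" for i unfolding m_def using that by (intro Max_ge) auto
  have Pc: "poly (P i) c = (\<Sum>j\<le>m. coeff (P i) j * c ^ j)" if "i \<le> d" for i
    unfolding poly_altdef using dm[OF that] by (intro sum.mono_neutral_left) (auto simp: coeff_eq_0)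
  let ?I = "{..d} \<times> {..m}"
  let ?u = "\<lambda>(i, j). c ^ j * y ^ i" and ?g = "\<lambda>(i, j). coeff (P i) j"
  have swap: "(\<Sum>k\<in>?I. h k * ?u k) = (\<Sum>i\<le>d. (\<Sum>j\<le>m. h (i, j) * c ^ j) * y ^ i)" for h
    by (simp add: sum.cartesian_product sum_distrib_right case_prod_beta mult.assoc)
  have "(\<Sum>k\<in>?I. ?g k * ?u k) = (\<Sum>i\<le>d. poly (P i) c * y ^ i)"
    unfolding swap by (rule sum.cong) (auto simp: Pc)
  then have s0: "(\<Sum>k\<in>?I. ?g k * ?u k) = 0" using P(3) by simp
  obtain i where i: "i \<le> d" "poly (P i) c \<noteq> 0" using P(2) by blast
  have "\<exists>k\<in>?I. ?g k \<noteq> 0"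
  proof (rule ccontr)
    assume "\<not> ?thesis"
    then have "\<And>j. j \<le> m \<Longrightarrow> coeff (P i) j = 0" using i(1) by auto
    then show False using i Pc[OF i(1)] by simp
  qed
  moreover have "?g k \<in> C" for k using P(1) unfolding poly_over_def by (cases k) auto
  moreover have "?u k \<in> vclosure F" for k
    using cG y(1) ring_set_mult[OF RG] ring_set_power[OF RG] by (cases k) auto
  ultimately have "\<exists>l. (\<forall>k\<in>?I. l k \<in> residues F) \<and> (\<exists>k\<in>?I. l k \<noteq> 0) \<and> (\<Sum>k\<in>?I. l k * ?u k) = 0"
    by (intro vclosure_dependent[OF F(1,2) L, of ?I ?u ?g] s0) simp_all
  then obtain l where l: "\<forall>k\<in>?I. l k \<in> residues F" "\<exists>k\<in>?I. l k \<noteq> 0" "(\<Sum>k\<in>?I. l k * ?u k) = 0"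
    by (elim exE conjE)
  define a where "a i = (\<Sum>j\<le>m. l (i, j) * c ^ j)" for i
  obtain i0 j0 where ij: "i0 \<le> d" "j0 \<le> m" "l (i0, j0) \<noteq> 0" using l(2) by auto
  \<comment> \<open>Grouped by powers of y the relation is nontrivial because c is transcendental
    over C.\<close>
  have "a i0 \<noteq> 0"
  proof
    assume "a i0 = 0"
    define Q where "Q = (\<Sum>j\<le>m. monom (l (i0, j)) j)"
    have cQ: "coeff Q j = (if j \<le> m then l (i0, j) else 0)" for j by (simp add: Q_def coeff_sum sum.delta)
    have "Q \<noteq> 0" using cQ[of j0] ij by auto
    moreover have "poly_over C Q" unfolding poly_over_def cQ using l(1) ij C_intros(2) by (auto simp: residues_def)
    moreover have "poly Q c = 0" using \<open>a i0 = 0\<close> by (simp add: a_def Q_def poly_sum poly_monom)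
    ultimately show False using trans unfolding algover_def by blast
  qed
  moreover have "a i \<in> E" if "i \<le> d" for i unfolding a_def
    using l(1) that E by (intro ring_set_sum[OF RE] ring_set_mult[OF RE] ring_set_power[OF RE]) auto
  moreover have "(\<Sum>i\<le>d. a i * y ^ i) = 0" using l(3) unfolding swap a_def .
  ultimately show ?thesis using ij(1) by (intro algdegI_sum[OF RE, of d a]) auto
qed

text \<open>K' is the intersection of K with the closure of one finite extension F of \<rat>(c). F
  contains \<beta>, the q-th roots of unity, s and the finitely many preimages that may not be small
  yet; all later preimages then lie in the closure. Degrees over \<rat>(c) are bounded on K' because
  they are bounded over C(c) and the residues of F are finite over \<rat>.\<close>

lemma descent:
  assumes char0: "\<And>n. n > 0 \<Longrightarrow> (of_nat n :: 'a) \<noteq> 0" and alg: "C \<subseteq> algover \<int>"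
    and q: "q \<ge> 2" and s: "s ^ q = - c" and \<beta>: "\<beta> \<in> Alg"
    and K: "field_set K" "c \<in> K" "\<beta> \<in> K" "\<And>y. y \<in> K \<Longrightarrow> y \<in> Alg \<Longrightarrow> y \<in> algdeg (adj C c) d"
  shows "\<exists>K' D. field_set K' \<and> D > 0 \<and> c \<in> K' \<and> \<beta> \<in> K' \<and> K' \<subseteq> algdeg (adj \<int> c) D \<and> K' \<subseteq> K \<and>
    (\<forall>n A r. (\<forall>x\<in>#A. (unicrit q c ^^ n) x = \<beta>) \<and> r \<in> K' \<and> (\<Prod>x\<in>#A. r - x) \<in> K \<longrightarrow> (\<Prod>x\<in>#A. r - x) \<in> K')"
proof -
  \<comment> \<open>The prime field \<rat>.\<close>
  define S where "S = adj \<int> (0 :: 'a)"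
  have S: "field_set S" unfolding S_def using Ints_ring_set by (rule adj_field_set)
  have ZC: "\<int> \<subseteq> C" using ring_set_of_int[OF RC] by (auto elim: Ints_cases)
  have ZS: "\<int> \<subseteq> S" unfolding S_def using Ints_ring_set by (rule adj_base)
  have SC: "S \<subseteq> C" unfolding S_def using C ZC C_intros(2) by (rule adj_least)
  define F0 where "F0 = adj S c"
  have F0: "field_set F0" unfolding F0_def using field_setD[OF S] by (rule adj_field_set)
  have SF0: "S \<subseteq> F0" "c \<in> F0" unfolding F0_def using adj_base[OF field_setD[OF S]] adj_gen[OF field_setD[OF S]] by auto
  have F0A: "F0 \<subseteq> adj C c" unfolding F0_def using SC by (rule adj_mono)
  have F0Z: "F0 \<subseteq> adj \<int> c"
  proof -
    have Zc: "field_set (adj \<int> c)" using Ints_ring_set by (rule adj_field_set)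
    have "S \<subseteq> adj \<int> c" unfolding S_def
      using Zc adj_base[OF Ints_ring_set] ring_set_0[OF field_setD[OF Zc]] by (rule adj_least)
    then show ?thesis unfolding F0_def using Zc adj_gen[OF Ints_ring_set] by (intro adj_least)
  qed
  have CF0: "C \<subseteq> algover F0" using alg algover_mono ZS SF0(1) by (metis subset_trans subset_iff)
  have finext_Alg: "G \<subseteq> Alg" if "finext F0 G" for G
  proof
    fix y assume "y \<in> G"
    then have "y \<in> algover F0" using finext_bounded[OF that] algdeg_algover by blast
    then show "y \<in> Alg" using F0A algover_mono by blast
  qed
  obtain e where e: "\<beta> \<in> algdeg (adj C c) e" using \<beta> algover_algdeg by blast
  obtain P where P: "\<And>i. poly_over C (P i)" "\<exists>i\<le>e. poly (P i) c \<noteq> 0" "(\<Sum>i\<le>e. poly (P i) c * \<beta> ^ i) = 0"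
    using algdeg_adj_clear[OF RC e] by blast
  \<comment> \<open>An equation for \<beta> over C(c) involves finitely many constants, all
    algebraic over \<rat>; they are adjoined before \<beta>.\<close>
  define Z0 where "Z0 = (\<Union>i\<le>e. coeff (P i) ` {..degree (P i)})"
  have "Z0 \<subseteq> algover F0" using P(1) CF0 unfolding Z0_def poly_over_def by blast
  then obtain F1 where F1: "finext F0 F1" "Z0 \<subseteq> F1"
    using finext_adjoin[OF _ finext_refl[OF F0], of Z0] by (auto simp: Z0_def)
  have f1: "field_set F1" "c \<in> F1" using finext_field[OF F1(1)] finext_subset[OF F1(1)] SF0(2) by auto
  have "\<beta> \<in> algdeg F1 e"
  proof (rule algdegI_sum[OF field_setD[OF f1(1)] _ P(2,3)])
    fix i assume "i \<le> e"
    have "coeff (P i) j \<in> F1" for j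
    proof (cases "j \<le> degree (P i)")
      case True then show ?thesis using F1(2) \<open>i \<le> e\<close> unfolding Z0_def by blast
    next
      case False then show ?thesis using ring_set_0[OF field_setD[OF f1(1)]] by (simp add: coeff_eq_0)
    qed
    then show "poly (P i) c \<in> F1" using poly_in_ring_set[OF field_setD[OF f1(1)] _ f1(2)] unfolding poly_over_def by blast
  qed
  then obtain F2 where F2: "finext F1 F2" "\<beta> \<in> F2" using finext_adjoin_one[OF f1(1)] algdeg_algover by blast
  have f2: "field_set F2" "c \<in> F2" "finext F0 F2"
    using finext_field[OF F2(1)] finext_subset[OF F2(1)] f1(2) finext_trans[OF F1(1) F2(1)] by auto
  obtain N where N: "\<And>x. (unicrit q c ^^ N) x = \<beta> \<Longrightarrow> x * \<pi> \<in> M"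
    using preimages_eventually_small[OF q \<beta>] by blast
  \<comment> \<open>The q-th roots of unity are written as preimages of 1 under x^q, and s is later
    read as a preimage of 0 under x^q + c, so that one lemma on preimages shows all of Z to be
    algebraic.\<close>
  define Z where "Z = {z. (unicrit q 0 ^^ 1) z = 1} \<union> {s} \<union> (\<Union>j\<le>N. {x. (unicrit q c ^^ j) x = \<beta>})"
  have q0: "q > 0" using q by simp
  have "finite Z" unfolding Z_def using finite_unicrit_preimages[OF q0] by blast
  moreover have "Z \<subseteq> algover F2"
  proof
    fix z assume "z \<in> Z"
    then consider "(unicrit q 0 ^^ 1) z = 1" | "(unicrit q c ^^ 1) z = 0" | j where "(unicrit q c ^^ j) z = \<beta>"
      unfolding Z_def using s by force
    then show "z \<in> algover F2"
    proof cases
      case 1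
      then show ?thesis
        using ring_set_0[OF field_setD[OF f2(1)]] ring_set_1[OF field_setD[OF f2(1)]] q0
        by (rule unicrit_preimage_algover[OF f2(1), rotated 3])
    next
      case 2
      then show ?thesis using f2(2) ring_set_0[OF field_setD[OF f2(1)]] q0
        by (rule unicrit_preimage_algover[OF f2(1), rotated 3])
    next
      case 3
      then show ?thesis using f2(2) F2(2) q0
        by (rule unicrit_preimage_algover[OF f2(1), rotated 3])
    qed
  qed
  ultimately obtain F where F: "finext F0 F" "F2 \<subseteq> F" "Z \<subseteq> F"
    using finext_adjoin[OF _ f2(3), of Z] by blast
  have f: "field_set F" "F \<subseteq> Alg" "c \<in> F" "\<beta> \<in> F"
    using finext_field[OF F(1)] finext_Alg[OF F(1)] f2(2) F2(2) F(2) by auto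
  note G = vclosure_field[OF f(1,2)]
  note RG = field_setD[OF G]
  have FG: "F \<subseteq> vclosure F" using f(2) by (rule vclosure_subset)
  have L: "residues F \<subseteq> vclosure F" using residues_in_vclosure[OF f(1,2) alg char0] .
  \<comment> \<open>Smallness is part of the induction because \<open>preimage_in_vclosure\<close>
    asks for it at the preceding point; up to index N the preimages were put into Z instead.\<close>
  have pre: "x \<in> vclosure F \<and> (n \<ge> N \<longrightarrow> x * \<pi> \<in> M)" if "(unicrit q c ^^ n) x = \<beta>" for n x
    using that
  proof (induction n arbitrary: x)
    case 0
    then show ?case using f(4) FG N[of x] by auto
  next
    case (Suc n)
    define x0 where "x0 = x ^ q + c"
    have "(unicrit q c ^^ n) x0 = \<beta>" using Suc.prems unfolding x0_def by (simp only: funpow_Suc_right o_apply)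
    then have IH: "x0 \<in> vclosure F" "n \<ge> N \<Longrightarrow> x0 * \<pi> \<in> M" using Suc.IH by auto
    show ?case
    proof (cases "n \<ge> N")
      case True
      have mu: "z \<in> F" if "z ^ q = 1" for z using that F(3) unfolding Z_def by auto
      have sF: "s \<in> F" using F(3) unfolding Z_def by blast
      have "x \<in> vclosure F"
        using preimage_in_vclosure[OF f(1,2) q char0[OF q0] sF s mu IH(1) IH(2)[OF True] x0_def[symmetric]] .
      moreover have "x * \<pi> \<in> M" using preimage_small_step[OF q x0_def[symmetric] IH(2)[OF True]] .
      ultimately show ?thesis by blast
    next
      case False
      then have "Suc n \<in> {..N}" by simp
      then have "x \<in> Z" using Suc.prems unfolding Z_def by blast
      moreover have "x * \<pi> \<in> M" if "Suc n \<ge> N"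
      proof -
        have "Suc n = N" using that False by simp
        then show ?thesis using N Suc.prems by blast
      qed
      ultimately show ?thesis using F(3) FG by blast
    qed
  qed
  obtain B where B: "finite B" "B \<subseteq> residues F" "residues F \<subseteq> lspan S B"
    using residues_finite_dimensional[OF S SC F(1)[unfolded F0_def]] by blast
  have "B \<subseteq> algover F0" using B(2) CF0 unfolding residues_def by blast
  \<comment> \<open>A finite basis of the residues over \<rat> places all of them in one finite
    extension of \<rat>(c), so that degree bounds over E become degree bounds over
    \<rat>(c).\<close>
  then obtain E where E: "finext F0 E" "B \<subseteq> E" using finext_adjoin[OF B(1) finext_refl[OF F0]] by blast
  have fE: "field_set E" "c \<in> E" "S \<subseteq> E" using finext_field[OF E(1)] finext_subset[OF E(1)] SF0 by auto
  have LE: "residues F \<subseteq> E"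
  proof
    fix a assume "a \<in> residues F"
    then obtain t where t: "\<And>b. b \<in> B \<Longrightarrow> t b \<in> S" "a = (\<Sum>b\<in>B. t b * b)" using B(3) lspanE[of a S B] by blast
    show "a \<in> E" unfolding t(2) using t(1) fE E(2)
      by (intro ring_set_sum[OF field_setD] ring_set_mult[OF field_setD]) auto
  qed
  obtain e' where e': "\<And>d y. y \<in> algdeg E d \<Longrightarrow> y \<in> algdeg F0 (e' * d)" using finext_algdeg[OF E(1)] by blast
  define K' where "K' = K \<inter> vclosure F"
  have "K' \<subseteq> algdeg (adj \<int> c) (Suc (e' * d))"
  proof
    fix y assume y: "y \<in> K'"
    then have "y \<in> algdeg (adj C c) d" using K(4) vclosure_in_Alg unfolding K'_def by blast
    then have "y \<in> algdeg E d"
      using vclosure_algdeg[OF f(1,2,3) L _ _ fE(1) LE fE(2)] y unfolding K'_def by blast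
    then have "y \<in> algdeg F0 (e' * d)" by (rule e')
    then show "y \<in> algdeg (adj \<int> c) (Suc (e' * d))" using F0Z by (rule algdeg_mono) simp
  qed
  moreover have "field_set K'" unfolding K'_def using K(1) G by (rule field_set_Int)
  moreover have "K' \<subseteq> K" unfolding K'_def by blast
  moreover have "c \<in> K'" "\<beta> \<in> K'" using K f FG unfolding K'_def by auto
  moreover have "(\<Prod>x\<in>#A. r - x) \<in> K'"
    if "\<forall>x\<in>#A. (unicrit q c ^^ n) x = \<beta>" "r \<in> K'" "(\<Prod>x\<in>#A. r - x) \<in> K" for n A r
    using that pre[of n] unfolding K'_def
    by (auto intro!: ring_set_prod_mset[OF RG] ring_set_diff[OF RG])
  ultimately show ?thesis by (intro exI[of _ K'] exI[of _ "Suc (e' * d)"]) auto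
qed

end

section \<open>Factors of iterates\<close>

lemma algover_closed:
  fixes C :: "'a::field set"
  assumes C: "field_set C" and closed: "\<And>P. poly_over C P \<Longrightarrow> degree P > 0 \<Longrightarrow> \<exists>a\<in>C. poly P a = 0"
  shows "algover C = C"
proof
  have "poly_over C P \<Longrightarrow> P \<noteq> 0 \<Longrightarrow> poly P y = 0 \<Longrightarrow> y \<in> C" for P y
  proof (induction "degree P" arbitrary: P rule: less_induct)
    case less
    have "degree P \<noteq> 0"
    proof
      assume "degree P = 0"
      then obtain b where "P = [:b:]" by (rule degree_eq_zeroE)
      then show False using less.prems by simp
    qed
    then obtain a where a: "a \<in> C" "poly P a = 0" using closed less.prems(1) by blast
    define R where "R = synthetic_div P a"
    have PR: "P = [:- a, 1:] * R" unfolding R_def using synthetic_div_correct'[of a P] a(2) by simp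
    have RC: "poly_over C R" unfolding R_def
      using less.prems(1) a(1) by (rule poly_over_synthetic_div[OF field_setD[OF C]])
    have R0: "R \<noteq> 0" using PR less.prems(2) by auto
    have dR: "degree R < degree P" unfolding R_def using \<open>degree P \<noteq> 0\<close> by (simp add: degree_synthetic_div)
    have "poly P y = (y - a) * poly R y" by (subst PR) (simp add: algebra_simps)
    then have "y = a \<or> poly R y = 0" using less.prems(3) by simp
    then show ?case using a(1) less.hyps[OF dR RC R0] by blast
  qed
  then show "algover C \<subseteq> C" unfolding algover_def by blast
qed (rule algover_superset[OF C])

text \<open>At the chosen place \<beta> has a pole while F, and with it c, is integral. Bounded
  denominators are known only for elements algebraic over F(\<beta>), so K is cut down to these. No
  factor is lost, since all preimages of \<beta> are algebraic over F(\<beta>).\<close>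

lemma transcendental_factor_bound:
  fixes K :: "'a::field set"
  assumes K: "field_set K" "F \<subseteq> K" "\<beta> \<in> K" and F: "field_set F" "c \<in> F" and \<beta>: "\<beta> \<notin> algover F"
    and d: "\<And>y. y \<in> K \<Longrightarrow> y \<in> algover (adj F \<beta>) \<Longrightarrow> y \<in> algdeg (adj F \<beta>) d" and q: "q > 0"
  shows "\<exists>N. \<forall>n A. A \<noteq> {#} \<and> (\<forall>x\<in>#A. (unicrit q c ^^ n) x = \<beta>) \<and> (\<forall>r\<in>K. (\<Prod>x\<in>#A. r - x) \<in> K)
           \<longrightarrow> q ^ n \<le> N * size A"
proof -
  obtain V where "pole_place V F \<beta>" using pole_place_exists[OF F(1) \<beta>] by blast
  then interpret pole_place V F \<beta> .
  define K' where "K' = K \<inter> algover (adj F \<beta>)"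
  have K': "field_set K'" unfolding K'_def using K(1) Alg_field by (rule field_set_Int)
  have \<beta>K: "\<beta> \<in> K'" unfolding K'_def using K(3) c_in_Alg by blast
  have disc: "discrete_on (inverse \<beta>) (Suc d) K'"
    unfolding discrete_on_def
  proof (intro ballI impI)
    fix y assume y: "y \<in> K'" "y \<noteq> 0"
    then have "y \<in> algdeg (adj F \<beta>) (Suc d)" using d algdeg_mono[of y _ d _ "Suc d"] unfolding K'_def by auto
    then show "\<exists>i j. 1 \<le> i \<and> i \<le> Suc d \<and> vassoc V (y ^ i) (inverse \<beta> powi j)"
      using discrete_Alg[of "Suc d"] y(2) unfolding discrete_on_def by blast
  qed
  have cV': "c \<in> V" using F(2) CV by blast
  obtain N where N: "\<And>n A. A \<noteq> {#} \<and> (\<forall>x\<in>#A. (unicrit q c ^^ n) x = \<beta>) \<and> (\<forall>r\<in>K'. (\<Prod>x\<in>#A. r - x) \<in> K')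
           \<Longrightarrow> q ^ n \<le> N * size A"
    using escaping_factor_bound[OF pi_in_M pi_nonzero K' disc _ cV' \<beta>K cV q] by blast
  have "q ^ n \<le> N * size A"
    if A: "A \<noteq> {#}" "\<forall>x\<in>#A. (unicrit q c ^^ n) x = \<beta>" "\<forall>r\<in>K. (\<Prod>x\<in>#A. r - x) \<in> K" for n A
  proof -
    have "x \<in> algover (adj F \<beta>)" if "x \<in># A" for x
      using A(2) that adj_base[OF RC] F(2) adj_gen[OF RC] by (intro unicrit_preimage_algover[OF adj_field _ _ q, where n = n]) auto
    then have "(\<Prod>x\<in>#A. r - x) \<in> K'" if "r \<in> K'" for r
      using that A(3) unfolding K'_def by (auto intro!: ring_set_prod_mset[OF RAlg] ring_set_diff[OF RAlg])
    then show ?thesis using N A by blast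
  qed
  then show ?thesis by blast
qed

text \<open>Bounded degree over \<rat>(c), where the valuation has integer values and finitely many
  residues, supplies both inputs of the local bounds: denominators at most D, and equations of
  degree at most D for the residues.\<close>

lemma arithmetic_factor_bound:
  fixes K :: "'a::field set" and p :: nat
  assumes K: "field_set K" "c \<in> K" "\<beta> \<in> K" "K \<subseteq> algdeg (adj \<int> c) D" "D > 0"
    and tr: "\<And>P :: int poly. P \<noteq> 0 \<Longrightarrow> poly (map_poly of_int P) c \<noteq> 0"
    and p: "Factorial_Ring.prime p" and q: "q = p ^ r" "r \<ge> 1"
    and \<beta>: "\<And>m. m \<ge> 1 \<Longrightarrow> (unicrit q c ^^ m) \<beta> \<noteq> \<beta>"
  shows "\<exists>N. \<forall>n A. A \<noteq> {#} \<and> (\<forall>x\<in>#A. (unicrit q c ^^ n) x = \<beta>) \<and> (\<forall>r\<in>K. (\<Prod>x\<in>#A. r - x) \<in> K)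
           \<longrightarrow> q ^ n \<le> N * size A"
proof -
  obtain V where V: "valuation_ring V" "of_nat p \<in> vmax V" "c \<in> V"
    "\<And>w. w \<in> adj \<int> c \<Longrightarrow> w \<noteq> 0 \<Longrightarrow> \<exists>j. vassoc V w (of_nat p powi j)"
    "\<And>w. w \<in> adj \<int> c \<Longrightarrow> w \<in> V \<Longrightarrow> \<exists>t\<in>{0..<int p}. w - of_int t \<in> vmax V"
    using padic_valuation_ring_exists[OF p tr] by blast
  interpret valuation_ring V by (rule V)
  have p0: "(of_nat p :: 'a) \<noteq> 0" using tr[of "[:int p:]"] prime_gt_0_nat[OF p] by (simp add: map_poly_pCons)
  have q0: "q > 0" using q prime_gt_0_nat[OF p] by simp
  have W: "field_set (adj \<int> c)" using Ints_ring_set by (rule adj_field_set)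
  have disc: "discrete_on (of_nat p) D K"
    using discrete_on_algdeg[of "of_nat p" "adj \<int> c" D, OF p0 V(4)] K(4) unfolding discrete_on_def by blast
  show ?thesis
  proof (cases "\<beta> \<in> V")
    case False
    show ?thesis by (rule escaping_factor_bound[OF V(2) p0 K(1) disc K(5) V(3) K(3) False q0])
  next
    case True
    have orbit: "(unicrit q c ^^ n) \<beta> \<in> K" for n
      using field_setD[OF K(1)] K(2,3) by (rule unicrit_in_ring_set)
    have "\<exists>t. (\<exists>i\<le>D. t i = 1) \<and> (\<forall>i. t i \<in> {0..<int p}) \<and> (\<Sum>i\<le>D. of_int (t i) * y ^ i) \<in> vmax V"
      if y: "y \<in> K" "y \<in> V" for y
    proof -
      obtain P where P: "P \<noteq> 0" "poly_over (adj \<int> c) P" "degree P \<le> D" "poly P y = 0"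
        using K(4) y(1) unfolding algdeg_def by blast
      have s: "(\<Sum>i\<in>{..D}. coeff P i * y ^ i) = 0"
        using P(3,4) unfolding poly_altdef
        by (subst sum.mono_neutral_right[of "{..D}" "{..degree P}"]) (auto simp: coeff_eq_0)
      have "\<exists>k\<in>{..D}. \<exists>w. w k = 1 \<and> (\<forall>i\<in>{..D}. w i \<in> adj \<int> c \<inter> V) \<and> (\<Sum>i\<in>{..D}. w i * y ^ i) = 0"
        using P by (intro normalized_relation[OF W _ _ _ s]) (auto simp: poly_over_def intro!: bexI[of _ "degree P"])
      then obtain k w where w: "k \<in> {..D}" "w k = 1" "\<forall>i\<in>{..D}. w i \<in> adj \<int> c \<inter> V" "(\<Sum>i\<in>{..D}. w i * y ^ i) = 0"
        by (elim bexE exE conjE)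
      have "\<exists>t. t \<in> {0..<int p} \<and> w i - of_int t \<in> vmax V" if "i \<le> D" for i
        using V(5)[of "w i"] w(3) that by auto
      then obtain t where t: "\<And>i. i \<le> D \<Longrightarrow> t i \<in> {0..<int p}" "\<And>i. i \<le> D \<Longrightarrow> w i - of_int (t i) \<in> vmax V" by metis
      \<comment> \<open>The equation for y reduced modulo M. Its entry at k is set to 1, the residue
        of \<open>w k\<close>, as a witness that it is nonzero modulo p.\<close>
      define t' where "t' i = (if i \<le> D then if i = k then 1 else t i else 0)" for i
      have t'm: "w i - of_int (t' i) \<in> vmax V" if "i \<le> D" for i
        using that t(2) w(2) zero_in_M by (auto simp: t'_def)
      have "(\<Sum>i\<le>D. of_int (t' i) * y ^ i) = - (\<Sum>i\<le>D. (w i - of_int (t' i)) * y ^ i)"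
        using w(4) by (simp add: left_diff_distrib sum_subtractf)
      also have "\<dots> \<in> vmax V" using t'm y(2) V_intros(7) by (intro M_uminus M_sum M_mult) auto
      finally have "(\<Sum>i\<le>D. of_int (t' i) * y ^ i) \<in> vmax V" .
      moreover have "t' k = 1" "k \<le> D" using w(1) by (auto simp: t'_def)
      moreover have "t' i \<in> {0..<int p}" for i using t(1)[of i] prime_gt_1_nat[OF p] by (auto simp: t'_def)
      ultimately show ?thesis by (intro exI[of _ t'] conjI exI[of _ k]) auto
    qed
    then obtain m where m: "m \<ge> 1" "(unicrit q c ^^ m) \<beta> - \<beta> \<in> vmax V"
      using unicrit_periodic_residue[OF p V(2) q V(3) True orbit, of D] by blast
    show ?thesis
      by (rule periodic_residue_factor_bound[OF p V(2) p0 q K(1) disc K(5) V(3) K(2) True K(3) m(1,2) \<beta>[OF m(1)]])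
  qed
qed

text \<open>In both cases the bounded degrees come from
  \<open>finitely_generated_bounded_degree\<close>, applied over F(\<beta>) or over F = C(c). A q-th
  root of -c exists because the ambient field is algebraically closed.\<close>

lemma unicrit_factor_bound:
  fixes K C :: "'a::alg_closed_field set" and p :: nat
  assumes C: "field_set C" and closed: "\<And>P. poly_over C P \<Longrightarrow> degree P > 0 \<Longrightarrow> \<exists>a\<in>C. poly P a = 0"
    and alg: "C \<subseteq> algover \<int>" and char0: "\<And>n. n > 0 \<Longrightarrow> (of_nat n :: 'a) \<noteq> 0"
    and K: "field_set K" "C \<subseteq> K" "K \<subseteq> adjs C ys" and c: "c \<in> K" "c \<notin> C" and \<beta>: "\<beta> \<in> K"
    and p: "Factorial_Ring.prime p" and q: "q = p ^ r" "r \<ge> 1"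
    and np: "\<And>m. m \<ge> 1 \<Longrightarrow> (unicrit q c ^^ m) \<beta> \<noteq> \<beta>"
  shows "\<exists>N. \<forall>n A. A \<noteq> {#} \<and> (\<forall>x\<in>#A. (unicrit q c ^^ n) x = \<beta>) \<and> (\<forall>r\<in>K. (\<Prod>x\<in>#A. r - x) \<in> K)
           \<longrightarrow> q ^ n \<le> N * size A"
proof -
  have q2: "q \<ge> 2"
    using q prime_ge_2_nat[OF p] power_increasing[of 1 r p] by simp
  have trc: "c \<notin> algover C" using algover_closed[OF C closed] c(2) by blast
  define F where "F = adj C c"
  have F: "field_set F" unfolding F_def using field_setD[OF C] by (rule adj_field_set)
  have CF: "C \<subseteq> F" "c \<in> F" unfolding F_def using adj_base[OF field_setD[OF C]] adj_gen[OF field_setD[OF C]] by auto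
  have bounded: "\<exists>d. \<forall>y\<in>K. y \<in> algover G \<longrightarrow> y \<in> algdeg G d" if "field_set G" "C \<subseteq> G" for G
    using finitely_generated_bounded_degree[OF that(1), of ys] adjs_mono[OF that(2), of ys] K(3) by blast
  show ?thesis
  proof (cases "\<beta> \<in> algover F")
    case False
    have FK: "F \<subseteq> K" unfolding F_def using K(1,2) c(1) by (rule adj_least)
    have Fb: "field_set (adj F \<beta>)" "C \<subseteq> adj F \<beta>"
      using adj_field_set[OF field_setD[OF F]] adj_base[OF field_setD[OF F]] CF(1) by auto
    obtain d where d: "\<And>y. y \<in> K \<Longrightarrow> y \<in> algover (adj F \<beta>) \<Longrightarrow> y \<in> algdeg (adj F \<beta>) d"
      using bounded[OF Fb] by blast
    show ?thesis using transcendental_factor_bound[OF K(1) FK \<beta> F CF(2) False d] q2 by simp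
  next
    case True
    obtain d where d: "\<And>y. y \<in> K \<Longrightarrow> y \<in> algover F \<Longrightarrow> y \<in> algdeg F d"
      using bounded[OF F CF(1)] by blast
    obtain V where "pole_place V C c" using pole_place_exists[OF C trc] by blast
    then interpret place_at_infinity V C c
      using closed trc by (simp add: place_at_infinity_def place_at_infinity_axioms_def)
    obtain s where s: "s ^ q = - c" using nth_root_exists[of q "- c"] q2 by auto
    have "\<exists>K' D. field_set K' \<and> D > 0 \<and> c \<in> K' \<and> \<beta> \<in> K' \<and> K' \<subseteq> algdeg (adj \<int> c) D \<and> K' \<subseteq> K \<and>
      (\<forall>n A r. (\<forall>x\<in>#A. (unicrit q c ^^ n) x = \<beta>) \<and> r \<in> K' \<and> (\<Prod>x\<in>#A. r - x) \<in> K \<longrightarrow> (\<Prod>x\<in>#A. r - x) \<in> K')"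
      by (rule descent[OF _ alg q2 s True[unfolded F_def] K(1) c(1) \<beta>]) (use char0 d[unfolded F_def] in auto)
    then obtain K' D where K': "field_set K'" "D > 0" "c \<in> K'" "\<beta> \<in> K'" "K' \<subseteq> algdeg (adj \<int> c) D"
      and K'K: "K' \<subseteq> K" and prods: "\<forall>n A r. (\<forall>x\<in>#A. (unicrit q c ^^ n) x = \<beta>) \<and> r \<in> K' \<and>
        (\<Prod>x\<in>#A. r - x) \<in> K \<longrightarrow> (\<Prod>x\<in>#A. r - x) \<in> K'"
      by (elim exE conjE)
    have tr: "poly (map_poly of_int P) c \<noteq> 0" if "P \<noteq> 0" for P :: "int poly"
    proof
      assume a: "poly (map_poly of_int P) c = 0"
      have inj: "(of_int z :: 'a) = 0 \<longleftrightarrow> z = 0" for z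
        using char0[of "nat z"] char0[of "nat (- z)"] by (cases z rule: int_cases2) auto
      have "map_poly of_int P \<noteq> (0 :: 'a poly)"
        using that inj by (metis coeff_map_poly of_int_0 leading_coeff_0_iff coeff_0)
      moreover have "poly_over C (map_poly of_int P)"
        using ring_set_of_int[OF field_setD[OF C]] by (simp add: poly_over_def coeff_map_poly)
      ultimately show False using a trc unfolding algover_def by blast
    qed
    obtain N where N: "\<And>n A. A \<noteq> {#} \<and> (\<forall>x\<in>#A. (unicrit q c ^^ n) x = \<beta>) \<and> (\<forall>r\<in>K'. (\<Prod>x\<in>#A. r - x) \<in> K')
           \<Longrightarrow> q ^ n \<le> N * size A"
      using arithmetic_factor_bound[OF K'(1,3,4,5,2) tr p q np] by blast
    have "q ^ n \<le> N * size A"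
      if A: "A \<noteq> {#}" "\<forall>x\<in>#A. (unicrit q c ^^ n) x = \<beta>" "\<forall>r\<in>K. (\<Prod>x\<in>#A. r - x) \<in> K" for n A
    proof -
      have "\<forall>r\<in>K'. (\<Prod>x\<in>#A. r - x) \<in> K'" using A(2,3) prods K'K by blast
      then show ?thesis using N A(1,2) by blast
    qed
    then show ?thesis by blast
  qed
qed

section \<open>Eventual stability\<close>

lemma ring_map_to_ac: "ring_map to_ac"
  by (simp add: ring_map_def)

lemma iter_poly_unicrit: "iter_poly (monom 1 q + [:c:]) n = iter_unicrit q c n"
proof -
  have "pcompose (monom 1 k) P = P ^ k" for k and P :: "'a poly"
    by (induction k) (auto simp: monom_Suc pcompose_pCons monom_0)
  then have e: "pcompose (monom 1 q + [:c:]) = (\<lambda>P. P ^ q + [:c:])"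
    by (intro ext) (simp add: pcompose_add)
  show ?thesis unfolding iter_poly_def iter_unicrit_def e ..
qed

lemma map_poly_iter_unicrit:
  assumes h: "ring_map h" shows "map_poly h (iter_unicrit q c n) = iter_unicrit q (h c) n"
proof (induction n)
  case 0
  then show ?case by (simp add: iter_unicrit_def map_poly_pCons ring_map_0[OF h] ring_map_1[OF h])
next
  case (Suc n)
  have p: "map_poly h (P ^ k) = map_poly h P ^ k" for P k
    by (induction k) (auto simp: map_poly_mult[OF h] ring_map_1[OF h])
  have e: "iter_unicrit q a (Suc n) = iter_unicrit q a n ^ q + [:a:]" for a :: 'a by (simp add: iter_unicrit_def)
  have e': "iter_unicrit q a (Suc n) = iter_unicrit q a n ^ q + [:a:]" for a :: 'b by (simp add: iter_unicrit_def)
  show ?case unfolding e e' map_poly_add[OF h] p Suc by (simp add: map_poly_pCons ring_map_0[OF h])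
qed

lemma map_to_ac_adjs: "to_ac ` adjs F ys \<subseteq> adjs (to_ac ` F) (map to_ac ys)"
proof (induction ys arbitrary: F)
  case (Cons y ys)
  have "to_ac ` adj F y \<subseteq> adj (to_ac ` F) (to_ac y)"
  proof
    fix z assume "z \<in> to_ac ` adj F y"
    then obtain w where w: "w \<in> adj F y" "z = to_ac w" by blast
    obtain P Q where PQ: "poly_over F P" "poly_over F Q" "poly Q y \<noteq> 0" "w = poly P y / poly Q y"
      using w(1) by (rule adjE)
    have "poly_over (to_ac ` F) (map_poly to_ac P)" "poly_over (to_ac ` F) (map_poly to_ac Q)"
      using PQ by (auto simp: poly_over_def coeff_map_poly)
    moreover have "z = poly (map_poly to_ac P) (to_ac y) / poly (map_poly to_ac Q) (to_ac y)"
      using w(2) PQ by (simp add: poly_map_poly[OF ring_map_to_ac])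
    moreover have "poly (map_poly to_ac Q) (to_ac y) \<noteq> 0"
      using PQ(3) by (simp add: poly_map_poly[OF ring_map_to_ac])
    ultimately show "z \<in> adj (to_ac ` F) (to_ac y)" using adjI by metis
  qed
  then have "adjs (to_ac ` adj F y) (map to_ac ys) \<subseteq> adjs (adj (to_ac ` F) (to_ac y)) (map to_ac ys)"
    by (rule adjs_mono)
  then show ?case using Cons.IH[of "adj F y"] by simp
qed simp

lemma range_ring_map_field:
  assumes h: "ring_map (h :: 'a::field \<Rightarrow> 'b::field)" shows "field_set (range h)"
proof -
  have inv: "inverse (h x) \<in> range h" for x
  proof (cases "x = 0")
    case True then show ?thesis by (metis inverse_zero rangeI ring_map_0[OF h])
  next
    case False
    then have "h x * h (inverse x) = 1" by (simp add: ring_map_mult[OF h, symmetric] ring_map_1[OF h])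
    then show ?thesis by (metis inverse_unique rangeI)
  qed
  show ?thesis unfolding field_set_def ring_set_def
    using inv by (auto simp: ring_map_diff[OF h, symmetric] ring_map_mult[OF h, symmetric] intro: range_eqI[of _ _ 1] simp: ring_map_1[OF h])
qed

lemma ring_map_nonzero:
  assumes h: "ring_map (h :: 'a::field \<Rightarrow> 'b::field)" and "x \<noteq> 0" shows "h x \<noteq> 0"
proof
  assume "h x = 0"
  then have "h (x * inverse x) = 0" by (simp add: ring_map_mult[OF h])
  then show False using assms by (simp add: ring_map_1[OF h])
qed

text \<open>A rational polynomial is one over \<open>adj \<int> 0\<close>. Clearing denominators
  there gives integer polynomials evaluated at 0, that is, integers.\<close>

lemma algebraic_number_algover_Ints: "(t :: rat alg_closure) \<in> algover \<int>"
proof -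
  obtain P :: "rat poly" where P: "P \<noteq> 0" "poly (map_poly to_ac P) t = 0" using alg_closure_algebraic .
  let ?S = "adj \<int> (0 :: rat alg_closure)"
  have "to_ac x \<in> ?S" for x :: rat
  proof -
    obtain a b where "quotient_of x = (a, b)" by force
    then have x: "x = of_int a / of_int b" by (rule quotient_of_div)
    have "field_set ?S" using Ints_ring_set by (rule adj_field_set)
    moreover have "of_int a \<in> ?S" "of_int b \<in> ?S" by (auto intro: subsetD[OF adj_base[OF Ints_ring_set]])
    ultimately have "of_int a / of_int b \<in> ?S" by (rule field_set_divide)
    then show ?thesis by (simp add: x)
  qed
  then have "poly_over ?S (map_poly to_ac P)" by (simp add: poly_over_def coeff_map_poly)
  moreover have "map_poly to_ac P \<noteq> 0"
    using P(1) by (metis coeff_map_poly coeff_0 leading_coeff_0_iff to_ac_0 to_ac_eq_0_iff)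
  ultimately have "t \<in> algdeg ?S (degree (map_poly to_ac P))" using P(2) unfolding algdeg_def by blast
  then obtain R where R: "\<And>i. poly_over \<int> (R i)" "\<exists>i\<le>degree (map_poly to_ac P). poly (R i) 0 \<noteq> 0"
    "(\<Sum>i\<le>degree (map_poly to_ac P). poly (R i) 0 * t ^ i) = 0"
    using algdeg_adj_clear[OF Ints_ring_set] by blast
  have "t \<in> algdeg \<int> (degree (map_poly to_ac P))"
    using R poly_in_ring_set[OF Ints_ring_set R(1)] by (intro algdegI_sum[OF Ints_ring_set, of _ "\<lambda>i. poly (R i) 0"]) auto
  then show ?thesis by (rule algdeg_algover)
qed

text \<open>A factor g satisfies q^n \<le> N deg g. Summed over a factorization, whose degrees add
  up to q^n, this leaves at most N factors, counted with multiplicity.\<close>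

theorem unicritical_eventually_stable:
  fixes \<iota> :: "rat alg_closure \<Rightarrow> 'k::field" and p :: nat
  assumes \<iota>: "ring_map \<iota>" and fg: "adjs (range \<iota>) ys = UNIV" and c: "c \<notin> range \<iota>"
    and p: "Factorial_Ring.prime p" and q: "q = p ^ r" "r \<ge> 1"
    and \<beta>: "\<not> periodic_point (monom 1 q + [:c:]) \<beta>"
  shows "eventually_stable (monom 1 q + [:c:]) \<beta>"
proof -
  define h where "h x = to_ac (\<iota> x)" for x
  define K where "K = range (to_ac :: 'k \<Rightarrow> _)"
  note ac = ring_map_to_ac
  have h: "ring_map h" using \<iota> by (simp add: ring_map_def h_def)
  have q0: "q > 0" using q prime_gt_0_nat[OF p] by simp
  have Ch: "range h = to_ac ` range \<iota>" by (auto simp: h_def)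
  have C: "field_set (range h)" using h by (rule range_ring_map_field)
  have K: "field_set K" unfolding K_def using ac by (rule range_ring_map_field)
  \<comment> \<open>The root has to be found among the constants, so the polynomial is pulled back
    to the algebraic numbers.\<close>
  have closed: "\<exists>a\<in>range h. poly P a = 0" if P: "poly_over (range h) P" "degree P > 0" for P
  proof -
    have "\<forall>i. \<exists>t. coeff P i = h t" using P(1) unfolding poly_over_def by blast
    then obtain t where t: "\<And>i. coeff P i = h (t i)" by metis
    define P' where "P' = (\<Sum>i\<le>degree P. monom (t i) i)"
    have cP: "coeff P' i = (if i \<le> degree P then t i else 0)" for i by (simp add: P'_def coeff_sum sum.delta)
    have PP: "P = map_poly h P'"
      by (rule poly_eqI) (auto simp: coeff_map_poly ring_map_0[OF h] cP coeff_eq_0 t[symmetric])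
    have "t (degree P) \<noteq> 0" using t[of "degree P"] P(2) ring_map_0[OF h] by (metis degree_0 leading_coeff_0_iff less_irrefl)
    then have "degree P' > 0" using P(2) le_degree[of P' "degree P"] cP by auto
    then obtain a where "poly P' a = 0" using alg_closed_imp_poly_has_root by blast
    then have "poly P (h a) = 0" unfolding PP by (simp add: poly_map_poly[OF h] ring_map_0[OF h])
    then show ?thesis by blast
  qed
  have alg: "range h \<subseteq> algover \<int>"
  proof
    fix y assume "y \<in> range h"
    then obtain t where y: "y = h t" by blast
    obtain P where P: "P \<noteq> 0" "poly_over \<int> P" "poly P t = 0"
      using algebraic_number_algover_Ints[of t] unfolding algover_def by blast
    obtain Q :: "int poly" where Q: "P = map_poly of_int Q" using P(2) poly_over_Ints_iff by blast
    have hi: "h (of_int z) = of_int z" for z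
    proof -
      have "h (of_nat n) = of_nat n" for n
        by (induction n) (auto simp: ring_map_0[OF h] ring_map_1[OF h] ring_map_add[OF h])
      then show ?thesis by (cases z rule: int_cases2) (auto simp: ring_map_uminus[OF h])
    qed
    have "map_poly h P = map_poly of_int Q" unfolding Q
      by (rule poly_eqI) (simp add: coeff_map_poly ring_map_0[OF h] hi)
    then have "poly_over \<int> (map_poly h P)" using poly_over_Ints_iff by blast
    moreover have "map_poly h P \<noteq> 0"
      using P(1) ring_map_nonzero[OF h] by (metis coeff_map_poly coeff_0 leading_coeff_0_iff ring_map_0[OF h])
    moreover have "poly (map_poly h P) y = 0" unfolding y using P(3) by (simp add: poly_map_poly[OF h] ring_map_0[OF h])
    ultimately show "y \<in> algover \<int>" by (intro algoverI)
  qed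
  have char0: "(of_nat n :: 'k alg_closure) \<noteq> 0" if "n > 0" for n
  proof -
    have "h (of_nat n) = of_nat n"
      by (induction n) (auto simp: ring_map_0[OF h] ring_map_1[OF h] ring_map_add[OF h])
    then show ?thesis using ring_map_nonzero[OF h, of "of_nat n"] that by auto
  qed
  have Kfg: "K \<subseteq> adjs (range h) (map to_ac ys)"
    using map_to_ac_adjs[of "range \<iota>" ys] fg unfolding Ch K_def by simp
  have CK: "range h \<subseteq> K" by (auto simp: h_def K_def)
  have cC: "to_ac c \<notin> range h" using c by (auto simp: h_def)
  have iter: "(unicrit q (to_ac c) ^^ n) (to_ac x) = to_ac ((unicrit q c ^^ n) x)" for n x
    by (induction n) auto
  have np: "(unicrit q (to_ac c) ^^ m) (to_ac \<beta>) \<noteq> to_ac \<beta>" if "m \<ge> 1" for m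
    using \<beta> that unfolding periodic_point_def iter_poly_unicrit poly_iter_unicrit iter to_ac_eq_iff by blast
  obtain N where N: "\<And>n A. A \<noteq> {#} \<and> (\<forall>x\<in>#A. (unicrit q (to_ac c) ^^ n) x = to_ac \<beta>) \<and>
      (\<forall>r\<in>K. (\<Prod>x\<in>#A. r - x) \<in> K) \<Longrightarrow> q ^ n \<le> N * size A"
    using unicrit_factor_bound[OF C closed alg char0 K CK Kfg _ cC _ p q np] unfolding K_def by blast
  have "size A \<le> N"
    if A: "irreducible_factorization (iter_poly (monom 1 q + [:c:]) n - [:\<beta>:]) A" for n A
  proof -
    let ?P = "iter_unicrit q c n - [:\<beta>:]"
    have irr: "\<And>g. g \<in># A \<Longrightarrow> Factorial_Ring.irreducible g" and prod: "prod_mset A = ?P"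
      using A unfolding irreducible_factorization_def iter_poly_unicrit by auto
    have bound: "q ^ n \<le> N * degree g" if g: "g \<in># A" for g
    proof -
      have g0: "g \<noteq> 0" using irr[OF g] by auto
      have dg: "degree g > 0" using irr[OF g] is_unit_iff_degree[OF g0] by (auto simp: Factorial_Ring.irreducible_def)
      let ?g = "map_poly to_ac g"
      have lc: "lead_coeff ?g = to_ac (lead_coeff g)" "degree ?g = degree g" "?g \<noteq> 0"
        using g0 by (auto simp: coeff_map_poly degree_map_poly map_poly_eq_0_iff)
      \<comment> \<open>The roots of g with multiplicity, so that g is the product of its linear
        factors up to the leading coefficient.\<close>
      obtain S where S: "size S = degree g" "?g = smult (lead_coeff ?g) (\<Prod>x\<in>#S. [:-x, 1:])"
        using alg_closed_imp_factorization[OF lc(3)] lc(2) by auto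
      have ev: "poly ?g y = to_ac (lead_coeff g) * (\<Prod>x\<in>#S. y - x)" for y
        using arg_cong[OF S(2), of "\<lambda>P. poly P y"] lc(1) by (simp add: poly_prod_mset)
      have "S \<noteq> {#}" using S(1) dg by auto
      moreover have "(unicrit q (to_ac c) ^^ n) x = to_ac \<beta>" if "x \<in># S" for x
      proof -
        have "poly ?g x = 0" using that unfolding ev by (auto simp: prod_mset_zero_iff)
        moreover have "g dvd ?P" using g prod dvd_prod_mset by metis
        then obtain k where "?P = g * k" by blast
        then have "map_poly to_ac ?P = ?g * map_poly to_ac k" by (simp add: map_poly_mult[OF ac])
        ultimately have "poly (map_poly to_ac ?P) x = 0" by simp
        then show ?thesis
          by (simp add: map_poly_diff[OF ac] map_poly_iter_unicrit[OF ac] map_poly_pCons poly_iter_unicrit)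
      qed
      \<comment> \<open>Here it matters that g has coefficients in K: the product is the value at a
        point of K of g divided by its leading coefficient.\<close>
      moreover have "(\<Prod>x\<in>#S. y - x) \<in> K" if yK: "y \<in> K" for y
      proof -
        obtain y' where y': "y = to_ac y'" using yK unfolding K_def by blast
        have "(\<Prod>x\<in>#S. y - x) = poly ?g y / to_ac (lead_coeff g)" unfolding ev using g0 by simp
        also have "\<dots> = to_ac (poly g y' / lead_coeff g)" unfolding y' by (simp add: poly_map_poly[OF ac])
        finally show ?thesis unfolding K_def by blast
      qed
      ultimately show ?thesis using N[of S n] S(1) by auto
    qed
    have dP: "degree ?P = q ^ n"
    proof -
      have "degree [:\<beta>:] < degree (iter_unicrit q c n)" using iter_unicrit_monic[OF q0, of c n] q0 by simp
      then have "degree (iter_unicrit q c n + [:- \<beta>:]) = q ^ n"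
        using iter_unicrit_monic[OF q0, of c n] by (simp add: degree_add_eq_left)
      moreover have "?P = iter_unicrit q c n + [:- \<beta>:]"
        using diff_conv_add_uminus[of "iter_unicrit q c n" "[:\<beta>:]"] by (simp only: minus_pCons minus_zero)
      ultimately show ?thesis by (simp only:)
    qed
    have "\<forall>g\<in>#S. g \<noteq> 0 \<Longrightarrow> prod_mset S \<noteq> 0 \<and> degree (prod_mset S) = (\<Sum>g\<in>#S. degree g)" for S :: "'k poly multiset"
      by (induction S) (auto simp: degree_mult_eq)
    moreover have "\<forall>g\<in>#A. g \<noteq> 0" using irr unfolding Factorial_Ring.irreducible_def by blast
    ultimately have "degree ?P = (\<Sum>g\<in>#A. degree g)" using prod by metis
    have "size A * q ^ n \<le> (\<Sum>g\<in>#A. N * degree g)"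
      using bound by (induction A) (auto intro: add_mono)
    also have "\<dots> = N * (\<Sum>g\<in>#A. degree g)" by (simp add: sum_mset_distrib_left)
    also have "\<dots> = N * q ^ n" using \<open>degree ?P = (\<Sum>g\<in>#A. degree g)\<close> dP by simp
    finally show ?thesis using q0 by simp
  qed
  then show ?thesis unfolding eventually_stable_def by blast
qed

section \<open>The function field of a projective variety\<close>

lemma mp_eval_superset:
  assumes "finite S" "Poly_Mapping.keys F \<subseteq> S"
  shows "mp_eval F a = (\<Sum>m\<in>S. Poly_Mapping.lookup F m * (\<Prod>i\<in>UNIV. (a $ i) ^ Poly_Mapping.lookup m i))"
  unfolding mp_eval_def using assms
  by (intro sum.mono_neutral_left) (auto simp: not_in_keys_iff_lookup_eq_zero)

lemma mp_eval_add: "mp_eval (F + G) a = mp_eval F a + mp_eval G a"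
proof -
  let ?S = "Poly_Mapping.keys F \<union> Poly_Mapping.keys G"
  have "finite ?S" by simp
  then have "mp_eval H a = (\<Sum>m\<in>?S. Poly_Mapping.lookup H m * (\<Prod>i\<in>UNIV. (a $ i) ^ Poly_Mapping.lookup m i))"
    if "Poly_Mapping.keys H \<subseteq> ?S" for H using mp_eval_superset that by blast
  then show ?thesis using keys_add[of F G] by (simp add: lookup_add distrib_right sum.distrib)
qed

lemma mp_eval_0 [simp]: "mp_eval 0 a = 0" by (simp add: mp_eval_def)

lemma mp_eval_sum: "mp_eval (sum u I) a = (\<Sum>i\<in>I. mp_eval (u i) a)"
  by (induction I rule: infinite_finite_induct) (auto simp: mp_eval_add)

lemma mp_eval_single: "mp_eval (Poly_Mapping.single m t) a = t * (\<Prod>i\<in>UNIV. (a $ i) ^ Poly_Mapping.lookup m i)"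
  using mp_eval_superset[of "{m}" "Poly_Mapping.single m t" a] by simp

lemma mp_sum_monomials: "F = (\<Sum>m\<in>Poly_Mapping.keys F. Poly_Mapping.single m (Poly_Mapping.lookup F m))"
proof (rule poly_mapping_eqI)
  fix k
  have "Poly_Mapping.lookup (\<Sum>m\<in>Poly_Mapping.keys F. Poly_Mapping.single m (Poly_Mapping.lookup F m)) k =
      (\<Sum>m\<in>Poly_Mapping.keys F. if m = k then Poly_Mapping.lookup F m else 0)"
    unfolding lookup_sum by (intro sum.cong) (auto simp: lookup_single when_def)
  also have "\<dots> = Poly_Mapping.lookup F k" by (simp add: sum.delta' not_in_keys_iff_lookup_eq_zero)
  finally show "Poly_Mapping.lookup F k = Poly_Mapping.lookup (\<Sum>m\<in>Poly_Mapping.keys F. Poly_Mapping.single m (Poly_Mapping.lookup F m)) k" by simp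
qed

lemma mp_eval_mult: "mp_eval (F * G) a = mp_eval F a * mp_eval G a"
proof -
  let ?e = "\<lambda>m. \<Prod>i\<in>UNIV. (a $ i) ^ Poly_Mapping.lookup m i"
  have e: "?e (m + n) = ?e m * ?e n" for m n
    by (simp add: lookup_add power_add prod.distrib)
  have "F * G = (\<Sum>m\<in>Poly_Mapping.keys F. \<Sum>n\<in>Poly_Mapping.keys G.
      Poly_Mapping.single (m + n) (Poly_Mapping.lookup F m * Poly_Mapping.lookup G n))"
    by (subst mp_sum_monomials[of F], subst mp_sum_monomials[of G]) (simp add: sum_product mult_single)
  then have "mp_eval (F * G) a = (\<Sum>m\<in>Poly_Mapping.keys F. \<Sum>n\<in>Poly_Mapping.keys G.
      (Poly_Mapping.lookup F m * Poly_Mapping.lookup G n) * ?e (m + n))"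
    by (simp add: mp_eval_sum mp_eval_single)
  also have "\<dots> = (\<Sum>m\<in>Poly_Mapping.keys F. \<Sum>n\<in>Poly_Mapping.keys G. (Poly_Mapping.lookup F m * ?e m) * (Poly_Mapping.lookup G n * ?e n))"
    by (intro sum.cong refl) (simp only: e mult_ac)
  also have "\<dots> = mp_eval F a * mp_eval G a" by (simp add: mp_eval_def sum_product)
  finally show ?thesis .
qed

lemma mp_eval_1 [simp]: "mp_eval 1 a = 1"
  using mp_eval_single[of 0 1 a] by simp

lemma mp_eval_uminus: "mp_eval (- F) a = - mp_eval F a"
  using mp_eval_add[of F "- F" a] by (simp add: eq_neg_iff_add_eq_0 add.commute)

lemma mp_eval_diff: "mp_eval (F - G) a = mp_eval F a - mp_eval G a"
  using mp_eval_add[of F "- G" a] by (simp add: mp_eval_uminus)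

lemma mp_eval_power: "mp_eval (F ^ k) a = mp_eval F a ^ k"
  by (induction k) (auto simp: mp_eval_mult)

lemma mp_eval_const: "mp_eval (mp_const t) a = t"
  by (simp add: mp_const_def mp_eval_single)

lemma homogeneous_add: "homogeneous d F \<Longrightarrow> homogeneous d G \<Longrightarrow> homogeneous d (F + G)"
  unfolding homogeneous_def using keys_add[of F G] by blast

lemma homogeneous_uminus: "homogeneous d F \<Longrightarrow> homogeneous d (- F)"
  unfolding homogeneous_def by (simp add: in_keys_iff)

lemma homogeneous_diff: "homogeneous d F \<Longrightarrow> homogeneous d G \<Longrightarrow> homogeneous d (F - G)"
  using homogeneous_add[of d F "- G"] homogeneous_uminus[of d G] by simp

lemma homogeneous_mult:
  assumes "homogeneous d F" "homogeneous e G" shows "homogeneous (d + e) (F * G)"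
  unfolding homogeneous_def
proof
  fix m assume "m \<in> Poly_Mapping.keys (F * G)"
  then obtain k l where "m = k + l" "k \<in> Poly_Mapping.keys F" "l \<in> Poly_Mapping.keys G"
    using keys_mult[of F G] by blast
  then show "(\<Sum>i\<in>UNIV. Poly_Mapping.lookup m i) = d + e"
    using assms unfolding homogeneous_def by (simp add: lookup_add sum.distrib)
qed

lemma homogeneous_const: "homogeneous 0 (mp_const t)"
  by (auto simp: homogeneous_def mp_const_def split: if_splits)

lemma homogeneous_1: "homogeneous 0 1"
  using homogeneous_const[of 1] by (simp add: mp_const_def)

lemma homogeneous_power: "homogeneous d F \<Longrightarrow> homogeneous (k * d) (F ^ k)"
  by (induction k) (auto simp: homogeneous_1 intro: homogeneous_mult)

definition mp_var :: "'n \<Rightarrow> ('a::comm_ring_1, 'n::finite) mpoly" where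
  "mp_var i = Poly_Mapping.single (Poly_Mapping.single i 1) 1"

lemma homogeneous_var: "homogeneous 1 (mp_var i)"
proof -
  have "(\<Sum>j\<in>UNIV. Poly_Mapping.lookup (Poly_Mapping.single i (1::nat)) j) = (\<Sum>j\<in>UNIV. if j = i then 1 else 0)"
    by (intro sum.cong) (auto simp: lookup_single when_def)
  then show ?thesis by (auto simp: homogeneous_def mp_var_def split: if_splits)
qed

lemma mp_eval_var: "mp_eval (mp_var i) a = a $ i"
proof -
  have "(\<Prod>j\<in>UNIV. (a $ j) ^ Poly_Mapping.lookup (Poly_Mapping.single i 1) j) = (\<Prod>j\<in>UNIV. if j = i then a $ j else 1)"
    by (intro prod.cong) (auto simp: lookup_single when_def)
  then show ?thesis by (simp add: mp_var_def mp_eval_single prod.delta)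
qed

section \<open>Rational functions on an irreducible variety\<close>

locale proj_variety =
  fixes V :: "('a::field^'n::finite) set"
  assumes V: "projective_variety V"
begin

lemma closed_hypersurface_section:
  assumes "homogeneous d F" shows "proj_closed {a \<in> V. mp_eval F a = 0}"
proof -
  obtain S where S: "\<forall>F\<in>S. \<exists>d. homogeneous d F" "V = {a. a \<noteq> 0 \<and> (\<forall>F\<in>S. mp_eval F a = 0)}"
    using V unfolding projective_variety_def proj_closed_def by blast
  show ?thesis unfolding proj_closed_def
    using S assms by (intro exI[of _ "insert F S"]) auto
qed

text \<open>V is the union of two sections, which are closed because F and G are homogeneous; by
  irreducibility one of them is all of V. This makes products of denominators admissible and
  \<open>rat_rel\<close> transitive.\<close>

lemma vanishing_ideal_prime:
  assumes "homogeneous d F" "homogeneous e G" "\<And>a. a \<in> V \<Longrightarrow> mp_eval F a * mp_eval G a = 0"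
  shows "(\<forall>a\<in>V. mp_eval F a = 0) \<or> (\<forall>a\<in>V. mp_eval G a = 0)"
proof -
  have "V = {a \<in> V. mp_eval F a = 0} \<union> {a \<in> V. mp_eval G a = 0}" using assms(3) by auto
  then have "V = {a \<in> V. mp_eval F a = 0} \<or> V = {a \<in> V. mp_eval G a = 0}"
    using V closed_hypersurface_section assms(1,2) unfolding projective_variety_def by blast
  then show ?thesis by blast
qed

lemma rat_fracsI: "homogeneous d g \<Longrightarrow> homogeneous d h \<Longrightarrow> a \<in> V \<Longrightarrow> mp_eval h a \<noteq> 0 \<Longrightarrow> (g, h) \<in> rat_fracs V"
  unfolding rat_fracs_def by blast

lemma rat_fracsE:
  assumes "(g, h) \<in> rat_fracs V"
  obtains d a where "homogeneous d g" "homogeneous d h" "a \<in> V" "mp_eval h a \<noteq> 0"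
  using assms unfolding rat_fracs_def by blast

lemma rat_fracs_denominator:
  assumes "(g, h) \<in> rat_fracs V" "(g', h') \<in> rat_fracs V"
  shows "\<exists>a\<in>V. mp_eval (h * h') a \<noteq> 0"
proof -
  obtain d a where 1: "homogeneous d h" "a \<in> V" "mp_eval h a \<noteq> 0" using assms(1) by (rule rat_fracsE)
  obtain d' a' where 2: "homogeneous d' h'" "a' \<in> V" "mp_eval h' a' \<noteq> 0" using assms(2) by (rule rat_fracsE)
  show ?thesis
  proof (rule ccontr)
    assume "\<not> ?thesis"
    then show False using vanishing_ideal_prime[OF 1(1) 2(1)] 1 2 by (auto simp: mp_eval_mult)
  qed
qed

lemma rat_fracs_mult:
  assumes "(g, h) \<in> rat_fracs V" "(g', h') \<in> rat_fracs V" shows "(g * g', h * h') \<in> rat_fracs V"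
proof -
  obtain d where 1: "homogeneous d g" "homogeneous d h" using assms(1) by (rule rat_fracsE)
  obtain d' where 2: "homogeneous d' g'" "homogeneous d' h'" using assms(2) by (rule rat_fracsE)
  obtain a where "a \<in> V" "mp_eval (h * h') a \<noteq> 0" using rat_fracs_denominator[OF assms] by blast
  then show ?thesis using homogeneous_mult[OF 1(1) 2(1)] homogeneous_mult[OF 1(2) 2(2)] by (intro rat_fracsI)
qed

lemma rat_fracs_add:
  assumes "(g, h) \<in> rat_fracs V" "(g', h') \<in> rat_fracs V" shows "(g * h' + g' * h, h * h') \<in> rat_fracs V"
proof -
  obtain d where 1: "homogeneous d g" "homogeneous d h" using assms(1) by (rule rat_fracsE)
  obtain d' where 2: "homogeneous d' g'" "homogeneous d' h'" using assms(2) by (rule rat_fracsE)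
  obtain a where "a \<in> V" "mp_eval (h * h') a \<noteq> 0" using rat_fracs_denominator[OF assms] by blast
  moreover have "homogeneous (d + d') (g * h' + g' * h)"
    using homogeneous_mult[OF 1(1) 2(2)] homogeneous_mult[OF 2(1) 1(2)] by (intro homogeneous_add) (simp_all add: add.commute)
  ultimately show ?thesis using homogeneous_mult[OF 1(2) 2(2)] by (intro rat_fracsI)
qed

lemma rat_rel_iff: "((g, h), (g', h')) \<in> rat_rel V \<longleftrightarrow> (g, h) \<in> rat_fracs V \<and> (g', h') \<in> rat_fracs V \<and>
    (\<forall>a\<in>V. mp_eval g a * mp_eval h' a = mp_eval g' a * mp_eval h a)"
  by (simp add: rat_rel_def mp_eval_diff mp_eval_mult)

lemma rat_rel_equiv: "equiv (rat_fracs V) (rat_rel V)"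
proof (rule equivI)
  show "rat_rel V \<subseteq> rat_fracs V \<times> rat_fracs V" by (auto simp: rat_rel_def)
  show "refl_on (rat_fracs V) (rat_rel V)" by (auto simp: refl_on_def rat_rel_iff)
  show "sym (rat_rel V)"
  proof (rule symI)
    fix x y assume "(x, y) \<in> rat_rel V"
    then show "(y, x) \<in> rat_rel V" by (cases x, cases y) (simp add: rat_rel_iff)
  qed
  show "Relation.trans (rat_rel V)"
  proof (rule transI)
    fix x y z assume xyz: "(x, y) \<in> rat_rel V" "(y, z) \<in> rat_rel V"
    obtain g h g' h' g'' h'' where e: "x = (g, h)" "y = (g', h')" "z = (g'', h'')" by (metis surj_pair)
    have fr: "(g, h) \<in> rat_fracs V" "(g', h') \<in> rat_fracs V" "(g'', h'') \<in> rat_fracs V"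
      and r: "\<And>a. a \<in> V \<Longrightarrow> mp_eval g a * mp_eval h' a = mp_eval g' a * mp_eval h a"
        "\<And>a. a \<in> V \<Longrightarrow> mp_eval g' a * mp_eval h'' a = mp_eval g'' a * mp_eval h' a"
      using xyz unfolding e rat_rel_iff by auto
    obtain d where 1: "homogeneous d g" "homogeneous d h" using fr(1) by (rule rat_fracsE)
    obtain d' a' where 2: "homogeneous d' h'" "a' \<in> V" "mp_eval h' a' \<noteq> 0" using fr(2) by (rule rat_fracsE)
    obtain d'' where 3: "homogeneous d'' g''" "homogeneous d'' h''" using fr(3) by (rule rat_fracsE)
    have hom: "homogeneous (d + d'') (g * h'' - g'' * h)"
      using homogeneous_mult[OF 1(1) 3(2)] homogeneous_mult[OF 3(1) 1(2)]
      by (intro homogeneous_diff) (simp_all add: add.commute)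
    \<comment> \<open>The middle denominator h' may vanish at some points of V, so it is cancelled
      by primality of the ideal and not pointwise.\<close>
    have "mp_eval h' a * mp_eval (g * h'' - g'' * h) a = 0" if "a \<in> V" for a
    proof -
      have "mp_eval h' a * (mp_eval g a * mp_eval h'' a - mp_eval g'' a * mp_eval h a) =
          (mp_eval g a * mp_eval h' a) * mp_eval h'' a - (mp_eval g'' a * mp_eval h' a) * mp_eval h a"
        by (simp add: algebra_simps)
      also have "\<dots> = 0" unfolding r(1)[OF that] r(2)[OF that, symmetric] by simp
      finally show ?thesis by (simp add: mp_eval_diff mp_eval_mult)
    qed
    then have "\<forall>a\<in>V. mp_eval (g * h'' - g'' * h) a = 0"
      using vanishing_ideal_prime[OF 2(1) hom] 2 by blast
    then show "(x, z) \<in> rat_rel V" unfolding e rat_rel_iff using fr by (simp add: mp_eval_diff mp_eval_mult)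
  qed
qed

definition rat_class :: "('a, 'n) mpoly \<Rightarrow> ('a, 'n) mpoly \<Rightarrow> (('a, 'n) mpoly \<times> ('a, 'n) mpoly) set" where
  "rat_class g h = rat_rel V `` {(g, h)}"

lemma rat_class_eq:
  assumes "(g, h) \<in> rat_fracs V" "(g', h') \<in> rat_fracs V"
    "\<And>a. a \<in> V \<Longrightarrow> mp_eval g a * mp_eval h' a = mp_eval g' a * mp_eval h a"
  shows "rat_class g h = rat_class g' h'"
  unfolding rat_class_def using assms by (intro equiv_class_eq[OF rat_rel_equiv]) (simp add: rat_rel_iff)

lemma rat_class_carrier: "(g, h) \<in> rat_fracs V \<Longrightarrow> rat_class g h \<in> carrier (function_field V)"
  by (simp add: function_field_def rat_class_def quotientI)

lemma carrier_rat_class: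
  assumes "A \<in> carrier (function_field V)" obtains g h where "(g, h) \<in> rat_fracs V" "A = rat_class g h"
proof -
  have "A \<in> rat_fracs V // rat_rel V" using assms by (simp add: function_field_def)
  then obtain x where "x \<in> rat_fracs V" "A = rat_rel V `` {x}" by (rule quotientE)
  then show thesis using that[of "fst x" "snd x"] by (simp add: rat_class_def)
qed

lemma rat_class_mult:
  assumes x: "(g, h) \<in> rat_fracs V" "(g', h') \<in> rat_fracs V"
  shows "rat_class g h \<otimes>\<^bsub>function_field V\<^esub> rat_class g' h' = rat_class (g * g') (h * h')"
proof -
  have cong: "congruent2 (rat_rel V) (rat_rel V) (\<lambda>(g, h) (g', h'). rat_rel V `` {(g * g', h * h')})"
  proof (rule congruent2I')
    fix y1 z1 y2 z2 assume r: "(y1, z1) \<in> rat_rel V" "(y2, z2) \<in> rat_rel V"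
    obtain g1 h1 k1 l1 g2 h2 k2 l2 where e: "y1 = (g1, h1)" "z1 = (k1, l1)" "y2 = (g2, h2)" "z2 = (k2, l2)"
      by (metis surj_pair)
    have a: "(p1 * p2) * (s1 * s2) = (r1 * r2) * (q1 * q2)"
      if "p1 * s1 = r1 * q1" "p2 * s2 = r2 * q2" for p1 q1 r1 s1 p2 q2 r2 s2 :: 'a
    proof -
      have "(p1 * p2) * (s1 * s2) = (p1 * s1) * (p2 * s2)" by (simp only: mult_ac)
      then show ?thesis unfolding that by (simp only: mult_ac)
    qed
    have fr: "(g1, h1) \<in> rat_fracs V" "(g2, h2) \<in> rat_fracs V" "(k1, l1) \<in> rat_fracs V" "(k2, l2) \<in> rat_fracs V"
      and ev: "\<forall>a\<in>V. mp_eval g1 a * mp_eval l1 a = mp_eval k1 a * mp_eval h1 a"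
        "\<forall>a\<in>V. mp_eval g2 a * mp_eval l2 a = mp_eval k2 a * mp_eval h2 a"
      using r unfolding e rat_rel_iff by auto
    have "rat_class (g1 * g2) (h1 * h2) = rat_class (k1 * k2) (l1 * l2)"
    proof (rule rat_class_eq[OF rat_fracs_mult[OF fr(1,2)] rat_fracs_mult[OF fr(3,4)]])
      fix x assume "x \<in> V"
      then show "mp_eval (g1 * g2) x * mp_eval (l1 * l2) x = mp_eval (k1 * k2) x * mp_eval (h1 * h2) x"
        unfolding mp_eval_mult using ev by (intro a) blast+
    qed
    then show "(\<lambda>(g, h) (g', h'). rat_rel V `` {(g * g', h * h')}) y1 y2 =
        (\<lambda>(g, h) (g', h'). rat_rel V `` {(g * g', h * h')}) z1 z2"
      unfolding e rat_class_def by simp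
  qed
  then show ?thesis
    using UN_equiv_class2[OF rat_rel_equiv rat_rel_equiv cong x]
    by (simp add: function_field_def rat_class_def case_prod_unfold)
qed

lemma rat_class_add:
  assumes x: "(g, h) \<in> rat_fracs V" "(g', h') \<in> rat_fracs V"
  shows "rat_class g h \<oplus>\<^bsub>function_field V\<^esub> rat_class g' h' = rat_class (g * h' + g' * h) (h * h')"
proof -
  have cong: "congruent2 (rat_rel V) (rat_rel V) (\<lambda>(g, h) (g', h'). rat_rel V `` {(g * h' + g' * h, h * h')})"
  proof (rule congruent2I')
    fix y1 z1 y2 z2 assume r: "(y1, z1) \<in> rat_rel V" "(y2, z2) \<in> rat_rel V"
    obtain g1 h1 k1 l1 g2 h2 k2 l2 where e: "y1 = (g1, h1)" "z1 = (k1, l1)" "y2 = (g2, h2)" "z2 = (k2, l2)"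
      by (metis surj_pair)
    have a: "(p1 * q2 + p2 * q1) * (s1 * s2) = (r1 * s2 + r2 * s1) * (q1 * q2)"
      if "p1 * s1 = r1 * q1" "p2 * s2 = r2 * q2" for p1 q1 r1 s1 p2 q2 r2 s2 :: 'a
    proof -
      have "(p1 * q2 + p2 * q1) * (s1 * s2) = (p1 * s1) * q2 * s2 + (p2 * s2) * q1 * s1" by (simp add: algebra_simps)
      then show ?thesis unfolding that by (simp add: algebra_simps)
    qed
    have fr: "(g1, h1) \<in> rat_fracs V" "(g2, h2) \<in> rat_fracs V" "(k1, l1) \<in> rat_fracs V" "(k2, l2) \<in> rat_fracs V"
      and ev: "\<forall>a\<in>V. mp_eval g1 a * mp_eval l1 a = mp_eval k1 a * mp_eval h1 a"
        "\<forall>a\<in>V. mp_eval g2 a * mp_eval l2 a = mp_eval k2 a * mp_eval h2 a"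
      using r unfolding e rat_rel_iff by auto
    have "rat_class (g1 * h2 + g2 * h1) (h1 * h2) = rat_class (k1 * l2 + k2 * l1) (l1 * l2)"
    proof (rule rat_class_eq[OF rat_fracs_add[OF fr(1,2)] rat_fracs_add[OF fr(3,4)]])
      fix x assume "x \<in> V"
      then show "mp_eval (g1 * h2 + g2 * h1) x * mp_eval (l1 * l2) x = mp_eval (k1 * l2 + k2 * l1) x * mp_eval (h1 * h2) x"
        unfolding mp_eval_mult mp_eval_add using ev by (intro a) blast+
    qed
    then show "(\<lambda>(g, h) (g', h'). rat_rel V `` {(g * h' + g' * h, h * h')}) y1 y2 =
        (\<lambda>(g, h) (g', h'). rat_rel V `` {(g * h' + g' * h, h * h')}) z1 z2"
      unfolding e rat_class_def by simp
  qed
  then show ?thesis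
    using UN_equiv_class2[OF rat_rel_equiv rat_rel_equiv cong x]
    by (simp add: function_field_def rat_class_def case_prod_unfold)
qed

context
  fixes \<phi> :: "(('a, 'n) mpoly \<times> ('a, 'n) mpoly) set \<Rightarrow> 'k::field"
  assumes \<phi>: "\<phi> \<in> ring_iso (function_field V) (ring_of_type_algebra :: 'k ring)"
begin

lemma phi_mult:
  assumes "(g, h) \<in> rat_fracs V" "(g', h') \<in> rat_fracs V"
  shows "\<phi> (rat_class (g * g') (h * h')) = \<phi> (rat_class g h) * \<phi> (rat_class g' h')"
  using \<phi> assms rat_class_carrier rat_class_mult[OF assms]
  by (force simp: ring_iso_def ring_hom_def ring_of_type_algebra_def)

lemma phi_add:
  assumes "(g, h) \<in> rat_fracs V" "(g', h') \<in> rat_fracs V"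
  shows "\<phi> (rat_class (g * h' + g' * h) (h * h')) = \<phi> (rat_class g h) + \<phi> (rat_class g' h')"
  using \<phi> assms rat_class_carrier rat_class_add[OF assms]
  by (force simp: ring_iso_def ring_hom_def ring_of_type_algebra_def)

lemma phi_one: "\<phi> (rat_class 1 1) = 1"
  using \<phi> by (simp add: ring_iso_def ring_hom_def ring_of_type_algebra_def function_field_def rat_class_def)

lemma phi_surj: "\<exists>g h. (g, h) \<in> rat_fracs V \<and> y = \<phi> (rat_class g h)"
proof -
  have "\<phi> ` carrier (function_field V) = UNIV"
    using \<phi> by (simp add: ring_iso_def bij_betw_def ring_of_type_algebra_def)
  then obtain A where "A \<in> carrier (function_field V)" "y = \<phi> A" by (metis UNIV_I imageE)
  then show ?thesis by (metis carrier_rat_class)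
qed

definition const_map :: "'a \<Rightarrow> 'k" where
  "const_map t = \<phi> (rat_class (mp_const t) 1)"

lemma const_fracs: "(mp_const t, 1) \<in> rat_fracs V"
proof -
  obtain a where "a \<in> V" using V unfolding projective_variety_def by blast
  then show ?thesis by (intro rat_fracsI[OF homogeneous_const homogeneous_1]) auto
qed

lemma const_map_ring_map: "ring_map const_map"
proof -
  have "const_map 1 = 1" using phi_one by (simp add: const_map_def mp_const_def)
  moreover have "const_map (t + u) = const_map t + const_map u" for t u
    using phi_add[OF const_fracs[of t] const_fracs[of u]] by (simp add: const_map_def mp_const_def single_add)
  moreover have "const_map (t * u) = const_map t * const_map u" for t u
    using phi_mult[OF const_fracs[of t] const_fracs[of u]] by (simp add: const_map_def mp_const_def mult_single)
  ultimately show ?thesis by (simp add: ring_map_def)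
qed

lemma range_const_map: "range const_map = \<phi> ` constant_functions V"
  by (auto simp: const_map_def constant_functions_def rat_class_def)

text \<open>Dehomogenize at a coordinate z that does not vanish identically on V: a form of degree k
  divided by z^k is a polynomial in the quotients x_i / z, and every g/h is a quotient of two such
  elements.\<close>

lemma function_field_finitely_generated: "\<exists>ys. adjs (range const_map) ys = UNIV"
proof -
  obtain a0 where a0: "a0 \<in> V" using V unfolding projective_variety_def by blast
  then have "a0 \<noteq> 0" using V unfolding projective_variety_def proj_closed_def by blast
  then obtain i0 where i0: "a0 $ i0 \<noteq> 0" by (auto simp: vec_eq_iff)
  let ?x = "mp_var :: 'n \<Rightarrow> ('a, 'n) mpoly" and ?z = "mp_var i0 :: ('a, 'n) mpoly"
  define Y where "Y i = \<phi> (rat_class (?x i) ?z)" for i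
  obtain ns :: "'n list" where ns: "set ns = UNIV" using finite_list[OF finite_class.finite_UNIV] by blast
  define L where "L = adjs (range const_map) (map Y ns)"
  have Cf: "field_set (range const_map)" using const_map_ring_map by (rule range_ring_map_field)
  have L: "field_set L" unfolding L_def using Cf by (rule adjs_field_set)
  note RL = field_setD[OF L]
  have sub: "range const_map \<subseteq> L" "\<And>i. Y i \<in> L"
    using adjs_superset[OF Cf, of "map Y ns"] ns unfolding L_def by auto
  have za: "mp_eval (?z ^ k) a0 \<noteq> 0" for k using i0 by (simp add: mp_eval_power mp_eval_var)
  have hz: "homogeneous k (?z ^ k)" for k using homogeneous_power[OF homogeneous_var, of k] by simp
  have fr: "(g, ?z ^ k) \<in> rat_fracs V" if "homogeneous k g" for g k
    using that hz a0 za by (rule rat_fracsI)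
  have frx: "(?x i ^ k, ?z ^ k) \<in> rat_fracs V" for i k
    using homogeneous_power[OF homogeneous_var, of k] by (intro fr) simp
  have Ypow: "\<phi> (rat_class (?x i ^ k) (?z ^ k)) = Y i ^ k" for i k
  proof (induction k)
    case 0 then show ?case using phi_one by simp
  next
    case (Suc k)
    show ?case using phi_mult[OF frx[of i 1] frx[of i k]] Suc by (simp add: Y_def)
  qed
  \<comment> \<open>The denominator is kept as a product of powers of z, matching
    \<open>phi_mult\<close> factor by factor; it is merged into the single power z^k only in
    \<open>mono\<close>.\<close>
  have prodx: "(\<Prod>i\<in>I. ?x i ^ k i, \<Prod>i\<in>I. ?z ^ k i) \<in> rat_fracs V \<and>
      \<phi> (rat_class (\<Prod>i\<in>I. ?x i ^ k i) (\<Prod>i\<in>I. ?z ^ k i)) = (\<Prod>i\<in>I. Y i ^ k i)"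
    if "finite I" for I :: "'n set" and k
    using that
  proof (induction I rule: finite_induct)
    case empty
    then show ?case using phi_one const_fracs[of 1] by (simp add: mp_const_def)
  next
    case (insert i I)
    then show ?case
      using rat_fracs_mult[OF frx[of i "k i"], of "\<Prod>i\<in>I. ?x i ^ k i" "\<Prod>i\<in>I. ?z ^ k i"]
        phi_mult[OF frx[of i "k i"], of "\<Prod>i\<in>I. ?x i ^ k i" "\<Prod>i\<in>I. ?z ^ k i"] Ypow by simp
  qed
  have mono: "\<phi> (rat_class (Poly_Mapping.single m t) (?z ^ k)) \<in> L" if m: "(\<Sum>i\<in>UNIV. Poly_Mapping.lookup m i) = k" for m t k
  proof -
    let ?X = "\<Prod>i\<in>UNIV. ?x i ^ Poly_Mapping.lookup m i" and ?Z = "\<Prod>i\<in>UNIV. ?z ^ Poly_Mapping.lookup m i"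
    have p: "(?X, ?Z) \<in> rat_fracs V" "\<phi> (rat_class ?X ?Z) = (\<Prod>i\<in>UNIV. Y i ^ Poly_Mapping.lookup m i)"
      using prodx[of UNIV "Poly_Mapping.lookup m"] by auto
    have ev_prod: "mp_eval (\<Prod>i\<in>I. u i) a = (\<Prod>i\<in>I. mp_eval (u i) a)" if "finite I" for I :: "'n set" and u :: "'n \<Rightarrow> ('a, 'n) mpoly" and a
      using that by (induction I rule: finite_induct) (auto simp: mp_eval_mult)
    have pw: "(\<Prod>i\<in>UNIV. (a $ i0) ^ Poly_Mapping.lookup m i) = (a $ i0) ^ k" for a :: "'a ^ 'n"
      using m by (simp add: power_sum[symmetric])
    have "homogeneous k (Poly_Mapping.single m t)" using m by (auto simp: homogeneous_def split: if_splits)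
    then have "rat_class (Poly_Mapping.single m t) (?z ^ k) = rat_class (mp_const t * ?X) (1 * ?Z)"
      using m by (intro rat_class_eq fr rat_fracs_mult const_fracs p(1))
        (simp_all add: mp_eval_single mp_eval_mult mp_eval_const ev_prod mp_eval_power mp_eval_var pw)
    then have "\<phi> (rat_class (Poly_Mapping.single m t) (?z ^ k)) = const_map t * (\<Prod>i\<in>UNIV. Y i ^ Poly_Mapping.lookup m i)"
      using phi_mult[OF const_fracs[of t] p(1)] p(2) by (simp add: const_map_def)
    then show ?thesis using sub by (auto intro!: ring_set_mult[OF RL] ring_set_prod[OF RL] ring_set_power[OF RL])
  qed
  have addL: "\<phi> (rat_class (g + g') (?z ^ k)) = \<phi> (rat_class g (?z ^ k)) + \<phi> (rat_class g' (?z ^ k))"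
    if "homogeneous k g" "homogeneous k g'" for g g' k
  proof -
    have "rat_class (g + g') (?z ^ k) = rat_class (g * ?z ^ k + g' * ?z ^ k) (?z ^ k * ?z ^ k)"
      using fr[OF homogeneous_add[OF that]] rat_fracs_add[OF fr[OF that(1)] fr[OF that(2)]]
      by (rule rat_class_eq) (simp add: mp_eval_add mp_eval_mult algebra_simps)
    then show ?thesis using phi_add[OF fr[OF that(1)] fr[OF that(2)]] by simp
  qed
  have sumL: "homogeneous k (\<Sum>m\<in>S. Poly_Mapping.single m (t m)) \<and>
      \<phi> (rat_class (\<Sum>m\<in>S. Poly_Mapping.single m (t m)) (?z ^ k)) \<in> L"
    if "finite S" "\<And>m. m \<in> S \<Longrightarrow> (\<Sum>i\<in>UNIV. Poly_Mapping.lookup m i) = k" for S and t :: "_ \<Rightarrow> 'a" and k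
    using that
  proof (induction S rule: finite_induct)
    case empty
    have "homogeneous k (Poly_Mapping.single 0 0 :: ('a, 'n) mpoly)" by (simp add: homogeneous_def)
    moreover have "rat_class 0 (?z ^ k) = rat_class (mp_const 0) 1"
      using fr[of k 0] const_fracs[of 0] by (intro rat_class_eq) (auto simp: homogeneous_def mp_const_def)
    moreover have "\<phi> (rat_class (mp_const 0) 1) \<in> L" using sub(1) unfolding const_map_def by blast
    ultimately show ?case by simp
  next
    case (insert m S)
    have "homogeneous k (Poly_Mapping.single m (t m))" using insert.prems by (auto simp: homogeneous_def split: if_splits)
    then show ?case using insert mono[of m k "t m"]
      by (auto simp: addL intro!: homogeneous_add ring_set_add[OF RL])
  qed
  have homL: "\<phi> (rat_class g (?z ^ k)) \<in> L" if "homogeneous k g" for g k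
    using sumL[of "Poly_Mapping.keys g" k "Poly_Mapping.lookup g"] that mp_sum_monomials[of g] unfolding homogeneous_def by auto
  have "y \<in> L" for y
  proof -
    obtain g h where gh: "(g, h) \<in> rat_fracs V" "y = \<phi> (rat_class g h)" using phi_surj by blast
    obtain k a where ka: "homogeneous k g" "homogeneous k h" "a \<in> V" "mp_eval h a \<noteq> 0" using gh(1) by (rule rat_fracsE)
    have zh: "(?z ^ k, h) \<in> rat_fracs V" using hz ka(2,3,4) by (rule rat_fracsI)
    have hh: "(h, ?z ^ k) \<in> rat_fracs V" using ka(2) by (rule fr)
    have "rat_class (h * ?z ^ k) (?z ^ k * h) = rat_class 1 1"
      using rat_fracs_mult[OF hh zh] const_fracs[of 1] by (intro rat_class_eq) (auto simp: mp_const_def mp_eval_mult)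
    then have "\<phi> (rat_class h (?z ^ k)) * \<phi> (rat_class (?z ^ k) h) = 1" using phi_mult[OF hh zh] phi_one by simp
    then have ne: "\<phi> (rat_class h (?z ^ k)) \<noteq> 0" by auto
    have "rat_class (g * h) (h * ?z ^ k) = rat_class g (?z ^ k)"
      using rat_fracs_mult[OF gh(1) hh] fr[OF ka(1)] by (intro rat_class_eq) (auto simp: mp_eval_mult)
    then have "y * \<phi> (rat_class h (?z ^ k)) = \<phi> (rat_class g (?z ^ k))" using phi_mult[OF gh(1) hh] gh(2) by simp
    then have "y = \<phi> (rat_class g (?z ^ k)) / \<phi> (rat_class h (?z ^ k))" using ne by (simp add: field_simps)
    then show ?thesis using homL[OF ka(1)] homL[OF ka(2)] field_set_divide[OF L] by simp
  qed
  then show ?thesis unfolding L_def by (intro exI[of _ "map Y ns"]) auto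
qed

end

end

theorem theorem1p3:
  fixes V :: "(rat alg_closure ^ 'n::finite) set"
    and \<phi> :: "((rat alg_closure, 'n) mpoly \<times> (rat alg_closure, 'n) mpoly) set \<Rightarrow> 'k::field"
    and p q r :: nat and c \<beta> :: 'k and f :: "'k poly"
  assumes "smooth_projective_variety V"
    and "\<phi> \<in> ring_iso (function_field V) (ring_of_type_algebra :: 'k ring)"
    and "Factorial_Ring.prime p" and "r \<ge> 1" and "q = p ^ r"
    and "f = Polynomial.monom 1 q + [:c:]"
    and "c \<notin> \<phi> ` constant_functions V"
    and "\<not> periodic_point f \<beta>"
  shows "eventually_stable f \<beta>"
proof -
  have "projective_variety V" using assms(1) by (simp add: smooth_projective_variety_def)
  then interpret proj_variety V by unfold_locales
  obtain ys where ys: "adjs (range (const_map \<phi>)) ys = UNIV"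
    using function_field_finitely_generated[OF assms(2)] by blast
  have "c \<notin> range (const_map \<phi>)" using assms(7) range_const_map[OF assms(2)] by simp
  then show ?thesis
    using unicritical_eventually_stable[OF const_map_ring_map[OF assms(2)] ys _ assms(3,5,4)] assms(6,8) by simp
qed

end
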